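(* Let $\phi$ be a smooth Kähler potential on $\mathbb P^1$ (a smooth real function with $\omega_{FS}+dd^c\phi>0$). With $\psi_t$ ($t\in\mathbb R$) and $\tilde\Phi$ the envelopes on $\mathbb P^1$ and $\mathbb P^1\times\overline{\mathbb D}$ associated to $\phi$ as defined in the context, we have for all $z\in\mathbb P^1$ and $t\in\mathbb R$ $$\psi_t(z)=\inf_{0<|\tau|\le 1}\{\tilde\Phi(z,\tau)-(1-t)\ln|\tau|^2\},$$ and for all $z\in\mathbb P^1$ and $\tau\in\overline{\mathbb D}\setminus\{0\}$ $$\tilde\Phi(z,\tau)=\sup_{t\in\mathbb R}\{\psi_t(z)+(1-t)\ln|\tau|^2\}.$$
   Context: $\mathbb D\subset\mathbb C$ is the open unit disc and $\mathbb P^1=\mathbb C\cup\{\infty\}$. $\omega_{FS}$ is the Fubini-Study form, with $\omega_{FS}=dd^c\ln(1+|z|^2)$ on $\mathbb C$ and $dd^c$ normalized so that $dd^c\ln|z|^2=\delta_0$. $\pi\colon\mathbb P^1\times\overline{\mathbb D}\to\mathbb P^1$ is the projection. For $t\in\mathbb R$, $$\psi_t=\sup\{\psi:\psi\colon\mathbb P^1\to\mathbb R\cup\{-\infty\}\text{ usc},\ \omega_{FS}+dd^c\psi\ge0,\ \psi\le\phi,\ \nu_0(\psi)\ge t\},$$ where $\nu_0(\psi)\ge t$ means $\psi(z)\le t\ln|z|^2+C$ near $0\in\mathbb C\subset\mathbb P^1$ for some constant $C$. (For $t<0$ one has $\psi_t=\phi$, and for $t>1$ one has $\psi_t\equiv-\infty$.)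 $$\tilde\Phi=\sup\{\psi:\psi\text{ usc on }\mathbb P^1\times\overline{\mathbb D},\ \pi^*\omega_{FS}+dd^c\psi\ge0,\ \psi(z,\tau)\le\phi(z)\text{ for }\tau\in\partial\mathbb D,\ \nu_{(0,0)}(\psi)\ge1\},$$ where $\nu_{(0,0)}(\psi)\ge1$ means $\psi(z,\tau)\le\ln(|z|^2+|\tau|^2)+C$ near $(0,0)$ for some constant $C$. *)

theory Defs
  imports "HOL-Analysis.Analysis"
begin

section \<open>The projective line\<close>

text \<open>\<open>None\<close> is the point at infinity and \<open>Some z\<close> is the point \<open>z \<in> \<complex>\<close>.\<close>

type_synonym P1 = "complex option"

definition P1_top :: "P1 topology" where
  "P1_top = Alexandroff_compactification euclidean"

definition chart_infinity :: "complex \<Rightarrow> P1" where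
  "chart_infinity w = (if w = 0 then None else Some (1 / w))"

text \<open>Inverses of the two standard holomorphic charts, each parametrising an open subset of the
  projective line by \<open>\<complex>\<close>.\<close>

definition P1_charts :: "(complex \<Rightarrow> P1) set" where
  "P1_charts = {Some, chart_infinity}"

section \<open>Smooth Kaehler potentials\<close>

primrec Ck_on :: "nat \<Rightarrow> 'a::real_normed_vector set \<Rightarrow> ('a \<Rightarrow> real) \<Rightarrow> bool" where
  "Ck_on 0 S f \<longleftrightarrow> continuous_on S f"
| "Ck_on (Suc k) S f \<longleftrightarrow> (\<forall>x\<in>S. f differentiable (at x)) \<and>
     (\<forall>v. Ck_on k S (\<lambda>x. frechet_derivative f (at x) v))"

definition smooth_P1 :: "(P1 \<Rightarrow> real) \<Rightarrow> bool" where
  "smooth_P1 f \<longleftrightarrow> (\<forall>\<kappa>\<in>P1_charts. \<forall>k. Ck_on k UNIV (f \<circ> \<kappa>))"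

text \<open>The coefficient of \<open>dd\<^sup>c u\<close> with respect to \<open>dx \<and> dy\<close>. Since the distributional Laplacian
  of \<open>ln \<bar>z\<bar>\<^sup>2\<close> is \<open>4\<pi>\<delta>\<^sub>0\<close>, the factor \<open>1/(4\<pi>)\<close> is the normalisation \<open>dd\<^sup>c ln \<bar>z\<bar>\<^sup>2 = \<delta>\<^sub>0\<close>.\<close>

definition ddc :: "(complex \<Rightarrow> real) \<Rightarrow> complex \<Rightarrow> real" where
  "ddc u z = (\<Sum>b\<in>Basis. frechet_derivative (\<lambda>w. frechet_derivative u (at w) b) (at z) b) / (4 * pi)"

text \<open>A local potential of the Fubini-Study form in both charts: for \<open>w = 1/z\<close> one has
  \<open>ln (1 + \<bar>z\<bar>\<^sup>2) = ln (1 + \<bar>w\<bar>\<^sup>2) - ln \<bar>w\<bar>\<^sup>2\<close>, and \<open>ln \<bar>w\<bar>\<^sup>2\<close> is harmonic for \<open>w \<noteq> 0\<close>.\<close>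

definition FS_potential :: "complex \<Rightarrow> real" where
  "FS_potential z = ln (1 + (cmod z)\<^sup>2)"

definition kaehler_potential :: "(P1 \<Rightarrow> real) \<Rightarrow> bool" where
  "kaehler_potential \<phi> \<longleftrightarrow> smooth_P1 \<phi> \<and>
     (\<forall>\<kappa>\<in>P1_charts. \<forall>z. ddc FS_potential z + ddc (\<phi> \<circ> \<kappa>) z > 0)"

section \<open>Upper semicontinuous and plurisubharmonic functions\<close>

text \<open>Upper semicontinuous functions with values in \<open>\<real> \<union> {-\<infinity>}\<close>.\<close>

definition usc_on :: "'a topology \<Rightarrow> ('a \<Rightarrow> ereal) \<Rightarrow> bool" where
  "usc_on X f \<longleftrightarrow> (\<forall>c. openin X {x \<in> topspace X. f x < c}) \<and> (\<forall>x\<in>topspace X. f x \<noteq> \<infinity>)"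

text \<open>The mean of \<open>u\<close> over a circle, as the extended Lebesgue integral of the positive part minus
  that of the negative part (note that \<open>e2ennreal x\<close> is \<open>max 0 x\<close>). If \<open>u\<close> is upper semicontinuous
  the first integral is finite, so that the difference is meaningful; it may be \<open>-\<infinity>\<close>.\<close>

definition circle_mean :: "(complex \<Rightarrow> ereal) \<Rightarrow> complex \<Rightarrow> real \<Rightarrow> ereal" where
  "circle_mean u a r =
     (enn2ereal (\<integral>\<^sup>+\<theta>\<in>{0..2 * pi}. e2ennreal (u (a + of_real r * cis \<theta>)) \<partial>lborel)
      - enn2ereal (\<integral>\<^sup>+\<theta>\<in>{0..2 * pi}. e2ennreal (- u (a + of_real r * cis \<theta>)) \<partial>lborel))
     / ereal (2 * pi)"

text \<open>In the next two definitions \<open>U\<close> is meant to be open; the function that is identically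
  \<open>-\<infinity>\<close> is admitted.\<close>

definition subharmonic_on :: "complex set \<Rightarrow> (complex \<Rightarrow> ereal) \<Rightarrow> bool" where
  "subharmonic_on U u \<longleftrightarrow> usc_on (top_of_set U) u \<and>
     (\<forall>a r. 0 < r \<and> cball a r \<subseteq> U \<longrightarrow> u a \<le> circle_mean u a r)"

definition psh_on :: "(complex \<times> complex) set \<Rightarrow> (complex \<times> complex \<Rightarrow> ereal) \<Rightarrow> bool" where
  "psh_on U u \<longleftrightarrow> usc_on (top_of_set U) u \<and>
     (\<forall>a1 a2 b1 b2. subharmonic_on {l. (a1 + l * b1, a2 + l * b2) \<in> U}
        (\<lambda>l. u (a1 + l * b1, a2 + l * b2)))"

text \<open>For an upper semicontinuous \<open>\<psi>\<close>, the condition \<open>\<omega>\<^sub>F\<^sub>S + dd\<^sup>c \<psi> \<ge> 0\<close> has its usual pluripotential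
  meaning: \<open>\<psi>\<close> plus a local potential of the form is (pluri)subharmonic. (Positivity as a
  distribution alone would not see the values of \<open>\<psi>\<close> on null sets.)\<close>

definition FS_sh :: "(P1 \<Rightarrow> ereal) \<Rightarrow> bool" where
  "FS_sh \<psi> \<longleftrightarrow> (\<forall>\<kappa>\<in>P1_charts. subharmonic_on UNIV (\<lambda>z. ereal (FS_potential z) + \<psi> (\<kappa> z)))"

text \<open>The positivity of \<open>\<pi>\<^sup>*\<omega>\<^sub>F\<^sub>S + dd\<^sup>c \<psi>\<close>, over the open disc.\<close>

definition FS_psh_disc :: "(P1 \<times> complex \<Rightarrow> ereal) \<Rightarrow> bool" where
  "FS_psh_disc \<psi> \<longleftrightarrow> (\<forall>\<kappa>\<in>P1_charts.
     psh_on (UNIV \<times> ball 0 1) (\<lambda>(z, \<tau>). ereal (FS_potential z) + \<psi> (\<kappa> z, \<tau>)))"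

section \<open>The envelopes\<close>

text \<open>The logarithm on \<open>[0,\<infinity>)\<close>, with the value \<open>-\<infinity>\<close> at \<open>0\<close> (whereas \<open>ln 0 = 0\<close> for reals).\<close>

definition ln_ext :: "real \<Rightarrow> ereal" where
  "ln_ext x = (if x = 0 then -\<infinity> else ereal (ln x))"

text \<open>At \<open>z = 0\<close> the products below are \<open>-\<infinity>\<close>, \<open>0\<close>, \<open>\<infinity>\<close> for \<open>t > 0\<close>, \<open>t = 0\<close>, \<open>t < 0\<close>
  respectively.\<close>

definition lelong_ge :: "(P1 \<Rightarrow> ereal) \<Rightarrow> real \<Rightarrow> bool" where
  "lelong_ge \<psi> t \<longleftrightarrow> (\<exists>C::real. eventually
     (\<lambda>z. \<psi> (Some z) \<le> ereal t * ln_ext ((cmod z)\<^sup>2) + ereal C) (nhds 0))"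

definition lelong_ge_one_disc :: "(P1 \<times> complex \<Rightarrow> ereal) \<Rightarrow> bool" where
  "lelong_ge_one_disc \<psi> \<longleftrightarrow> (\<exists>C::real. eventually
     (\<lambda>(z, \<tau>). \<psi> (Some z, \<tau>) \<le> ln_ext ((cmod z)\<^sup>2 + (cmod \<tau>)\<^sup>2) + ereal C) (nhds (0, 0)))"

definition psi_env :: "(P1 \<Rightarrow> real) \<Rightarrow> real \<Rightarrow> P1 \<Rightarrow> ereal" where
  "psi_env \<phi> t z = (SUP \<psi> \<in> {\<psi>. usc_on P1_top \<psi> \<and> FS_sh \<psi> \<and> (\<forall>x. \<psi> x \<le> ereal (\<phi> x))
     \<and> lelong_ge \<psi> t}. \<psi> z)"

definition Phi_env :: "(P1 \<Rightarrow> real) \<Rightarrow> P1 \<times> complex \<Rightarrow> ereal" where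
  "Phi_env \<phi> p = (SUP \<psi> \<in> {\<psi>. usc_on (prod_topology P1_top (top_of_set (cball 0 1))) \<psi>
     \<and> FS_psh_disc \<psi> \<and> (\<forall>x. \<forall>\<tau>\<in>sphere 0 1. \<psi> (x, \<tau>) \<le> ereal (\<phi> x))
     \<and> lelong_ge_one_disc \<psi>}. \<psi> p)"

end

theory Submission
  imports Defs "HOL-Complex_Analysis.Complex_Analysis"
begin

text \<open>If \<open>\<psi>\<close> competes for \<open>\<psi>\<^sub>t\<close> with \<open>0 \<le> t \<le> 1\<close>, then \<open>\<psi>(z) + (1 - t) ln \<bar>\<tau>\<bar>\<^sup>2\<close> competes for the envelope on the
  product. Conversely, let \<open>S\<close> compete on the product; replacing it by the supremum over rotations of \<open>\<tau>\<close>,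
  we may assume that it depends on \<open>\<bar>\<tau>\<bar>\<close> only, hence is convex in \<open>s = ln \<bar>\<tau>\<bar>\<close>. By Kiselman's minimum
  principle the infimum over \<open>s < 0\<close> of \<open>S - 2 (1 - t) s\<close> competes for \<open>\<psi>\<^sub>t\<close>, for every real \<open>t\<close>, and a
  supporting line of the convex function recovers \<open>S\<close> from these infima. This is the second identity. The
  first one is the biduality for the concave function \<open>t \<mapsto> \<psi>\<^sub>t(z)\<close>, which requires left continuity
  at the endpoint \<open>t = 1\<close> of its domain.

  Subharmonicity is handled throughout by harmonic majorants: \<open>f\<close> satisfies the mean value inequality on a
  circle iff \<open>f < Re p\<close> on the circle implies \<open>f \<le> Re p\<close> at the centre, for all entire \<open>p\<close>.\<close>

section \<open>Upper semicontinuity\<close>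

text \<open>The exception is t = 1. There t \<mapsto> \<open>psi_env \<phi> t z\<close> drops to
  -\<infinity> just to the right, biduality returns the left limit, and equality with the value
  itself has to be earned by exhibiting a regularised limit of envelopes as a candidate.

  Two further obstacles shape the proof. Values may be -\<infinity>, so convexity and subharmonicity
  are expressed through real affine or harmonic majorants; tests of this kind survive suprema and
  infima without any discussion of measurability. And plurisubharmonicity is given on complex lines
  only, whereas minimising over s produces curved holomorphic graphs, so the passage from lines to
  graphs has to be proved.

  The slope m of a supporting line in s corresponds to t through m = 2 (1 - t), because (1 - t) ln
  |\<tau>|^2 = 2 (1 - t) s. A supporting slope can be any real number, which is why minimisation
  must yield a candidate for every real t.\<close>

lemma usc_on_compose:
  assumes "continuous_map X Y h" "usc_on Y f"
  shows "usc_on X (\<lambda>x. f (h x))"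
  unfolding usc_on_def
proof safe
  fix c
  have "{x \<in> topspace X. f (h x) < c} = {x \<in> topspace X. h x \<in> {y \<in> topspace Y. f y < c}}"
    using assms(1) by (auto simp: continuous_map_def)
  moreover have "openin X {x \<in> topspace X. h x \<in> {y \<in> topspace Y. f y < c}}"
    by (rule openin_continuous_map_preimage[OF assms(1)]) (use assms(2) in \<open>auto simp: usc_on_def\<close>)
  ultimately show "openin X {x \<in> topspace X. f (h x) < c}" by simp
next
  fix x assume "x \<in> topspace X" "f (h x) = \<infinity>"
  then show False using assms by (auto simp: usc_on_def continuous_map_def)
qed

text \<open>Needed to write a sublevel set of a sum as a union of intersections of sublevel sets. If
  one summand is -\<infinity>, the other is bounded first and the infinite one takes whatever is
  left.\<close>

lemma ereal_add_less_split:
  fixes x y c :: ereal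
  assumes "x + y < c" "x \<noteq> \<infinity>" "y \<noteq> \<infinity>"
  obtains a b where "x < ereal a" "y < ereal b" "ereal (a + b) \<le> c"
proof (cases x)
  case (real x')
  show thesis
  proof (cases y)
    case (real y')
    have "ereal (x' + y') < c" using assms \<open>x = ereal x'\<close> real by simp
    then obtain d where d: "x' + y' < d" "ereal d < c" using ereal_dense2[of "ereal (x'+y')" c] by auto
    show thesis
      by (rule that[of "x' + (d - x' - y')/2" "y' + (d - x' - y')/2"])
         (use d \<open>x = ereal x'\<close> real in \<open>auto simp: field_simps\<close>)
  next
    case MInf
    have "-\<infinity> < c" using assms(1) by (rule le_less_trans[rotated]) simp
    then obtain d where d: "ereal d < c" using ereal_dense2[of "-\<infinity>" c] by auto
    show thesis
      by (rule that[of "x' + 1" "d - x' - 1"]) (use d real MInf in auto)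
  qed (use assms in auto)
next
  case MInf
  have "-\<infinity> < c" using assms(1) by (rule le_less_trans[rotated]) simp
  then obtain d where d: "ereal d < c" using ereal_dense2[of "-\<infinity>" c] by auto
  obtain b where "y < ereal b" using assms(3) ereal_dense2[of y \<infinity>] by auto
  then show thesis
    by (intro that[of "d - b" b]) (use d MInf in auto)
qed (use assms in auto)

lemma usc_on_add:
  assumes f: "usc_on X f" and g: "usc_on X g"
  shows "usc_on X (\<lambda>x. f x + g x)"
  unfolding usc_on_def
proof safe
  fix c
  let ?I = "{(a, b). ereal (a + b) \<le> c}"
  have "{x \<in> topspace X. f x + g x < c} =
     (\<Union>(a, b)\<in>?I. {x \<in> topspace X. f x < ereal a} \<inter> {x \<in> topspace X. g x < ereal b})" (is "?L = ?R")
  proof (intro equalityI subsetI)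
    fix x assume x: "x \<in> ?L"
    then have "f x + g x < c" "f x \<noteq> \<infinity>" "g x \<noteq> \<infinity>" using f g by (auto simp: usc_on_def)
    then obtain a b where "f x < ereal a" "g x < ereal b" "ereal (a + b) \<le> c"
      by (rule ereal_add_less_split)
    then show "x \<in> ?R" using x by (auto intro!: bexI[of _ "(a, b)"])
  next
    fix x assume "x \<in> ?R"
    then obtain a b where x: "x \<in> topspace X" "ereal (a + b) \<le> c" "f x < ereal a" "g x < ereal b" by auto
    then have "f x + g x < ereal a + ereal b" by (intro ereal_add_strict_mono2)
    then show "x \<in> ?L" using x by auto
  qed
  also have "openin X \<dots>"
    using f g by (intro openin_Union) (auto simp: usc_on_def intro!: openin_Int)
  finally show "openin X ?L" .
next
  fix x assume "x \<in> topspace X" "f x + g x = \<infinity>"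
  then show False using f g by (auto simp: usc_on_def)
qed

lemma usc_on_INF:
  assumes "\<And>i. i \<in> I \<Longrightarrow> usc_on X (f i)" "I \<noteq> {}"
  shows "usc_on X (\<lambda>x. INF i\<in>I. f i x)"
  unfolding usc_on_def
proof safe
  fix c
  have "{x \<in> topspace X. (INF i\<in>I. f i x) < c} = (\<Union>i\<in>I. {x \<in> topspace X. f i x < c})"
    by (auto simp: INF_less_iff)
  also have "openin X \<dots>"
    using assms by (intro openin_Union) (auto simp: usc_on_def)
  finally show "openin X {x \<in> topspace X. (INF i\<in>I. f i x) < c}" .
next
  fix x assume x: "x \<in> topspace X" "(INF i\<in>I. f i x) = \<infinity>"
  from assms(2) obtain i where i: "i \<in> I" by auto
  have "f i x = \<infinity>" using x(2) i by (metis INF_lower ereal_infty_less_eq(1))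
  then show False using assms(1)[OF i] x by (auto simp: usc_on_def)
qed

lemma usc_on_subset:
  assumes "usc_on (top_of_set S) f" "T \<subseteq> S"
  shows "usc_on (top_of_set T) f"
  using usc_on_compose[of "top_of_set T" "top_of_set S" "\<lambda>x. x" f] assms by auto

lemma usc_on_cong:
  assumes "usc_on X f" "\<And>x. x \<in> topspace X \<Longrightarrow> f x = g x"
  shows "usc_on X g"
proof -
  have "{x \<in> topspace X. g x < c} = {x \<in> topspace X. f x < c}" for c using assms(2) by auto
  then show ?thesis using assms by (auto simp: usc_on_def)
qed

lemma usc_on_ereal:
  assumes "continuous_on S g"
  shows "usc_on (top_of_set S) (\<lambda>x. ereal (g x))"
  unfolding usc_on_def
proof safe
  fix c
  have "openin (top_of_set S) (S \<inter> (\<lambda>x. ereal (g x)) -` {..<c})"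
    by (rule continuous_openin_preimage_gen) (auto intro!: continuous_intros assms)
  moreover have "S \<inter> (\<lambda>x. ereal (g x)) -` {..<c} = {x \<in> topspace (top_of_set S). ereal (g x) < c}"
    by auto
  ultimately show "openin (top_of_set S) {x \<in> topspace (top_of_set S). ereal (g x) < c}" by simp
qed auto

text \<open>Without a maximum the open sets {f < f y} would cover the space. Among the finitely many
  y of a subcover, one with the largest value of f lies in none of these sets.\<close>

lemma usc_on_attains_sup:
  assumes "compact_space X" "topspace X \<noteq> {}" "usc_on X f"
  obtains x where "x \<in> topspace X" "\<And>y. y \<in> topspace X \<Longrightarrow> f y \<le> f x"
proof (rule ccontr)
  assume "\<not> thesis"
  then have *: "\<forall>x\<in>topspace X. \<exists>y\<in>topspace X. f x < f y" using that by (meson not_le)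
  let ?C = "(\<lambda>y. {x \<in> topspace X. f x < f y}) ` topspace X"
  have "\<And>U. U \<in> ?C \<Longrightarrow> openin X U" using assms(3) by (auto simp: usc_on_def)
  moreover have "topspace X \<subseteq> \<Union>?C" using * by auto
  ultimately obtain F where F: "finite F" "F \<subseteq> ?C" "topspace X \<subseteq> \<Union>F"
    using assms(1) unfolding compact_space_alt by meson
  obtain Y where Y: "finite Y" "Y \<subseteq> topspace X" "F = (\<lambda>y. {x \<in> topspace X. f x < f y}) ` Y"
    using finite_subset_image[OF F(1,2)] by blast
  have "Y \<noteq> {}" using F(3) Y assms(2) by auto
  have "Max (f ` Y) \<in> f ` Y" using Y \<open>Y \<noteq> {}\<close> by (intro Max_in) auto
  then obtain y where y: "y \<in> Y" "f y = Max (f ` Y)" by auto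
  then have "y \<in> topspace X" using Y by auto
  then obtain y' where "y' \<in> Y" "f y < f y'" using F(3) Y by auto
  then show False using y Y by (metis Max_ge finite_imageI image_eqI leD)
qed

lemma usc_on_compact_attains_sup:
  fixes f :: "'a::topological_space \<Rightarrow> ereal"
  assumes "compact S" "S \<noteq> {}" "usc_on (top_of_set S) f"
  obtains x where "x \<in> S" "\<And>y. y \<in> S \<Longrightarrow> f y \<le> f x"
  using usc_on_attains_sup[of "top_of_set S" f] assms
  by (metis compact_space_subtopology compactin_euclidean_iff topspace_euclidean_subtopology)

text \<open>Projection along a compact factor is a closed map, and since the supremum is attained,
  its superlevel set is the projection of the superlevel set of \<open>g\<close>.\<close>

lemma usc_on_SUP_compact:
  assumes "usc_on (prod_topology X Y) g" "compact_space Y" "topspace Y \<noteq> {}"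
  shows "usc_on X (\<lambda>x. SUP y\<in>topspace Y. g (x, y))"
proof -
  have att: "\<exists>y\<in>topspace Y. (SUP y\<in>topspace Y. g (x, y)) = g (x, y)" if "x \<in> topspace X" for x
  proof -
    have "continuous_map Y (prod_topology X Y) (\<lambda>y. (x, y))"
      using that by (intro continuous_map_pairedI) auto
    then have "usc_on Y (\<lambda>y. g (x, y))" by (rule usc_on_compose[OF _ assms(1)])
    then obtain y where "y \<in> topspace Y" "\<And>z. z \<in> topspace Y \<Longrightarrow> g (x, z) \<le> g (x, y)"
      using usc_on_attains_sup assms(2,3) by meson
    then show ?thesis by (intro bexI[of _ y] antisym SUP_least SUP_upper)
  qed
  show ?thesis unfolding usc_on_def
  proof safe
    fix c
    let ?P = "prod_topology X Y"
    have "closedin ?P (topspace ?P - {p \<in> topspace ?P. g p < c})"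
      using assms(1) unfolding usc_on_def by (intro closedin_diff closedin_topspace) auto
    then have "closedin X (fst ` (topspace ?P - {p \<in> topspace ?P. g p < c}))"
      using closed_map_fst[OF assms(2), of X] by (auto simp: closed_map_def)
    moreover have "{x \<in> topspace X. (SUP y\<in>topspace Y. g (x, y)) < c} =
        topspace X - fst ` (topspace ?P - {p \<in> topspace ?P. g p < c})" (is "?L = ?R")
    proof (intro equalityI subsetI)
      fix x assume x: "x \<in> ?L"
      then have "g (x, y) < c" if "y \<in> topspace Y" for y using that by (auto dest: SUP_lessD)
      then show "x \<in> ?R" using x by auto
    next
      fix x assume x: "x \<in> ?R"
      obtain y where y: "y \<in> topspace Y" "(SUP y\<in>topspace Y. g (x, y)) = g (x, y)" using att x by auto
      have "g (x, y) < c"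
      proof (rule ccontr)
        assume "\<not> g (x, y) < c"
        then have "(x, y) \<in> topspace ?P - {p \<in> topspace ?P. g p < c}" using x y by auto
        then have "fst (x, y) \<in> fst ` (topspace ?P - {p \<in> topspace ?P. g p < c})" by blast
        then show False using x by simp
      qed
      then show "x \<in> ?L" using x y by auto
    qed
    ultimately show "openin X {x \<in> topspace X. (SUP y\<in>topspace Y. g (x, y)) < c}" by auto
  next
    fix x assume "x \<in> topspace X" "(SUP y\<in>topspace Y. g (x, y)) = \<infinity>"
    then obtain y where "y \<in> topspace Y" "g (x, y) = \<infinity>" using att[of x] by metis
    then show False using \<open>x \<in> topspace X\<close> assms(1) by (auto simp: usc_on_def)
  qed
qed

text \<open>Truncation below at -n followed by sup-convolution with n times the distance gives
  n-Lipschitz functions that decrease to \<open>f\<close>. They reduce statements on means of usc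
  functions to continuous integrands.\<close>

lemma usc_on_approx:
  fixes f :: "'a::metric_space \<Rightarrow> ereal"
  assumes S: "compact S" and f: "usc_on (top_of_set S) f"
  obtains q :: "nat \<Rightarrow> 'a \<Rightarrow> real" where "\<And>n. continuous_on S (q n)"
    "\<And>n x. x \<in> S \<Longrightarrow> f x < ereal (q n x)" "\<And>x. x \<in> S \<Longrightarrow> decseq (\<lambda>n. q n x)"
    "\<And>x. x \<in> S \<Longrightarrow> (\<lambda>n. ereal (q n x)) \<longlonglongrightarrow> f x"
proof (cases "S = {}")
  case True
  then show thesis by (intro that[of "\<lambda>n x. 0"]) auto
next
  case False
  obtain x0 where x0: "x0 \<in> S" "\<And>y. y \<in> S \<Longrightarrow> f y \<le> f x0"
    using usc_on_compact_attains_sup[OF S False f] by metis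
  have "f x0 \<noteq> \<infinity>" using f x0 by (auto simp: usc_on_def)
  then obtain M0 where "f x0 < ereal M0" using ereal_dense2[of "f x0" \<infinity>] by auto
  define M where "M = max M0 0"
  have M: "f y \<le> ereal M" "0 \<le> M" if "y \<in> S" for y
    using x0(2)[OF that] \<open>f x0 < ereal M0\<close> unfolding M_def
    by (metis ereal_less_eq(3) less_imp_le max.cobounded1 order_trans) simp
  define g where "g n y = real_of_ereal (max (f y) (ereal (- real n)))" for n :: nat and y
  have g: "ereal (g n y) = max (f y) (ereal (- real n))" if "y \<in> S" for n y
  proof -
    have "\<bar>max (f y) (ereal (- real n))\<bar> \<noteq> \<infinity>"
      using M(1)[OF that] by (cases "f y") (auto simp: max_def)
    then show ?thesis unfolding g_def by (simp add: ereal_real)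
  qed
  have gM: "g n y \<le> M" if "y \<in> S" for n y
  proof -
    have "ereal (g n y) \<le> ereal M" unfolding g[OF that] using M[OF that] by (auto intro: order_trans[of _ 0])
    then show ?thesis by simp
  qed
  have gdec: "g n y \<le> g m y" if "y \<in> S" "m \<le> n" for m n y
  proof -
    have "ereal (g n y) \<le> ereal (g m y)" unfolding g[OF that(1)] using that by (intro max.mono) auto
    then show ?thesis by simp
  qed
  define h where "h n x = (SUP y\<in>S. g n y - real n * dist x y)" for n x
  have bdd: "bdd_above ((\<lambda>y. g n y - real n * dist x y) ` S)" for n x
    by (rule bdd_aboveI2[of _ _ M]) (use gM in \<open>smt (verit) mult_nonneg_nonneg of_nat_0_le_iff zero_le_dist\<close>)
  have lip: "h n x \<le> h n x' + real n * dist x x'" for n x x'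
    unfolding h_def
  proof (rule cSUP_least[OF False])
    fix y assume y: "y \<in> S"
    have "g n y - real n * dist x' y \<le> (SUP y\<in>S. g n y - real n * dist x' y)"
      by (rule cSUP_upper[OF y bdd])
    moreover have "real n * dist x' y \<le> real n * (dist x x' + dist x y)"
      by (intro mult_left_mono) (metis dist_commute dist_triangle, simp)
    ultimately show "g n y - real n * dist x y \<le> (SUP y\<in>S. g n y - real n * dist x' y) + real n * dist x x'"
      by (simp add: algebra_simps)
  qed
  have cont: "continuous_on S (h n)" for n
  proof (rule continuous_onI)
    fix x and e :: real assume "x \<in> S" "0 < e"
    show "\<exists>d>0. \<forall>x'\<in>S. dist x' x < d \<longrightarrow> dist (h n x') (h n x) \<le> e"
    proof (intro exI[of _ "e / (real n + 1)"] conjI ballI impI)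
      show "0 < e / (real n + 1)" using \<open>0 < e\<close> by simp
      fix x' assume "dist x' x < e / (real n + 1)"
      then have "dist x' x * (real n + 1) < e" by (simp add: field_simps)
      then have "real n * dist x' x \<le> e" using zero_le_dist[of x' x] unfolding distrib_left mult.right_neutral mult.commute[of _ "real n"] by linarith
      then show "dist (h n x') (h n x) \<le> e"
        using lip[of n x x'] lip[of n x' x] by (simp add: dist_real_def dist_commute abs_le_iff)
    qed
  qed
  have hg: "g n x \<le> h n x" if "x \<in> S" for n x
    using cSUP_upper[OF that bdd, of n x] by (simp add: h_def)
  \<comment> \<open>The extra 1/(n+1) makes the majorant strict even where the sup-convolution
    touches \<open>f\<close>.\<close>
  have fh: "f x < ereal (h n x + 1 / (real n + 1))" if "x \<in> S" for n x
  proof -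
    have "f x \<le> ereal (g n x)" unfolding g[OF that] by simp
    also have "\<dots> < ereal (h n x + 1 / (real n + 1))"
    proof -
      have "0 < 1 / (real n + 1)" by simp
      then show ?thesis using hg[OF that, of n] unfolding less_ereal.simps by linarith
    qed
    finally show ?thesis .
  qed
  have hdec: "h n x \<le> h m x" if "m \<le> n" for m n x
    unfolding h_def
  proof (rule cSUP_mono[OF False bdd])
    fix y assume y: "y \<in> S"
    have "real m * dist x y \<le> real n * dist x y" using that by (intro mult_right_mono) auto
    then show "\<exists>k\<in>S. g n y - real n * dist x y \<le> g m k - real m * dist x k"
      using gdec[OF y that] y by (intro bexI[of _ y]) auto
  qed
  have lim: "(\<lambda>n. ereal (h n x + 1 / (real n + 1))) \<longlonglongrightarrow> f x" if x: "x \<in> S" for x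
  proof (rule order_tendstoI)
    fix a assume "a < f x"
    then show "\<forall>\<^sub>F n in sequentially. a < ereal (h n x + 1 / (real n + 1))"
      by (intro always_eventually allI less_trans[OF _ fh[OF x]])
  next
    fix a assume "f x < a"
    then obtain b where b: "f x < ereal b" "ereal b < a" using ereal_dense2 by blast
    then obtain c where c: "f x < ereal c" "ereal c < ereal b" using ereal_dense2 by blast
    have "openin (top_of_set S) {y \<in> S. f y < ereal c}" using f by (auto simp: usc_on_def)
    then obtain d where d: "d > 0" "\<And>y. y \<in> S \<Longrightarrow> dist y x < d \<Longrightarrow> f y < ereal c"
      unfolding openin_euclidean_subtopology_iff using c(1) x by blast
    \<comment> \<open>For large n the truncation level is below \<open>c\<close>, points at distance
      at least \<open>d\<close> are penalised below \<open>c\<close>, and 1/(n+1) fits into the gap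
      between \<open>c\<close> and \<open>b\<close>.\<close>
    have "\<forall>\<^sub>F n in sequentially. - c < real n" by real_asymp
    moreover have "\<forall>\<^sub>F n in sequentially. M - real n * d < c" using d(1) by real_asymp
    moreover have "\<forall>\<^sub>F n in sequentially. c + 1 / (real n + 1) < b" using c(2) by simp real_asymp
    ultimately show "\<forall>\<^sub>F n in sequentially. ereal (h n x + 1 / (real n + 1)) < a"
    proof eventually_elim
      case (elim n)
      have "h n x \<le> c" unfolding h_def
      proof (rule cSUP_least[OF False])
        fix y assume y: "y \<in> S"
        show "g n y - real n * dist x y \<le> c"
        proof (cases "dist y x < d")
          case True
          have "ereal (g n y) \<le> ereal c" unfolding g[OF y] using d(2)[OF y True] elim(1) by auto
          then show ?thesis by (smt (verit) ereal_less_eq(3) mult_nonneg_nonneg of_nat_0_le_iff zero_le_dist)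
        next
          case False
          then have "real n * d \<le> real n * dist x y" by (intro mult_left_mono) (auto simp: dist_commute)
          then show ?thesis using gM[OF y, of n] elim(2) by linarith
        qed
      qed
      then have "ereal (h n x + 1 / (real n + 1)) < ereal b" using elim(3) by simp
      then show ?case using b(2) by (rule less_trans)
    qed
  qed
  show thesis
  proof (rule that[of "\<lambda>n x. h n x + 1 / (real n + 1)"])
    show "continuous_on S (\<lambda>x. h n x + 1 / (real n + 1))" for n by (intro continuous_intros cont)
    show "decseq (\<lambda>n. h n x + 1 / (real n + 1))" for x
      unfolding decseq_def by (auto intro!: add_mono hdec divide_left_mono)
  qed (use fh lim in auto)
qed

section \<open>Circle means and harmonic majorants\<close>

definition cmean :: "(complex \<Rightarrow> real) \<Rightarrow> complex \<Rightarrow> real \<Rightarrow> real" where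
  "cmean q a r = integral {0..2 * pi} (\<lambda>\<theta>. q (a + of_real r * cis \<theta>)) / (2 * pi)"

lemma continuous_on_circle_param:
  assumes "continuous_on (sphere a r) q" "0 \<le> r"
  shows "continuous_on T (\<lambda>\<theta>. q (a + of_real r * cis \<theta>))"
  by (rule continuous_on_compose2[OF assms(1)])
     (use assms(2) in \<open>auto intro!: continuous_intros simp: dist_norm norm_mult\<close>)

lemma cmean_integrable:
  fixes q :: "complex \<Rightarrow> real"
  assumes "continuous_on (sphere a r) q" "0 \<le> r"
  shows "(\<lambda>\<theta>. q (a + of_real r * cis \<theta>)) integrable_on {0..2 * pi}"
  by (rule integrable_continuous_real, rule continuous_on_circle_param[OF assms])

lemma cmean_add:
  assumes "continuous_on (sphere a r) p" "continuous_on (sphere a r) q" "0 \<le> r"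
  shows "cmean (\<lambda>z. p z + q z) a r = cmean p a r + cmean q a r"
  unfolding cmean_def
  by (subst Henstock_Kurzweil_Integration.integral_add)
     (auto intro!: cmean_integrable assms simp: add_divide_distrib)

lemma cmean_const [simp]: "cmean (\<lambda>z. c) a r = c"
  unfolding cmean_def by simp

lemma cmean_mono:
  assumes "continuous_on (sphere a r) p" "continuous_on (sphere a r) q" "0 \<le> r"
    and "\<And>z. z \<in> sphere a r \<Longrightarrow> p z \<le> q z"
  shows "cmean p a r \<le> cmean q a r"
  unfolding cmean_def
  by (intro divide_right_mono integral_le cmean_integrable assms)
     (use assms(3) in \<open>auto simp: dist_norm norm_mult\<close>)

text \<open>Cauchy's integral formula written in the angle: the factor r e^(it) of dz cancels the
  denominator, and the remaining \<i> is divided out before taking real parts.\<close>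

lemma cmean_Re_holomorphic:
  assumes hol: "f holomorphic_on S" and S: "open S" "cball a r \<subseteq> S" and r: "0 < r"
  shows "cmean (\<lambda>z. Re (f z)) a r = Re (f a)"
proof -
  have "((\<lambda>u. f u / (u - a)) has_contour_integral (2 * of_real pi * \<i> * f a)) (circlepath a r)"
  proof (rule Cauchy_integral_circlepath)
    show "continuous_on (cball a r) f"
      using hol S by (meson continuous_on_subset holomorphic_on_imp_continuous_on)
    show "f holomorphic_on ball a r"
      using hol S ball_subset_cball by (meson holomorphic_on_subset order_trans)
  qed (use r in auto)
  then have "((\<lambda>t. f (a + r * cis t) / (a + r * cis t - a) * r * \<i> * cis t)
      has_integral (2 * of_real pi * \<i> * f a)) {0..2 * pi}"
    unfolding circlepath_def by (subst (asm) has_contour_integral_part_circlepath_iff) auto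
  then have "((\<lambda>t. \<i> * f (a + r * cis t)) has_integral (2 * of_real pi * \<i> * f a)) {0..2 * pi}"
    by (rule has_integral_eq[rotated]) (use r in \<open>simp add: field_simps\<close>)
  then have "((\<lambda>t. - \<i> * (\<i> * f (a + r * cis t))) has_integral (- \<i> * (2 * of_real pi * \<i> * f a))) {0..2 * pi}"
    by (rule has_integral_mult_right)
  then have "((\<lambda>t. f (a + r * cis t)) has_integral (2 * of_real pi * f a)) {0..2 * pi}"
    by (simp add: algebra_simps)
  then have "((\<lambda>t. Re (f (a + r * cis t))) has_integral Re (2 * of_real pi * f a)) {0..2 * pi}"
    by (rule has_integral_Re)
  then show ?thesis unfolding cmean_def by (simp add: integral_unique)
qed

lemma circle_mean_mono:
  assumes "\<And>z. z \<in> sphere a r \<Longrightarrow> f z \<le> g z" "0 \<le> r"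
  shows "circle_mean f a r \<le> circle_mean g a r"
proof -
  have le: "f (a + r * cis t) \<le> g (a + r * cis t)" for t
    using assms by (auto simp: dist_norm norm_mult)
  show ?thesis unfolding circle_mean_def
    by (intro ereal_divide_right_mono ereal_minus_mono less_eq_ennreal.rep_eq[THEN iffD1] nn_integral_mono mult_right_mono e2ennreal_mono)
       (use le in auto)
qed

text \<open>For a continuous function both extended integrals are finite, so
  \<open>circle_mean\<close> is the ordinary mean. The finiteness and measurability parts prepare
  the passage to decreasing limits.\<close>

lemma
  fixes q :: "complex \<Rightarrow> real"
  assumes q: "continuous_on (sphere a r) q" and r: "0 \<le> r"
  shows circle_mean_ereal: "circle_mean (\<lambda>z. ereal (q z)) a r = ereal (cmean q a r)"
    and circle_mean_pos_finite:
      "(\<integral>\<^sup>+\<theta>\<in>{0..2 * pi}. e2ennreal (ereal (q (a + of_real r * cis \<theta>))) \<partial>lborel) < \<infinity>"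
    and circle_mean_pos_measurable: "(\<lambda>\<theta>. e2ennreal (ereal (q (a + of_real r * cis \<theta>))) *
      indicator {0..2 * pi} \<theta>) \<in> borel_measurable lborel"
    and circle_mean_neg_measurable: "(\<lambda>\<theta>. e2ennreal (- ereal (q (a + of_real r * cis \<theta>))) *
      indicator {0..2 * pi} \<theta>) \<in> borel_measurable lborel"
proof -
  let ?g = "\<lambda>\<theta>. indicator {0..2 * pi} \<theta> *\<^sub>R q (a + of_real r * cis \<theta>)"
  have set: "set_integrable lborel {0..2 * pi} (\<lambda>\<theta>. q (a + of_real r * cis \<theta>))"
    by (rule borel_integrable_atLeastAtMost', rule continuous_on_circle_param[OF q r])
  then have int: "integrable lborel ?g" unfolding set_integrable_def .
  have pos: "e2ennreal (ereal (q (a + of_real r * cis \<theta>))) * indicator {0..2 * pi} \<theta> = ennreal (?g \<theta>)" for \<theta>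
    by (auto simp: indicator_def)
  have neg: "e2ennreal (- ereal (q (a + of_real r * cis \<theta>))) * indicator {0..2 * pi} \<theta> = ennreal (- ?g \<theta>)" for \<theta>
    by (auto simp: indicator_def)
  show "(\<lambda>\<theta>. e2ennreal (ereal (q (a + of_real r * cis \<theta>))) * indicator {0..2 * pi} \<theta>) \<in> borel_measurable lborel"
    unfolding pos using borel_measurable_integrable[OF int] by measurable
  show "(\<lambda>\<theta>. e2ennreal (- ereal (q (a + of_real r * cis \<theta>))) * indicator {0..2 * pi} \<theta>) \<in> borel_measurable lborel"
    unfolding neg using borel_measurable_integrable[OF int] by measurable
  have fin: "(\<integral>\<^sup>+\<theta>. ennreal (?g \<theta>) \<partial>lborel) < \<infinity>" "(\<integral>\<^sup>+\<theta>. ennreal (- ?g \<theta>) \<partial>lborel) < \<infinity>"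
    using int unfolding real_integrable_def by (auto simp: top.not_eq_extremum)
  then show "(\<integral>\<^sup>+\<theta>\<in>{0..2 * pi}. e2ennreal (ereal (q (a + of_real r * cis \<theta>))) \<partial>lborel) < \<infinity>"
    unfolding pos by simp
  have "integral {0..2 * pi} (\<lambda>\<theta>. q (a + of_real r * cis \<theta>)) = (\<integral>\<theta>. ?g \<theta> \<partial>lborel)"
    using set_borel_integral_eq_integral(2)[OF set] by (simp add: set_lebesgue_integral_def)
  also have "\<dots> = enn2real (\<integral>\<^sup>+\<theta>. ennreal (?g \<theta>) \<partial>lborel) - enn2real (\<integral>\<^sup>+\<theta>. ennreal (- ?g \<theta>) \<partial>lborel)"
    by (rule real_lebesgue_integral_def[OF int])
  finally have *: "integral {0..2 * pi} (\<lambda>\<theta>. q (a + of_real r * cis \<theta>)) = \<dots>" .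
  have e: "enn2ereal x = ereal (enn2real x)" if "x < \<infinity>" for x
    using that by (metis enn2ereal_ennreal enn2real_nonneg ennreal_enn2real infinity_ennreal_def)
  show "circle_mean (\<lambda>z. ereal (q z)) a r = ereal (cmean q a r)"
    unfolding circle_mean_def cmean_def * pos neg e[OF fin(1)] e[OF fin(2)] by simp
qed

text \<open>Positive parts are dominated by that of the first function, negative parts increase, so
  dominated and monotone convergence apply separately. The limit of the positive parts is finite,
  hence the difference converges even if the mean is -\<infinity>.\<close>

lemma circle_mean_LIMSEQ:
  assumes q: "\<And>n. continuous_on (sphere a r) (q n)" and r: "0 \<le> r"
    and dec: "\<And>z. z \<in> sphere a r \<Longrightarrow> decseq (\<lambda>n. q n z)"
    and lim: "\<And>z. z \<in> sphere a r \<Longrightarrow> (\<lambda>n. ereal (q n z)) \<longlonglongrightarrow> f z"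
  shows "(\<lambda>n. ereal (cmean (q n) a r)) \<longlonglongrightarrow> circle_mean f a r"
proof -
  let ?z = "\<lambda>\<theta>. a + of_real r * cis \<theta>"
  let ?P = "\<lambda>n \<theta>. e2ennreal (ereal (q n (?z \<theta>))) * indicator {0..2 * pi} \<theta>"
  let ?N = "\<lambda>n \<theta>. e2ennreal (- ereal (q n (?z \<theta>))) * indicator {0..2 * pi} \<theta>"
  let ?P' = "\<lambda>\<theta>. e2ennreal (f (?z \<theta>)) * indicator {0..2 * pi} \<theta>"
  let ?N' = "\<lambda>\<theta>. e2ennreal (- f (?z \<theta>)) * indicator {0..2 * pi} \<theta>"
  have z: "?z \<theta> \<in> sphere a r" for \<theta> using r by (auto simp: dist_norm norm_mult)
  note meas = circle_mean_pos_measurable[OF q r] circle_mean_neg_measurable[OF q r]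
  have Plim: "(\<lambda>n. ?P n \<theta>) \<longlonglongrightarrow> ?P' \<theta>" for \<theta>
    using tendsto_e2ennrealI[OF lim[OF z, of \<theta>]] by (cases "\<theta> \<in> {0..2 * pi}") auto
  have Nlim: "(\<lambda>n. ?N n \<theta>) \<longlonglongrightarrow> ?N' \<theta>" for \<theta>
    using tendsto_e2ennrealI[OF tendsto_uminus_ereal[OF lim[OF z, of \<theta>]]]
    by (cases "\<theta> \<in> {0..2 * pi}") auto
  have Pmeas: "?P' \<in> borel_measurable lborel" by (rule borel_measurable_LIMSEQ_order[OF Plim meas(1)])
  have le: "q n (?z \<theta>) \<le> q m (?z \<theta>)" if "m \<le> n" for m n \<theta> using dec[OF z] that by (auto simp: decseq_def)
  have Pint: "(\<lambda>n. integral\<^sup>N lborel (?P n)) \<longlonglongrightarrow> integral\<^sup>N lborel ?P'"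
  proof (rule nn_integral_dominated_convergence[of _ _ _ "?P 0"])
    show "\<And>j. AE x in lborel. ?P j x \<le> ?P 0 x"
      by (intro always_eventually allI mult_right_mono e2ennreal_mono) (use le in auto)
    show "(\<integral>\<^sup>+x. ?P 0 x \<partial>lborel) < \<infinity>" by (rule circle_mean_pos_finite[OF q r])
  qed (use Plim meas Pmeas in auto)
  have Nint: "(\<lambda>n. integral\<^sup>N lborel (?N n)) \<longlonglongrightarrow> integral\<^sup>N lborel ?N'"
  proof (rule nn_integral_LIMSEQ)
    show "incseq ?N"
      unfolding incseq_def le_fun_def
      by (intro allI impI mult_right_mono e2ennreal_mono) (use le in auto)
  qed (use Nlim meas in auto)
  have "integral\<^sup>N lborel ?P' \<le> integral\<^sup>N lborel (?P 0)"
    by (rule LIMSEQ_le_const2[OF Pint])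
       (intro exI[of _ 0] allI impI nn_integral_mono mult_right_mono e2ennreal_mono, use le in auto)
  also have "\<dots> < \<infinity>" by (rule circle_mean_pos_finite[OF q r])
  finally have fin: "enn2ereal (integral\<^sup>N lborel ?P') \<noteq> \<infinity>"
    by auto
  have eq: "ereal (cmean (q n) a r) = (enn2ereal (integral\<^sup>N lborel (?P n)) - enn2ereal (integral\<^sup>N lborel (?N n))) / ereal (2 * pi)" for n
    using circle_mean_ereal[OF q r, of n] by (simp add: circle_mean_def)
  have "(\<lambda>n. (enn2ereal (integral\<^sup>N lborel (?P n)) - enn2ereal (integral\<^sup>N lborel (?N n))) / ereal (2 * pi))
     \<longlonglongrightarrow> (enn2ereal (integral\<^sup>N lborel ?P') - enn2ereal (integral\<^sup>N lborel ?N')) / ereal (2 * pi)"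
    by (intro tendsto_divide_ereal tendsto_diff_ereal_general tendsto_const)
       (use fin Pint Nint enn2ereal_nonneg[of "integral\<^sup>N lborel ?P'"] in \<open>auto intro!: tendsto_enn2erealI\<close>)
  then show ?thesis unfolding eq circle_mean_def .
qed

section \<open>Density of real trigonometric polynomials on a circle\<close>

definition trig_fun :: "(complex \<Rightarrow> real) \<Rightarrow> bool" where
  "trig_fun g \<longleftrightarrow> (\<exists>p. \<forall>z\<in>sphere 0 1. g z = Re (poly p z))"

lemma trig_fun_add: "trig_fun f \<Longrightarrow> trig_fun g \<Longrightarrow> trig_fun (\<lambda>z. f z + g z)"
  unfolding trig_fun_def by (metis poly_add plus_complex.sel(1))

lemma trig_fun_sum: "finite A \<Longrightarrow> (\<And>i. i \<in> A \<Longrightarrow> trig_fun (f i)) \<Longrightarrow> trig_fun (\<lambda>z. \<Sum>i\<in>A. f i z)"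
proof (induction A rule: finite_induct)
  case empty
  show ?case unfolding trig_fun_def by (intro exI[of _ 0]) auto
qed (auto intro: trig_fun_add)

lemma trig_fun_cong: "trig_fun f \<Longrightarrow> (\<And>z. cmod z = 1 \<Longrightarrow> g z = f z) \<Longrightarrow> trig_fun g"
  unfolding trig_fun_def by auto

text \<open>On the unit circle cnj z = 1/z, so the lower power cancels and a monomial remains.
  Conjugation swaps the two exponents without changing the real part, so \<open>j \<le> i\<close>
  may be assumed.\<close>

lemma trig_fun_monom_cnj: "trig_fun (\<lambda>z. Re (c * z ^ i * cnj (d * z ^ j)))"
proof (induction j i arbitrary: c d rule: linorder_wlog)
  case (le j i)
  show ?case
  proof (rule trig_fun_cong)
    show "trig_fun (\<lambda>z. Re (poly (monom (c * cnj d) (i - j)) z))" unfolding trig_fun_def by blast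
    fix z :: complex assume "cmod z = 1"
    then have "z * cnj z = 1" by (simp add: complex_norm_square[symmetric])
    then have "z ^ j * cnj z ^ j = 1" by (metis power_mult_distrib power_one)
    moreover have "z ^ i = z ^ (i - j) * z ^ j" using le by (simp flip: power_add)
    ultimately have "z ^ i * cnj z ^ j = z ^ (i - j)" by (simp add: mult.assoc)
    then have "c * z ^ i * cnj (d * z ^ j) = c * cnj d * z ^ (i - j)" by (simp add: mult_ac)
    then show "Re (c * z ^ i * cnj (d * z ^ j)) = Re (poly (monom (c * cnj d) (i - j)) z)"
      by (simp only: poly_monom)
  qed
next
  case (sym j i)
  show ?case
  proof (rule trig_fun_cong[OF sym.IH[of d c]])
    fix z :: complex
    have "c * z ^ i * cnj (d * z ^ j) = cnj (d * z ^ j * cnj (c * z ^ i))"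
      by (simp only: complex_cnj_mult complex_cnj_cnj mult.commute)
    then show "Re (c * z ^ i * cnj (d * z ^ j)) = Re (d * z ^ j * cnj (c * z ^ i))"
      by (simp only: cnj.sel)
  qed
qed

text \<open>From Re u Re v = Re (u v) / 2 + Re (u cnj v) / 2: the first term is again the real part
  of a polynomial, the second expands into the mixed monomials treated above.\<close>

lemma trig_fun_mult:
  assumes "trig_fun f" "trig_fun g"
  shows "trig_fun (\<lambda>z. f z * g z)"
proof -
  obtain p q where p: "\<And>z. cmod z = 1 \<Longrightarrow> f z = Re (poly p z)" and q: "\<And>z. cmod z = 1 \<Longrightarrow> g z = Re (poly q z)"
    using assms unfolding trig_fun_def by auto
  have "trig_fun (\<lambda>z. Re (poly (smult (1/2) (p * q)) z) +
      (\<Sum>i\<le>degree p. \<Sum>j\<le>degree q. Re ((coeff p i / 2) * z ^ i * cnj (coeff q j * z ^ j))))"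
    by (intro trig_fun_add trig_fun_sum trig_fun_monom_cnj finite_atMost) (unfold trig_fun_def, blast)
  then show ?thesis
  proof (rule trig_fun_cong)
    fix z :: complex assume z: "cmod z = 1"
    have "(\<Sum>i\<le>degree p. \<Sum>j\<le>degree q. Re ((coeff p i / 2) * z ^ i * cnj (coeff q j * z ^ j)))
        = Re (\<Sum>i\<le>degree p. \<Sum>j\<le>degree q. (coeff p i / 2) * z ^ i * cnj (coeff q j * z ^ j))"
      by (simp only: Re_sum)
    also have "(\<Sum>i\<le>degree p. \<Sum>j\<le>degree q. (coeff p i / 2) * z ^ i * cnj (coeff q j * z ^ j))
        = (\<Sum>i\<le>degree p. (coeff p i / 2) * z ^ i) * (\<Sum>j\<le>degree q. cnj (coeff q j * z ^ j))"
      by (simp only: sum_product)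
    also have "(\<Sum>i\<le>degree p. (coeff p i / 2) * z ^ i) = poly p z / 2"
      by (simp add: poly_altdef sum_divide_distrib)
    also have "(\<Sum>j\<le>degree q. cnj (coeff q j * z ^ j)) = cnj (poly q z)"
      unfolding poly_altdef cnj_sum ..
    finally show "f z * g z = Re (poly (smult (1/2) (p * q)) z) +
      (\<Sum>i\<le>degree p. \<Sum>j\<le>degree q. Re ((coeff p i / 2) * z ^ i * cnj (coeff q j * z ^ j)))"
      using p[OF z] q[OF z] by (simp add: field_simps)
  qed
qed

text \<open>Stone-Weierstrass for the algebra of boundary values of real parts of polynomials. Each
  such function carries its own harmonic extension, so the Dirichlet problem on a disc is solved up
  to an error without a Poisson kernel.\<close>

lemma unit_circle_trig_approx:
  assumes q: "continuous_on (sphere 0 1) q" and e: "0 < e"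
  obtains p where "\<And>z. cmod z = 1 \<Longrightarrow> \<bar>q z - Re (poly p z)\<bar> < e"
proof -
  define R where "R = {g. continuous_on (sphere 0 1) g \<and> trig_fun g}"
  interpret function_ring_on R "sphere 0 1"
  proof
    fix x y :: complex assume xy: "x \<in> sphere 0 1" "y \<in> sphere 0 1" "x \<noteq> y"
    have "Re \<in> R" unfolding R_def trig_fun_def
      by (auto intro!: continuous_intros exI[of _ "monom 1 1"] simp: poly_monom)
    moreover have "Im \<in> R" unfolding R_def trig_fun_def
      by (auto intro!: continuous_intros exI[of _ "monom (-\<i>) 1"] simp: poly_monom)
    ultimately show "\<exists>f\<in>R. f x \<noteq> f y" using xy(3) complex_eqI by blast
  next
    fix c :: real
    show "(\<lambda>_. c) \<in> R" unfolding R_def trig_fun_def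
      by (auto intro!: continuous_intros exI[of _ "[:of_real c:]"])
  qed (auto simp: R_def intro: continuous_intros trig_fun_add trig_fun_mult)
  obtain g where g: "g \<in> R" "\<forall>x\<in>sphere 0 1. \<bar>q x - g x\<bar> < e"
    using Stone_Weierstrass_basic[OF q e] by auto
  then obtain p where "\<forall>z\<in>sphere 0 1. g z = Re (poly p z)" by (auto simp: R_def trig_fun_def)
  then show thesis using g(2) by (intro that[of p]) auto
qed

lemma circle_harmonic_approx:
  assumes q: "continuous_on (sphere a r) q" and r: "0 < r" and e: "0 < e"
  obtains p where "p holomorphic_on UNIV" "\<And>z. z \<in> sphere a r \<Longrightarrow> \<bar>q z - Re (p z)\<bar> < e"
proof -
  have "continuous_on (sphere 0 1) (\<lambda>w. q (a + of_real r * w))"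
    by (rule continuous_on_compose2[OF q])
       (use r in \<open>auto intro!: continuous_intros simp: dist_norm norm_mult\<close>)
  then obtain p where p: "\<And>z. cmod z = 1 \<Longrightarrow> \<bar>q (a + of_real r * z) - Re (poly p z)\<bar> < e"
    using unit_circle_trig_approx e by metis
  show thesis
  proof (rule that)
    show "(\<lambda>z. poly p ((z - a) / of_real r)) holomorphic_on UNIV"
      by (intro holomorphic_intros) (use r in auto)
    fix z assume "z \<in> sphere a r"
    then have "cmod ((z - a) / of_real r) = 1" using r by (auto simp: norm_divide dist_norm norm_minus_commute)
    from p[OF this] show "\<bar>q z - Re (poly p ((z - a) / of_real r))\<bar> < e" using r by simp
  qed
qed

text \<open>The mean of \<open>f\<close> is the limit of the means of continuous functions
  decreasing to it. Each of these lies just below the real part of an entire function, whose mean is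
  its value at the centre.\<close>

lemma le_circle_meanI:
  assumes f: "usc_on (top_of_set (sphere a r)) f" and r: "0 < r"
    and maj: "\<And>p. p holomorphic_on UNIV \<Longrightarrow> (\<And>z. z \<in> sphere a r \<Longrightarrow> f z < ereal (Re (p z))) \<Longrightarrow> L \<le> ereal (Re (p a))"
  shows "L \<le> circle_mean f a r"
proof -
  obtain q where q: "\<And>n. continuous_on (sphere a r) (q n)"
    "\<And>n z. z \<in> sphere a r \<Longrightarrow> f z < ereal (q n z)"
    "\<And>z. z \<in> sphere a r \<Longrightarrow> decseq (\<lambda>n. q n z)"
    "\<And>z. z \<in> sphere a r \<Longrightarrow> (\<lambda>n. ereal (q n z)) \<longlonglongrightarrow> f z"
    using usc_on_approx[OF compact_sphere f] by metis
  have "L \<le> ereal (cmean (q n) a r)" for n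
  proof (rule ereal_le_epsilon2)
    fix e :: real assume e: "0 < e"
    \<comment> \<open>Approximating q + e/2 to within e/2 puts the harmonic function strictly
      between q and q + e.\<close>
    have "continuous_on (sphere a r) (\<lambda>z. q n z + e/2)" by (intro continuous_intros q)
    then obtain p where p: "p holomorphic_on UNIV" "\<And>z. z \<in> sphere a r \<Longrightarrow> \<bar>q n z + e/2 - Re (p z)\<bar> < e/2"
      using circle_harmonic_approx[OF _ r, of _ _ "e/2"] e by (metis half_gt_zero)
    have cp: "continuous_on (sphere a r) (\<lambda>z. Re (p z))"
      using holomorphic_on_imp_continuous_on[OF p(1)] by (auto intro!: continuous_intros elim: continuous_on_subset)
    have "L \<le> ereal (Re (p a))"
    proof (rule maj[OF p(1)])
      fix z assume z: "z \<in> sphere a r"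
      have "q n z < Re (p z)" using p(2)[OF z] by linarith
      then show "f z < ereal (Re (p z))" using q(2)[OF z, of n] by (metis less_ereal.simps(1) less_trans)
    qed
    also have "Re (p a) = cmean (\<lambda>z. Re (p z)) a r"
      using cmean_Re_holomorphic[OF p(1), of a r] r by auto
    also have "\<dots> \<le> cmean (\<lambda>z. q n z + e) a r"
    proof (rule cmean_mono)
      fix z assume "z \<in> sphere a r"
      from p(2)[OF this] show "Re (p z) \<le> q n z + e" by linarith
    qed (use cp q r in \<open>auto intro!: continuous_intros\<close>)
    also have "\<dots> = cmean (q n) a r + e"
      by (subst cmean_add) (use q r in auto)
    finally show "L \<le> ereal (cmean (q n) a r) + ereal e" by simp
  qed
  then show ?thesis
    by (intro LIMSEQ_le_const[OF circle_mean_LIMSEQ[OF q(1) _ q(3,4)]]) (use r in auto)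
qed

text \<open>The converse half of the criterion. The majorant may be defined on a neighbourhood of
  the closed disc only, because \<open>annulus_bound\<close> supplies one built from a local branch
  of the logarithm.\<close>

lemma harmonic_majorant_bound:
  assumes L: "L \<le> circle_mean f a r" and r: "0 < r"
    and p: "p holomorphic_on S" "open S" "cball a r \<subseteq> S"
    and maj: "\<And>z. z \<in> sphere a r \<Longrightarrow> f z \<le> ereal (Re (p z))"
  shows "L \<le> ereal (Re (p a))"
proof -
  have "continuous_on (sphere a r) (\<lambda>z. Re (p z))"
    using holomorphic_on_imp_continuous_on[OF p(1)] p(3) sphere_cball[of a r]
    by (intro continuous_on_Re) (meson continuous_on_subset order_trans)
  then have "circle_mean f a r \<le> ereal (cmean (\<lambda>z. Re (p z)) a r)"
    using circle_mean_mono[of a r f "\<lambda>z. ereal (Re (p z))"] maj r by (simp add: circle_mean_ereal)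
  then show ?thesis using L cmean_Re_holomorphic[OF p r] by simp
qed

text \<open>The majorant is strict here because strict inequalities between a usc and a continuous
  function are open conditions, which compactness of the circle can exploit;
  \<open>subharmonic_onD\<close> accepts non-strict ones.\<close>

lemma subharmonic_onI:
  assumes "usc_on (top_of_set U) f"
    and "\<And>a r p. 0 < r \<Longrightarrow> cball a r \<subseteq> U \<Longrightarrow> p holomorphic_on UNIV \<Longrightarrow>
      (\<And>z. z \<in> sphere a r \<Longrightarrow> f z < ereal (Re (p z))) \<Longrightarrow> f a \<le> ereal (Re (p a))"
  shows "subharmonic_on U f"
  unfolding subharmonic_on_def
proof (intro conjI allI impI assms(1))
  fix a r assume "0 < r \<and> cball a r \<subseteq> U"
  then show "f a \<le> circle_mean f a r"
    using assms sphere_cball[of a r] by (intro le_circle_meanI usc_on_subset[OF assms(1)]) auto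
qed

lemma subharmonic_onD:
  assumes "subharmonic_on U f" "0 < r" "cball a r \<subseteq> U" "p holomorphic_on UNIV"
    and "\<And>z. z \<in> sphere a r \<Longrightarrow> f z \<le> ereal (Re (p z))"
  shows "f a \<le> ereal (Re (p a))"
  using harmonic_majorant_bound[of "f a" f a r p UNIV] assms by (auto simp: subharmonic_on_def)

section \<open>Operations preserving subharmonicity\<close>

lemma subharmonic_on_usc: "subharmonic_on U f \<Longrightarrow> usc_on (top_of_set U) f"
  by (simp add: subharmonic_on_def)

lemma subharmonic_on_subset: "subharmonic_on U f \<Longrightarrow> V \<subseteq> U \<Longrightarrow> subharmonic_on V f"
  unfolding subharmonic_on_def by (meson usc_on_subset order_trans)

lemma subharmonic_on_Re_holomorphic:
  assumes "p holomorphic_on U" "open U"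
  shows "subharmonic_on U (\<lambda>z. ereal (Re (p z)))"
  unfolding subharmonic_on_def
proof (intro conjI allI impI)
  have c: "continuous_on U (\<lambda>z. Re (p z))"
    using holomorphic_on_imp_continuous_on[OF assms(1)] by (intro continuous_intros)
  show "usc_on (top_of_set U) (\<lambda>z. ereal (Re (p z)))" by (rule usc_on_ereal[OF c])
  fix a r assume ar: "0 < r \<and> cball a r \<subseteq> U"
  then have "continuous_on (sphere a r) (\<lambda>z. Re (p z))"
    using c sphere_cball[of a r] by (meson continuous_on_subset order_trans)
  then show "ereal (Re (p a)) \<le> circle_mean (\<lambda>z. ereal (Re (p z))) a r"
    using ar cmean_Re_holomorphic[OF assms, of a r] by (simp add: circle_mean_ereal)
qed

text \<open>For b \<noteq> 0 a disc of radius r is carried to a disc of radius r |b| and majorants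
  are transported by the inverse affine map. For b = 0 the function is constant and the inequality
  on the circle is averaged.\<close>

lemma subharmonic_on_affine:
  assumes f: "subharmonic_on V f" and sub: "\<And>l. l \<in> U \<Longrightarrow> a + l * b \<in> V"
  shows "subharmonic_on U (\<lambda>l. f (a + l * b))"
proof (rule subharmonic_onI)
  show "usc_on (top_of_set U) (\<lambda>l. f (a + l * b))"
    by (rule usc_on_compose[OF _ subharmonic_on_usc[OF f]])
       (use sub in \<open>auto intro!: continuous_intros\<close>)
  fix c r p assume r: "0 < r" and c: "cball c r \<subseteq> U" and p: "p holomorphic_on UNIV"
    and less: "\<And>z. z \<in> sphere c r \<Longrightarrow> f (a + z * b) < ereal (Re (p z))"
  show "f (a + c * b) \<le> ereal (Re (p c))"
  proof (cases "b = 0")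
    case True
    have cp: "continuous_on (sphere c r) (\<lambda>z. Re (p z))"
      using holomorphic_on_imp_continuous_on[OF p] by (auto intro!: continuous_intros elim: continuous_on_subset)
    have "c \<in> U" using c r by auto
    then have "f a \<noteq> \<infinity>" using sub[of c] True f by (auto simp: subharmonic_on_def usc_on_def)
    show ?thesis
    proof (cases "f a")
      case (real x)
      have "cmean (\<lambda>z. x) c r \<le> cmean (\<lambda>z. Re (p z)) c r"
        by (rule cmean_mono) (use less True real cp r in \<open>auto intro: less_imp_le\<close>)
      then show ?thesis using cmean_Re_holomorphic[OF p, of c r] r True real by simp
    qed (use \<open>f a \<noteq> \<infinity>\<close> True in auto)
  next
    case False
    have "f (a + c * b) \<le> ereal (Re ((\<lambda>w. p ((w - a) / b)) (a + c * b)))"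
    proof (rule subharmonic_onD[OF f])
      show "0 < r * cmod b" using r False by simp
      have cb: "(w - a) / b \<in> cball c r" if "w \<in> cball (a + c * b) (r * cmod b)" for w
      proof -
        have "c - (w - a) / b = (a + c * b - w) / b" using False by (simp add: field_simps)
        then show ?thesis using that False by (simp add: dist_norm norm_divide field_simps)
      qed
      have sp: "(w - a) / b \<in> sphere c r" if "w \<in> sphere (a + c * b) (r * cmod b)" for w
      proof -
        have "c - (w - a) / b = (a + c * b - w) / b" using False by (simp add: field_simps)
        then show ?thesis using that False by (simp add: dist_norm norm_divide field_simps)
      qed
      have inv: "a + (w - a) / b * b = w" for w using False by simp
      show "cball (a + c * b) (r * cmod b) \<subseteq> V"
        using cb c sub inv by (metis subsetD subsetI)
      show "(\<lambda>w. p ((w - a) / b)) holomorphic_on UNIV"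
      proof -
        have "(\<lambda>w. (w - a) / b) holomorphic_on UNIV" using False by (intro holomorphic_intros)
        from holomorphic_on_compose_gen[OF this p] show ?thesis by (simp add: o_def)
      qed
      show "f z \<le> ereal (Re (p ((z - a) / b)))" if "z \<in> sphere (a + c * b) (r * cmod b)" for z
        using less[OF sp[OF that]] inv[of z] by simp
    qed
    then show ?thesis using False by simp
  qed
qed

text \<open>Two majorised sequences of continuous functions turn the sum into a limit of means, so that no
  \<open>\<infinity> - \<infinity>\<close> occurs.\<close>

lemma subharmonic_on_add:
  assumes f: "subharmonic_on U f" and g: "subharmonic_on U g"
  shows "subharmonic_on U (\<lambda>z. f z + g z)"
  unfolding subharmonic_on_def
proof (intro conjI allI impI)
  show "usc_on (top_of_set U) (\<lambda>z. f z + g z)"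
    using f g by (intro usc_on_add subharmonic_on_usc)
  fix a r assume ar: "0 < r \<and> cball a r \<subseteq> U"
  then have sub: "sphere a r \<subseteq> U" using sphere_cball[of a r] by blast
  obtain q where q: "\<And>n. continuous_on (sphere a r) (q n)"
    "\<And>n z. z \<in> sphere a r \<Longrightarrow> f z < ereal (q n z)"
    "\<And>z. z \<in> sphere a r \<Longrightarrow> decseq (\<lambda>n. q n z)"
    "\<And>z. z \<in> sphere a r \<Longrightarrow> (\<lambda>n. ereal (q n z)) \<longlonglongrightarrow> f z"
    using usc_on_approx[OF compact_sphere usc_on_subset[OF subharmonic_on_usc[OF f] sub]] by metis
  obtain s where s: "\<And>n. continuous_on (sphere a r) (s n)"
    "\<And>n z. z \<in> sphere a r \<Longrightarrow> g z < ereal (s n z)"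
    "\<And>z. z \<in> sphere a r \<Longrightarrow> decseq (\<lambda>n. s n z)"
    "\<And>z. z \<in> sphere a r \<Longrightarrow> (\<lambda>n. ereal (s n z)) \<longlonglongrightarrow> g z"
    using usc_on_approx[OF compact_sphere usc_on_subset[OF subharmonic_on_usc[OF g] sub]] by metis
  have bound: "h a \<le> ereal (cmean k a r)"
    if h: "subharmonic_on U h" and k: "continuous_on (sphere a r) k"
      "\<And>z. z \<in> sphere a r \<Longrightarrow> h z < ereal (k z)" for h k
  proof -
    have "h a \<le> circle_mean h a r" using h ar by (auto simp: subharmonic_on_def)
    also have "\<dots> \<le> circle_mean (\<lambda>z. ereal (k z)) a r"
      by (rule circle_mean_mono) (use k ar in \<open>auto intro: less_imp_le\<close>)
    also have "\<dots> = ereal (cmean k a r)" by (rule circle_mean_ereal) (use k ar in auto)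
    finally show ?thesis .
  qed
  have "(\<lambda>n. ereal (cmean (\<lambda>z. q n z + s n z) a r)) \<longlonglongrightarrow> circle_mean (\<lambda>z. f z + g z) a r"
  proof (rule circle_mean_LIMSEQ)
    fix z assume z: "z \<in> sphere a r"
    show "decseq (\<lambda>n. q n z + s n z)"
      using q(3)[OF z] s(3)[OF z] by (auto simp: decseq_def intro: add_mono)
    have "f z \<noteq> \<infinity>" "g z \<noteq> \<infinity>" using f g z sub by (auto simp: subharmonic_on_def usc_on_def)
    then have "(\<lambda>n. ereal (q n z) + ereal (s n z)) \<longlonglongrightarrow> f z + g z"
      by (intro tendsto_add_ereal_general q(4) s(4) z) auto
    then show "(\<lambda>n. ereal (q n z + s n z)) \<longlonglongrightarrow> f z + g z" by simp
  qed (use q s ar in \<open>auto intro!: continuous_intros\<close>)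
  moreover have "f a + g a \<le> ereal (cmean (\<lambda>z. q n z + s n z) a r)" for n
  proof -
    have "f a + g a \<le> ereal (cmean (q n) a r) + ereal (cmean (s n) a r)"
      by (intro add_mono bound f g q s)
    also have "\<dots> = ereal (cmean (\<lambda>z. q n z + s n z) a r)"
      using cmean_add[OF q(1) s(1), of n n] ar by simp
    finally show ?thesis .
  qed
  ultimately show "f a + g a \<le> circle_mean (\<lambda>z. f z + g z) a r"
    by (intro LIMSEQ_le_const) auto
qed

lemma ereal_cmult_le_iff:
  fixes c x y :: real and z :: ereal
  assumes "0 < c"
  shows "ereal c * z < ereal y \<longleftrightarrow> z < ereal (y / c)" "ereal c * z \<le> ereal y \<longleftrightarrow> z \<le> ereal (y / c)"
  using assms by (cases z; simp add: field_simps)+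

lemma usc_on_const: "usc_on X (\<lambda>x. ereal c)"
  using usc_on_compose[of X euclideanreal "\<lambda>x. c" ereal] usc_on_ereal[of UNIV "\<lambda>x. x"] by simp

lemma usc_on_cmult:
  assumes f: "usc_on X f" and c: "0 \<le> c"
  shows "usc_on X (\<lambda>x. ereal c * f x)"
proof (cases "c = 0")
  case True
  then show ?thesis using usc_on_const[of X 0] by (simp add: zero_ereal_def[symmetric])
next
  case False
  then have c: "0 < c" using c by simp
  have *: "ereal c * z < d \<longleftrightarrow> z < d / ereal c" for z d :: ereal
    using c by (cases z; cases d) (auto simp: field_simps)
  have "f x \<noteq> \<infinity>" if "x \<in> topspace X" for x using f that by (simp add: usc_on_def)
  then have "ereal c * f x \<noteq> \<infinity>" if "x \<in> topspace X" for x
    using that c by (cases "f x") auto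
  then show ?thesis using f by (simp add: usc_on_def *)
qed

lemma subharmonic_on_const: "subharmonic_on U (\<lambda>z. ereal c)"
  using subharmonic_on_subset[OF subharmonic_on_Re_holomorphic[of "\<lambda>z. of_real c" UNIV]] by simp

lemma subharmonic_on_cmult:
  assumes f: "subharmonic_on U f" and c: "0 \<le> c"
  shows "subharmonic_on U (\<lambda>z. ereal c * f z)"
proof (cases "c = 0")
  \<comment> \<open>In \<open>ereal\<close> the product of 0 and -\<infinity> is 0, so the function
    is the constant 0 here.\<close>
  case True
  then show ?thesis using subharmonic_on_const[of U 0] by (simp add: zero_ereal_def[symmetric])
next
  case False
  then have c': "0 < c" using c by simp
  show ?thesis
  proof (rule subharmonic_onI)
    show "usc_on (top_of_set U) (\<lambda>z. ereal c * f z)"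
      by (rule usc_on_cmult[OF subharmonic_on_usc[OF f] c])
    fix a r p assume *: "0 < r" "cball a r \<subseteq> U" "p holomorphic_on UNIV"
      "\<And>z. z \<in> sphere a r \<Longrightarrow> ereal c * f z < ereal (Re (p z))"
    have "f a \<le> ereal (Re ((\<lambda>z. p z / of_real c) a))"
      by (rule subharmonic_onD[OF f *(1,2)])
         (use * c' in \<open>auto intro!: holomorphic_intros simp: ereal_cmult_le_iff less_imp_le\<close>)
    then show "ereal c * f a \<le> ereal (Re (p a))" using c' by (simp add: ereal_cmult_le_iff)
  qed
qed

lemma ln_ext_less_iff:
  assumes "0 \<le> x"
  shows "ln_ext x < ereal y \<longleftrightarrow> x < exp y" "ln_ext x \<le> ereal y \<longleftrightarrow> x \<le> exp y"
  using assms by (auto simp: ln_ext_def) (metis antisym_conv2 exp_le_cancel_iff exp_ln exp_less_cancel_iff linorder_not_less)+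

lemma ln_ext_mono: "0 \<le> x \<Longrightarrow> x \<le> y \<Longrightarrow> ln_ext x \<le> ln_ext y"
  by (auto simp: ln_ext_def)

lemma usc_on_ln_ext:
  assumes g: "continuous_on S g" and pos: "\<And>x. x \<in> S \<Longrightarrow> 0 \<le> g x"
  shows "usc_on (top_of_set S) (\<lambda>x. ln_ext (g x))"
  unfolding usc_on_def
proof safe
  fix c :: ereal
  consider y where "c = ereal y" | "c = \<infinity>" | "c = -\<infinity>" by (cases c)
  then show "openin (top_of_set S) {x \<in> topspace (top_of_set S). ln_ext (g x) < c}"
  proof cases
    case 1
    have "{x \<in> topspace (top_of_set S). ln_ext (g x) < c} = S \<inter> g -` {..<exp y}"
      using pos by (auto simp: 1 ln_ext_less_iff)
    then show ?thesis using continuous_openin_preimage_gen[OF g, of "{..<exp y}"] by simp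
  next
    case 2
    then have "{x \<in> topspace (top_of_set S). ln_ext (g x) < c} = S" by (auto simp: ln_ext_def)
    then show ?thesis by simp
  next
    case 3
    then have "{x \<in> topspace (top_of_set S). ln_ext (g x) < c} = {}" by auto
    then show ?thesis by (metis openin_empty)
  qed
qed (auto simp: ln_ext_def split: if_splits)

text \<open>By the maximum principle for the holomorphic function \<open>F \<cdot> exp (- p / 2)\<close>.\<close>

lemma subharmonic_on_ln_norm:
  assumes F: "F holomorphic_on UNIV"
  shows "subharmonic_on U (\<lambda>z. ln_ext ((cmod (F z))\<^sup>2))"
proof (rule subharmonic_onI)
  show "usc_on (top_of_set U) (\<lambda>z. ln_ext ((cmod (F z))\<^sup>2))"
    using holomorphic_on_imp_continuous_on[OF F]
    by (intro usc_on_ln_ext) (auto intro!: continuous_intros elim: continuous_on_subset)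
  fix a r p assume *: "0 < r" "cball a r \<subseteq> U" "p holomorphic_on UNIV"
    "\<And>z. z \<in> sphere a r \<Longrightarrow> ln_ext ((cmod (F z))\<^sup>2) < ereal (Re (p z))"
  define G where "G = (\<lambda>z. F z * exp (- p z / 2))"
  have G: "G holomorphic_on UNIV" unfolding G_def using F *(3) by (intro holomorphic_intros) auto
  have Gn: "(cmod (G z))\<^sup>2 = (cmod (F z))\<^sup>2 / exp (Re (p z))" for z
    by (simp add: G_def norm_mult power_mult_distrib power2_eq_square field_simps flip: exp_add)
  have "cmod (G a) \<le> 1"
  proof (rule maximum_modulus_frontier[of G "ball a r"])
    show "G holomorphic_on interior (ball a r)" using G by (rule holomorphic_on_subset) auto
    show "continuous_on (closure (ball a r)) G"
      using holomorphic_on_imp_continuous_on[OF G] by (rule continuous_on_subset) auto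
    fix z assume "z \<in> frontier (ball a r)"
    then have "z \<in> sphere a r" using * by simp
    then have "(cmod (F z))\<^sup>2 < exp (Re (p z))" using *(4) by (simp add: ln_ext_less_iff)
    then have "(cmod (G z))\<^sup>2 \<le> 1" unfolding Gn by simp
    then show "cmod (G z) \<le> 1" by (simp add: power_le_one_iff abs_square_le_1)
  qed (use * in auto)
  then have "(cmod (G a))\<^sup>2 \<le> 1" by (simp add: abs_square_le_1)
  then have "(cmod (F a))\<^sup>2 \<le> exp (Re (p a))" unfolding Gn by simp
  then show "ln_ext ((cmod (F a))\<^sup>2) \<le> ereal (Re (p a))" by (simp add: ln_ext_less_iff)
qed

section \<open>Maximum principles\<close>

lemma cmod_add_square: "(cmod (x + y))\<^sup>2 = (cmod x)\<^sup>2 + 2 * Re (cnj x * y) + (cmod y)\<^sup>2"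
  unfolding cmod_power2 by (simp add: power2_eq_square algebra_simps)

lemma ereal_shift:
  fixes f :: ereal
  shows "ereal (x - c) < f \<longleftrightarrow> ereal x < f + ereal c"
    and "f < ereal (x - c) \<longleftrightarrow> f + ereal c < ereal x"
    and "f \<le> ereal (x - c) \<longleftrightarrow> f + ereal c \<le> ereal x"
  by (cases f; simp add: algebra_simps; fail)+

text \<open>Hadamard's three circles theorem. Adding \<epsilon> |w|^2 to the difference of
  \<open>f\<close> and the harmonic comparison function makes it strictly subharmonic, so that its
  maximum cannot lie in the open annulus; \<epsilon> is small enough not to lift the boundary values
  to \<delta>.\<close>

lemma annulus_bound:
  assumes f: "subharmonic_on U f" and r1: "0 < r1"
    and sub: "\<And>w. r1 \<le> cmod w \<Longrightarrow> cmod w \<le> r2 \<Longrightarrow> w \<in> U"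
    and bd: "\<And>w. cmod w = r1 \<or> cmod w = r2 \<Longrightarrow> f w \<le> ereal (\<alpha> + \<beta> * ln ((cmod w)\<^sup>2))"
    and z: "r1 \<le> cmod z" "cmod z \<le> r2"
  shows "f z \<le> ereal (\<alpha> + \<beta> * ln ((cmod z)\<^sup>2))"
proof (rule ccontr)
  define H where "H w = \<alpha> + \<beta> * ln ((cmod w)\<^sup>2)" for w :: complex
  assume "\<not> f z \<le> ereal (\<alpha> + \<beta> * ln ((cmod z)\<^sup>2))"
  then have "ereal (H z) < f z" by (simp add: H_def)
  then obtain y where y: "H z < y" "ereal y < f z" using ereal_dense2 by force
  define \<delta> where "\<delta> = y - H z"
  have \<delta>: "0 < \<delta>" using y by (simp add: \<delta>_def)
  have r2: "0 < r2" using r1 z by linarith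
  define \<epsilon> where "\<epsilon> = \<delta> / (2 * r2\<^sup>2)"
  have \<epsilon>: "0 < \<epsilon>" "\<epsilon> * r2\<^sup>2 < \<delta>" using \<delta> r2 by (auto simp: \<epsilon>_def)
  define K where "K = cball 0 r2 - ball (0::complex) r1"
  have K: "compact K" unfolding K_def by (intro compact_diff) auto
  have memK: "w \<in> K \<longleftrightarrow> r1 \<le> cmod w \<and> cmod w \<le> r2" for w by (auto simp: K_def)
  have KU: "K \<subseteq> U" using sub by (auto simp: memK)
  define g where "g w = f w + ereal (- H w + \<epsilon> * (cmod w)\<^sup>2)" for w
  have "usc_on (top_of_set K) g" unfolding g_def
  proof (intro usc_on_add usc_on_ereal)
    show "usc_on (top_of_set K) f" by (rule usc_on_subset[OF subharmonic_on_usc[OF f] KU])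
    show "continuous_on K (\<lambda>w. - H w + \<epsilon> * (cmod w)\<^sup>2)"
      unfolding H_def by (intro continuous_intros) (use r1 in \<open>auto simp: memK\<close>)
  qed
  moreover have "z \<in> K" using z by (simp add: memK)
  ultimately obtain x where x: "x \<in> K" "\<And>w. w \<in> K \<Longrightarrow> g w \<le> g x"
    using usc_on_compact_attains_sup[OF K] by (metis empty_iff)
  have "ereal \<delta> < g z"
  proof -
    have "ereal \<delta> < f z + ereal (- H z)" using y(2) unfolding \<delta>_def by (cases "f z") auto
    also have "\<dots> \<le> g z" unfolding g_def using \<epsilon> by (intro add_left_mono) auto
    finally show ?thesis .
  qed
  then have gx: "ereal \<delta> < g x" using x(2)[OF \<open>z \<in> K\<close>] by (rule less_le_trans)
  have bdless: "g w < ereal \<delta>" if "cmod w = r1 \<or> cmod w = r2" for w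
  proof -
    have "r1 \<le> r2" using z by linarith
    have "g w \<le> ereal (H w) + ereal (- H w + \<epsilon> * (cmod w)\<^sup>2)"
      unfolding g_def by (intro add_right_mono) (use bd[OF that] in \<open>simp add: H_def\<close>)
    also have "\<dots> = ereal (\<epsilon> * (cmod w)\<^sup>2)" by simp
    also have "\<dots> \<le> ereal (\<epsilon> * r2\<^sup>2)"
      using that \<epsilon> r1 \<open>r1 \<le> r2\<close> by (auto intro!: mult_left_mono power_mono)
    also have "\<dots> < ereal \<delta>" using \<epsilon> by simp
    finally show ?thesis .
  qed
  have x12: "r1 < cmod x" "cmod x < r2"
    using x(1) bdless[of x] gx unfolding memK by (metis less_asym' order_le_less)+
  have "g x \<noteq> \<infinity>" "f x \<noteq> \<infinity>"
    using x(1) KU subharmonic_on_usc[OF f] unfolding g_def usc_on_def by auto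
  moreover have "f x \<noteq> -\<infinity>" using gx unfolding g_def by auto
  ultimately obtain c where c: "f x = ereal c" by (cases "f x") auto
  define M where "M = c - H x + \<epsilon> * (cmod x)\<^sup>2"
  have gM: "g x = ereal M" by (simp add: g_def c M_def)
  define s where "s = min (cmod x - r1) (r2 - cmod x) / 2"
  have s: "0 < s" "s < cmod x - r1" "s < r2 - cmod x" using x12 by (auto simp: s_def)
  have x0: "x \<noteq> 0" using x12 r1 by auto
  have inK: "w \<in> K" if "w \<in> cball x s" for w
  proof -
    have "cmod (w - x) \<le> s" using that by (simp add: dist_norm norm_minus_commute)
    then show ?thesis using s norm_triangle_ineq2[of x w] norm_triangle_ineq2[of w x]
      by (simp add: memK norm_minus_commute)
  qed
  \<comment> \<open>Holomorphic near x. The logarithm is taken of w/x, which stays off the negative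
    axis, and |w|^2 is replaced by an expression affine in w whose real part agrees with it on the
    circle |w - x| = s. At the centre this real part exceeds |x|^2 by s^2, which yields the
    contradiction.\<close>
  define p where "p w = of_real (M + \<alpha>) + 2 * of_real \<beta> * (Ln (w / x) + of_real (ln (cmod x)))
     - of_real \<epsilon> * (of_real ((cmod x)\<^sup>2 + s\<^sup>2) + 2 * cnj x * (w - x))" for w
  have slit: "w / x \<notin> \<real>\<^sub>\<le>\<^sub>0" if "w \<in> ball x (cmod x)" for w
  proof
    assume "w / x \<in> \<real>\<^sub>\<le>\<^sub>0"
    then have "Re (w / x) \<le> 0" by (auto simp: complex_nonpos_Reals_iff)
    then have "1 \<le> Re (1 - w / x)" by simp
    also have "\<dots> \<le> cmod (1 - w / x)" by (rule complex_Re_le_cmod)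
    also have "1 - w / x = (x - w) / x" using x0 by (simp add: field_simps)
    also have "cmod \<dots> < 1" using that x0 by (simp add: norm_divide dist_norm)
    finally show False by simp
  qed
  have p: "p holomorphic_on ball x (cmod x)"
    unfolding p_def by (intro holomorphic_intros) (use slit x0 in auto)
  have Rep: "Re (p w) = M + H w - \<epsilon> * (cmod x)\<^sup>2 - \<epsilon> * s\<^sup>2 - 2 * \<epsilon> * Re (cnj x * (w - x))"
    if "w \<noteq> 0" for w
    using that x0 by (simp add: p_def H_def Re_Ln norm_divide ln_div ln_realpow algebra_simps)
  have fx: "f x \<le> ereal (Re (p x))"
  proof (rule harmonic_majorant_bound[OF _ s(1) p])
    have "cball x s \<subseteq> U" using inK KU by blast
    then show "f x \<le> circle_mean f x s"
      using f s(1) by (simp add: subharmonic_on_def)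
    show "cball x s \<subseteq> ball x (cmod x)" using s r1 by (auto simp: subset_iff)
    fix w assume w: "w \<in> sphere x s"
    then have wK: "w \<in> K" using inK by auto
    then have "w \<noteq> 0" using r1 by (auto simp: memK)
    have "cmod (w - x) = s" using w by (simp add: dist_norm norm_minus_commute)
    then have n: "(cmod w)\<^sup>2 = (cmod x)\<^sup>2 + 2 * Re (cnj x * (w - x)) + s\<^sup>2"
      using cmod_add_square[of x "w - x"] by simp
    have "f w + ereal (- H w + \<epsilon> * (cmod w)\<^sup>2) \<le> ereal M" using x(2)[OF wK] gM by (simp add: g_def)
    then have "f w \<le> ereal (M - (- H w + \<epsilon> * (cmod w)\<^sup>2))" by (simp only: ereal_shift)
    also have "M - (- H w + \<epsilon> * (cmod w)\<^sup>2) = Re (p w)"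
      unfolding Rep[OF \<open>w \<noteq> 0\<close>] n by (simp add: algebra_simps)
    finally show "f w \<le> ereal (Re (p w))" .
  qed simp
  have "Re (p x) = c - \<epsilon> * s\<^sup>2" unfolding Rep[OF x0] by (simp add: M_def)
  then show False using fx s(1) \<epsilon>(1) by (simp add: c zero_less_mult_iff not_less[symmetric])
qed

lemma psh_on_line:
  assumes "psh_on U u"
  shows "subharmonic_on {l. (a1 + l * b1, a2 + l * b2) \<in> U} (\<lambda>l. u (a1 + l * b1, a2 + l * b2))"
  using assms unfolding psh_on_def by blast

text \<open>The defining property of plurisubharmonicity only concerns complex lines. If a graph
  \<open>\<tau> = F z\<close> violated the inequality, a maximum point \<open>(z\<^sub>1, \<tau>\<^sub>1)\<close> of
  \<open>u - Re P + \<epsilon> \<bar>z - a\<bar>\<^sup>2 - N \<bar>\<tau> - F z\<bar>\<^sup>2\<close> for large \<open>N\<close> would lie close to the graph. Along the line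
  through it in the direction \<open>(1, F' z\<^sub>1)\<close> the function \<open>\<tau> - F z\<close> is holomorphic with vanishing
  derivative at the point, so that the penalty term does not contribute to the mean at second order.\<close>

lemma psh_on_graph:
  assumes u: "psh_on (UNIV \<times> ball 0 1) u" and r: "0 < r"
    and F: "F holomorphic_on UNIV" "\<And>z. z \<in> cball a r \<Longrightarrow> cmod (F z) < 1"
    and P: "P holomorphic_on UNIV"
    and bd: "\<And>z. z \<in> sphere a r \<Longrightarrow> u (z, F z) < ereal (Re (P z))"
  shows "u (a, F a) \<le> ereal (Re (P a))"
proof (rule ccontr)
  assume "\<not> u (a, F a) \<le> ereal (Re (P a))"
  then have pos: "ereal (Re (P a)) < u (a, F a)" by simp
  have contF: "continuous_on S F" for S
    using holomorphic_on_imp_continuous_on[OF F(1)] by (rule continuous_on_subset) auto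
  have contP: "continuous_on S P" for S
    using holomorphic_on_imp_continuous_on[OF P] by (rule continuous_on_subset) auto
  have "continuous_on (cball a r) (\<lambda>z. cmod (F z))" by (intro continuous_intros contF)
  moreover have "cball a r \<noteq> {}" using r by simp
  ultimately obtain z0 where z0: "z0 \<in> cball a r" "\<And>z. z \<in> cball a r \<Longrightarrow> cmod (F z) \<le> cmod (F z0)"
    using continuous_attains_sup[OF compact_cball] by metis
  define \<rho>' where "\<rho>' = cmod (F z0)"
  \<comment> \<open>A radius strictly between the maximum of |F| on the disc and 1, so that
    \<open>K\<close> contains a tube around the graph and still lies in the domain.\<close>
  define \<rho> where "\<rho> = (1 + \<rho>') / 2"
  have \<rho>: "\<rho>' < \<rho>" "\<rho> < 1" "0 \<le> \<rho>'" "\<And>z. z \<in> cball a r \<Longrightarrow> cmod (F z) \<le> \<rho>'"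
    using F(2)[OF z0(1)] z0(2) by (auto simp: \<rho>_def \<rho>'_def)
  define K where "K = cball a r \<times> cball (0::complex) \<rho>"
  have K: "compact K" unfolding K_def by (intro compact_Times) auto
  have KU: "K \<subseteq> UNIV \<times> ball 0 1" unfolding K_def using \<rho> by auto
  have uscu: "usc_on (top_of_set K) u" by (rule usc_on_subset[OF _ KU]) (use u in \<open>simp add: psh_on_def\<close>)
  have graphK: "(z, F z) \<in> K" if "z \<in> cball a r" for z
    using \<rho>(4)[OF that] \<rho>(1) that by (simp add: K_def)
  have contp: "continuous_on S (\<lambda>p. F (fst p))" "continuous_on S (\<lambda>p. P (fst p))" for S
    by (auto intro!: continuous_on_compose2[OF contF[of UNIV]] continuous_on_compose2[OF contP[of UNIV]] continuous_intros)
  \<comment> \<open>By compactness the strict inequality on the boundary circle holds with a margin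
    -m > 0; \<epsilon> r^2 spends exactly this margin.\<close>
  obtain \<epsilon> where \<epsilon>: "0 < \<epsilon>" "\<And>z. z \<in> sphere a r \<Longrightarrow> u (z, F z) + ereal (- Re (P z) + \<epsilon> * r\<^sup>2) < 0"
  proof -
    have "usc_on (top_of_set (sphere a r)) (\<lambda>z. u (z, F z) + ereal (- Re (P z)))"
    proof (intro usc_on_add usc_on_ereal continuous_intros contP)
      show "usc_on (top_of_set (sphere a r)) (\<lambda>z. u (z, F z))"
        by (rule usc_on_compose[OF _ uscu])
           (use graphK in \<open>auto intro!: continuous_intros contF\<close>)
    qed
    moreover have ne: "sphere a r \<noteq> {}" using r by simp
    ultimately obtain w where w: "w \<in> sphere a r"
      "\<And>z. z \<in> sphere a r \<Longrightarrow> u (z, F z) + ereal (- Re (P z)) \<le> u (w, F w) + ereal (- Re (P w))"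
      using usc_on_compact_attains_sup[OF compact_sphere ne] by blast
    have "u (w, F w) + ereal (- Re (P w)) < ereal 0"
      using bd[OF w(1)] ereal_shift(2)[of "u (w, F w)" 0 "- Re (P w)"] by simp
    then obtain m where m: "u (w, F w) + ereal (- Re (P w)) < ereal m" "m < 0"
      using ereal_dense2 by (metis less_ereal.simps(1))
    show thesis
    proof (rule that[of "- m / r\<^sup>2"])
      show "0 < - m / r\<^sup>2" using m r by (intro divide_pos_pos) auto
      fix z assume "z \<in> sphere a r"
      then have "u (z, F z) + ereal (- Re (P z)) < ereal m" using w(2) m(1) by (blast intro: le_less_trans)
      then show "u (z, F z) + ereal (- Re (P z) + - m / r\<^sup>2 * r\<^sup>2) < 0"
        using r by (cases "u (z, F z)") auto
    qed
  qed
  define V where "V p = u p + ereal (- Re (P (fst p)) + \<epsilon> * (cmod (fst p - a))\<^sup>2)" for p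
  have uscV: "usc_on (top_of_set K) V"
    unfolding V_def by (intro usc_on_add uscu usc_on_ereal continuous_intros contp)
  \<comment> \<open>Negativity of \<open>V\<close> on the boundary part of the graph extends to a
    tube around it: \<eta> is the least fibre distance from the graph to the compact set where
    \<open>V\<close> is not negative.\<close>
  obtain \<eta> where \<eta>: "0 < \<eta>" "\<And>z \<tau>. z \<in> sphere a r \<Longrightarrow> (z, \<tau>) \<in> K \<Longrightarrow> cmod (\<tau> - F z) < \<eta> \<Longrightarrow> V (z, \<tau>) < 0"
  proof -
    let ?S = "sphere a r \<times> cball (0::complex) \<rho>"
    have SK: "?S \<subseteq> K" unfolding K_def using sphere_cball by blast
    have "openin (top_of_set ?S) {p \<in> ?S. V p < 0}"
      using usc_on_subset[OF uscV SK] by (auto simp: usc_on_def)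
    then have "closedin (top_of_set ?S) (?S - {p \<in> ?S. V p < 0})" by (intro closedin_diff) auto
    then have C: "compact (?S - {p \<in> ?S. V p < 0})"
      by (rule closedin_compact[rotated]) (intro compact_Times compact_sphere compact_cball)
    show thesis
    proof (cases "?S - {p \<in> ?S. V p < 0} = {}")
      case True
      show thesis
      proof (rule that[of 1])
        fix z \<tau> assume "z \<in> sphere a r" "(z, \<tau>) \<in> K"
        then have "(z, \<tau>) \<in> ?S" by (simp add: K_def)
        then show "V (z, \<tau>) < 0" using True by blast
      qed simp
    next
      case False
      have "continuous_on (?S - {p \<in> ?S. V p < 0}) (\<lambda>p. cmod (snd p - F (fst p)))"
        by (intro continuous_intros contp)
      then obtain q where q: "q \<in> ?S - {p \<in> ?S. V p < 0}"
        "\<And>p. p \<in> ?S - {p \<in> ?S. V p < 0} \<Longrightarrow> cmod (snd q - F (fst q)) \<le> cmod (snd p - F (fst p))"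
        using continuous_attains_inf[OF C False] by blast
      have "snd q \<noteq> F (fst q)"
      proof
        assume eq: "snd q = F (fst q)"
        have fq: "fst q \<in> sphere a r" using q(1) by auto
        then have "cmod (fst q - a) = r" by (simp add: dist_norm norm_minus_commute)
        then have "V (fst q, F (fst q)) < 0" using \<epsilon>(2)[OF fq] by (simp add: V_def)
        then show False using q(1) eq by (metis (mono_tags, lifting) DiffD1 DiffD2 mem_Collect_eq prod.collapse)
      qed
      then show thesis
      proof (intro that[of "cmod (snd q - F (fst q))"])
        fix z \<tau> assume *: "z \<in> sphere a r" "(z, \<tau>) \<in> K" "cmod (\<tau> - F z) < cmod (snd q - F (fst q))"
        show "V (z, \<tau>) < 0"
          using q(2)[of "(z, \<tau>)"] * by (auto simp: K_def)
      qed auto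
    qed
  qed
  have "K \<noteq> {}" using graphK[of a] r by auto
  then obtain q0 where q0: "q0 \<in> K" "\<And>q. q \<in> K \<Longrightarrow> V q \<le> V q0"
    using usc_on_compact_attains_sup[OF K _ uscV] by blast
  have "V q0 \<noteq> \<infinity>" using uscV q0 by (auto simp: usc_on_def)
  then obtain B0 where B0: "V q0 < ereal B0" using ereal_dense2[of "V q0" \<infinity>] by auto
  define B where "B = max B0 1"
  have B: "0 < B" "\<And>q. q \<in> K \<Longrightarrow> V q < ereal B"
  proof -
    show "0 < B" by (simp add: B_def)
    fix q assume "q \<in> K"
    then have "V q \<le> V q0" by (rule q0(2))
    also have "\<dots> < ereal B0" by (rule B0)
    also have "\<dots> \<le> ereal B" by (simp add: B_def)
    finally show "V q < ereal B" .
  qed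
  define \<eta>' where "\<eta>' = min \<eta> (\<rho> - \<rho>')"
  have \<eta>': "0 < \<eta>'" "\<eta>' \<le> \<eta>" "\<eta>' \<le> \<rho> - \<rho>'" using \<eta>(1) \<rho>(1) by (auto simp: \<eta>'_def)
  \<comment> \<open>From fibre distance \<eta>' on, the penalty is at least the upper bound B of
    \<open>V\<close>, so the positive maximum of \<open>W\<close> lies closer to the graph.\<close>
  define N where "N = B / \<eta>'\<^sup>2"
  have N: "0 < N" using B \<eta>' by (simp add: N_def)
  define W where "W p = V p + ereal (- N * (cmod (snd p - F (fst p)))\<^sup>2)" for p
  have "usc_on (top_of_set K) W"
    unfolding W_def by (intro usc_on_add uscV usc_on_ereal continuous_intros contp)
  then obtain x where x: "x \<in> K" "\<And>p. p \<in> K \<Longrightarrow> W p \<le> W x"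
    using usc_on_compact_attains_sup[OF K \<open>K \<noteq> {}\<close>] by blast
  obtain z1 \<tau>1 where x_eq: "x = (z1, \<tau>1)" by (cases x)
  have "0 < W (a, F a)"
    using pos by (cases "u (a, F a)") (auto simp: W_def V_def zero_ereal_def)
  also have "\<dots> \<le> W x" using x graphK[of a] r by auto
  finally have Wx: "0 < W x" .
  have close: "cmod (\<tau>1 - F z1) < \<eta>'"
  proof (rule ccontr)
    assume "\<not> cmod (\<tau>1 - F z1) < \<eta>'"
    then have "\<eta>'\<^sup>2 \<le> (cmod (\<tau>1 - F z1))\<^sup>2" using \<eta>' by (intro power_mono) auto
    then have "N * \<eta>'\<^sup>2 \<le> N * (cmod (\<tau>1 - F z1))\<^sup>2" using N by (intro mult_left_mono) auto
    moreover have "N * \<eta>'\<^sup>2 = B" using \<eta>' by (simp add: N_def)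
    ultimately have "W x < 0"
      using B(2)[OF x(1)] by (cases "V x") (auto simp: W_def x_eq zero_ereal_def)
    then show False using Wx by simp
  qed
  have z1K: "z1 \<in> cball a r" using x(1) by (simp add: x_eq K_def)
  have \<tau>1: "cmod \<tau>1 < \<rho>"
    using norm_triangle_ineq2[of \<tau>1 "F z1"] close \<eta>'(3) \<rho>(4)[OF z1K] by linarith
  have z1: "cmod (z1 - a) < r"
  proof (rule ccontr)
    assume "\<not> cmod (z1 - a) < r"
    then have "z1 \<in> sphere a r" using z1K by (auto simp: dist_norm norm_minus_commute)
    then have "V x < 0" using \<eta>(2)[of z1 \<tau>1] x(1) close \<eta>'(2) by (auto simp: x_eq)
    moreover have "W x \<le> V x" unfolding W_def using N by (cases "V x") auto
    ultimately show False using Wx by auto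
  qed
  have "u x \<noteq> \<infinity>" using uscu x(1) by (auto simp: usc_on_def)
  moreover have "u x \<noteq> -\<infinity>" using Wx by (auto simp: W_def V_def)
  ultimately obtain c where c: "u x = ereal c" by (cases "u x") auto
  define y where "y = \<tau>1 - F z1"
  define M where "M = c - Re (P z1) + \<epsilon> * (cmod (z1 - a))\<^sup>2 - N * (cmod y)\<^sup>2"
  have WM: "W x = ereal M" by (simp add: W_def V_def x_eq c[unfolded x_eq] M_def y_def)
  define D where "D = deriv F z1"
  \<comment> \<open>With N \<kappa>^2 = \<epsilon>/2 the squared linearisation error of
    \<open>F\<close>, weighted by N, consumes only half of the gain \<epsilon> s^2.\<close>
  define \<kappa> where "\<kappa> = sqrt (\<epsilon> / (2 * N))"
  have \<kappa>: "0 < \<kappa>" "N * \<kappa>\<^sup>2 = \<epsilon> / 2" using \<epsilon>(1) N by (auto simp: \<kappa>_def)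
  define R where "R l = F (z1 + l) - F z1 - l * D" for l
  have "(F has_field_derivative D) (at z1)"
    unfolding D_def using F(1) by (intro holomorphic_derivI) auto
  then obtain d where d: "0 < d" "\<And>l. cmod l < d \<Longrightarrow> cmod (R l) \<le> \<kappa> * cmod l"
  proof -
    assume "(F has_field_derivative D) (at z1)"
    then have "(F has_derivative (\<lambda>h. D * h)) (at z1)" by (simp add: has_field_derivative_def)
    then obtain d where d: "0 < d" "\<And>y. norm (y - z1) < d \<Longrightarrow> norm (F y - F z1 - D * (y - z1)) \<le> \<kappa> * norm (y - z1)"
      unfolding has_derivative_at_alt using \<kappa>(1) by blast
    show thesis
    proof (rule that[OF d(1)])
      fix l assume "cmod l < d"
      then show "cmod (R l) \<le> \<kappa> * cmod l" using d(2)[of "z1 + l"] by (simp add: R_def mult.commute)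
    qed
  qed
  define s where "s = min (d / 2) (min ((r - cmod (z1 - a)) / 2) ((\<rho> - cmod \<tau>1) / (cmod D + 1)))"
  have D1: "0 < cmod D + 1" by (smt (verit) norm_ge_zero)
  have s: "0 < s" "s < d" "s < r - cmod (z1 - a)" "s * (cmod D + 1) \<le> \<rho> - cmod \<tau>1"
  proof -
    show "0 < s" using d z1 \<tau>1 D1 by (auto simp: s_def)
    have "s \<le> d / 2" "s \<le> (r - cmod (z1 - a)) / 2" "s \<le> (\<rho> - cmod \<tau>1) / (cmod D + 1)"
      unfolding s_def by (meson min.cobounded1 min.cobounded2 order_trans)+
    then show "s < d" "s < r - cmod (z1 - a)" "s * (cmod D + 1) \<le> \<rho> - cmod \<tau>1"
      using d z1 D1 by (auto simp: pos_le_divide_eq)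
  qed
  have inK: "(z1 + l * 1, \<tau>1 + l * D) \<in> K" if "cmod l \<le> s" for l
  proof -
    have "cmod (z1 + l - a) \<le> cmod (z1 - a) + cmod l" using norm_triangle_ineq[of "z1 - a" l] by (simp add: algebra_simps)
    moreover have "cmod (\<tau>1 + l * D) \<le> cmod \<tau>1 + cmod l * cmod D" using norm_triangle_ineq[of \<tau>1 "l * D"] by (simp add: norm_mult)
    moreover have "cmod l * cmod D \<le> s * (cmod D + 1)" using that s(1) by (intro mult_mono) auto
    moreover have "cmod (a - (z1 + l)) = cmod (z1 + l - a)" by (rule norm_minus_commute)
    ultimately have "cmod (a - (z1 + l)) \<le> r" "cmod (\<tau>1 + l * D) \<le> \<rho>" using that s by linarith+
    then show ?thesis unfolding K_def mem_Times_iff by (simp only: fst_conv snd_conv mem_cball dist_norm mult_1_right diff_0 norm_minus_cancel simp_thms)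
  qed
  \<comment> \<open>On |l| = s the real part dominates \<open>u\<close> by maximality of
    \<open>W\<close>: the square |z1 + l - a|^2 is expanded with |l|^2 = s^2, and in the penalty |R
    l|^2 is replaced by its bound \<kappa>^2 s^2. What remains is holomorphic in l.\<close>
  define p where "p l = of_real M + P (z1 + l)
      - of_real \<epsilon> * (of_real ((cmod (z1 - a))\<^sup>2) + 2 * cnj (z1 - a) * l + of_real (s\<^sup>2))
      + of_real N * (of_real ((cmod y)\<^sup>2) - 2 * cnj y * R l + of_real (\<kappa>\<^sup>2 * s\<^sup>2))" for l
  have comp: "(\<lambda>l. G (z1 + l)) holomorphic_on UNIV" if "G holomorphic_on UNIV" for G
  proof -
    have "(\<lambda>l. z1 + l) holomorphic_on UNIV" by (intro holomorphic_intros)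
    from holomorphic_on_compose_gen[OF this that] show ?thesis by (simp add: o_def)
  qed
  have hp: "p holomorphic_on UNIV"
    unfolding p_def R_def by (intro holomorphic_intros comp P F)
  have "u (z1 + 0 * 1, \<tau>1 + 0 * D) \<le> ereal (Re (p 0))"
  proof (rule subharmonic_onD[OF psh_on_line[OF u] s(1) _ hp])
    show "cball 0 s \<subseteq> {l. (z1 + l * 1, \<tau>1 + l * D) \<in> UNIV \<times> ball 0 1}"
      using inK KU by (intro subsetI CollectI) (meson mem_cball_0 subsetD)
    fix l :: complex assume "l \<in> sphere 0 s"
    then have l: "cmod l = s" by simp
    have n1: "(cmod (z1 + l - a))\<^sup>2 = (cmod (z1 - a))\<^sup>2 + 2 * Re (cnj (z1 - a) * l) + s\<^sup>2"
      using cmod_add_square[of "z1 - a" l] l by (simp add: algebra_simps)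
    have "\<tau>1 + l * D - F (z1 + l) = y + - R l" by (simp add: y_def R_def)
    then have n2: "(cmod (\<tau>1 + l * D - F (z1 + l)))\<^sup>2 = (cmod y)\<^sup>2 - 2 * Re (cnj y * R l) + (cmod (R l))\<^sup>2"
      using cmod_add_square[of y "- R l"] by simp
    have "(cmod (R l))\<^sup>2 \<le> (\<kappa> * s)\<^sup>2" using d(2)[of l] l s(2) by (intro power_mono) auto
    then have "N * (cmod (\<tau>1 + l * D - F (z1 + l)))\<^sup>2 \<le> N * ((cmod y)\<^sup>2 - 2 * Re (cnj y * R l) + \<kappa>\<^sup>2 * s\<^sup>2)"
      unfolding n2 using N by (intro mult_left_mono) (auto simp: power_mult_distrib)
    then have le: "M - (- Re (P (z1 + l)) + \<epsilon> * (cmod (z1 + l - a))\<^sup>2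
         + - N * (cmod (\<tau>1 + l * D - F (z1 + l)))\<^sup>2) \<le> Re (p l)"
      unfolding n1 p_def by (simp add: algebra_simps)
    have "W (z1 + l * 1, \<tau>1 + l * D) \<le> ereal M" using x(2)[OF inK] WM l by simp
    then have "u (z1 + l * 1, \<tau>1 + l * D) + ereal (- Re (P (z1 + l)) + \<epsilon> * (cmod (z1 + l - a))\<^sup>2
         + - N * (cmod (\<tau>1 + l * D - F (z1 + l)))\<^sup>2) \<le> ereal M"
      unfolding W_def V_def fst_conv snd_conv mult_1_right add.assoc plus_ereal.simps(1) .
    then have "u (z1 + l * 1, \<tau>1 + l * D) \<le> ereal (M - (- Re (P (z1 + l)) + \<epsilon> * (cmod (z1 + l - a))\<^sup>2
         + - N * (cmod (\<tau>1 + l * D - F (z1 + l)))\<^sup>2))" by (simp only: ereal_shift)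
    also have "\<dots> \<le> ereal (Re (p l))" using le by simp
    finally show "u (z1 + l * 1, \<tau>1 + l * D) \<le> ereal (Re (p l))" .
  qed
  moreover have "Re (p 0) = c - \<epsilon> * s\<^sup>2 + N * \<kappa>\<^sup>2 * s\<^sup>2"
    by (simp add: p_def M_def R_def algebra_simps)
  ultimately have "c \<le> c - \<epsilon> * s\<^sup>2 + \<epsilon> / 2 * s\<^sup>2" using c \<kappa>(2) by (simp add: x_eq)
  moreover have "0 < \<epsilon> * s\<^sup>2" using \<epsilon>(1) s(1) by simp
  ultimately show False by simp
qed

section \<open>The projective line and Kaehler potentials\<close>

lemma topspace_P1_top [simp]: "topspace P1_top = UNIV"
  by (auto simp: P1_top_def) (metis UNIV_I notin_range_Some)

lemma compact_space_P1_top: "compact_space P1_top"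
  by (simp add: P1_top_def)

lemma P1_charts_cases:
  assumes "\<kappa> \<in> P1_charts"
  obtains "\<kappa> = Some" | "\<kappa> = chart_infinity"
  using assms by (auto simp: P1_charts_def)

lemma P1_charts_mem [simp]: "Some \<in> P1_charts" "chart_infinity \<in> P1_charts"
  by (auto simp: P1_charts_def)

lemma chart_infinity_simps [simp]: "chart_infinity 0 = None" "w \<noteq> 0 \<Longrightarrow> chart_infinity w = Some (1 / w)"
  by (auto simp: chart_infinity_def)

lemma P1_covered_by_unit_discs:
  obtains \<kappa> z where "\<kappa> \<in> P1_charts" "z \<in> cball 0 1" "x = \<kappa> z"
proof (cases x)
  case None
  then show thesis using that[of chart_infinity 0] by auto
next
  case (Some w)
  show thesis
  proof (cases "cmod w \<le> 1")
    case True
    then show thesis using that[of Some w] Some by auto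
  next
    case False
    then have "w \<noteq> 0" by auto
    then show thesis
      using that[of chart_infinity "1 / w"] Some False by (auto simp: norm_divide)
  qed
qed

lemma open_inverse_vimage: "open U \<Longrightarrow> open {w::complex. w \<noteq> 0 \<and> 1 / w \<in> U}"
proof -
  assume U: "open U"
  have "open ((\<lambda>w::complex. 1 / w) -` U \<inter> (- {0}))"
    by (rule continuous_on_open_vimage[THEN iffD1, rule_format, OF _ _ U]) (auto intro!: continuous_intros)
  moreover have "(\<lambda>w::complex. 1 / w) -` U \<inter> (- {0}) = {w. w \<noteq> 0 \<and> 1 / w \<in> U}" by auto
  ultimately show ?thesis by simp
qed

text \<open>Reconciles the compactification with the atlas. Complements of compact sets contain some
  {|z| > B}, which is the punctured disc |w| < 1/B in the chart at infinity; conversely an open set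
  around w = 0 has bounded complement in the z-plane.\<close>

lemma openin_P1_top_iff: "openin P1_top V \<longleftrightarrow> (\<forall>\<kappa>\<in>P1_charts. open (\<kappa> -` V))"
proof
  assume V: "openin P1_top V"
  have "open (Some -` V)"
    using openin_continuous_map_preimage[OF continuous_map_Some V[unfolded P1_top_def]]
    by (simp add: vimage_def)
  moreover have "open (chart_infinity -` V)"
    using V unfolding P1_top_def openin_Alexandroff_compactification
  proof (elim disjE exE conjE)
    fix U :: "complex set" assume U: "openin euclidean U" "V = Some ` U"
    have "chart_infinity -` V = {w. w \<noteq> 0 \<and> 1 / w \<in> U}"
      by (auto simp: U chart_infinity_def split: if_splits)
    then show ?thesis using open_inverse_vimage U by simp
  next
    fix C :: "complex set"
    assume C: "compactin euclidean C" "closedin euclidean C" "V = insert None (Some ` (topspace euclidean - C))"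
    then have "bounded C" by (auto intro: compact_imp_bounded)
    then obtain B where B: "0 < B" "\<And>x. x \<in> C \<Longrightarrow> cmod x \<le> B" by (auto simp: bounded_pos)
    have "1 / w \<notin> C" if "w \<noteq> 0" "cmod w < 1 / B" for w
    proof
      assume "1 / w \<in> C"
      then have "cmod (1 / w) \<le> B" by (rule B)
      then have "1 \<le> B * cmod w" using that by (simp add: norm_divide pos_divide_le_eq)
      moreover have "B * cmod w < 1" using that(2) B(1) by (simp add: pos_less_divide_eq mult.commute)
      ultimately show False by simp
    qed
    then have "chart_infinity -` V = ball 0 (1 / B) \<union> {w. w \<noteq> 0 \<and> 1 / w \<in> - C}"
      using B(1) by (auto simp: C chart_infinity_def split: if_splits)
    moreover have "open (- C)" using C by (auto simp: open_Compl)
    ultimately show ?thesis using open_inverse_vimage by (metis open_Un open_ball)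
  qed
  ultimately show "\<forall>\<kappa>\<in>P1_charts. open (\<kappa> -` V)" by (auto simp: P1_charts_def)
next
  assume "\<forall>\<kappa>\<in>P1_charts. open (\<kappa> -` V)"
  then have o: "open (Some -` V)" "open (chart_infinity -` V)" by auto
  show "openin P1_top V"
  proof (cases "None \<in> V")
    case False
    then have "V = Some ` (Some -` V)" by (auto simp: image_iff) (metis not_None_eq)
    then show ?thesis using o(1) unfolding P1_top_def by (metis open_openin openin_Alexandroff_compactification)
  next
    case True
    then have "0 \<in> chart_infinity -` V" by simp
    then obtain d where d: "0 < d" "ball 0 d \<subseteq> chart_infinity -` V" using o(2) by (meson openE)
    let ?C = "- (Some -` V)"
    have "cmod x \<le> 1 / d" if "x \<in> ?C" for x
    proof (rule ccontr)
      assume "\<not> cmod x \<le> 1 / d"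
      then have "1 / d < cmod x" by simp
      moreover have "0 < 1 / d" using d by simp
      ultimately have x: "0 < cmod x" "1 < cmod x * d" using d by (auto simp: pos_divide_less_eq intro: less_trans)
      then have "cmod (1 / x) < d" by (simp add: norm_divide pos_divide_less_eq mult.commute)
      then have "1 / x \<in> chart_infinity -` V" using d by auto
      then show False using x that by auto
    qed
    then have "bounded ?C" by (auto simp: bounded_iff)
    moreover have "closed ?C" using o(1) by (simp add: closed_Compl)
    ultimately have "compact ?C" by (simp add: compact_eq_bounded_closed)
    moreover have "V = insert None (Some ` (topspace euclidean - ?C))"
      using True by (auto simp: image_iff)
    ultimately show ?thesis using \<open>closed ?C\<close> unfolding P1_top_def openin_Alexandroff_compactification
      by (metis closed_closedin compactin_euclidean_iff)
  qed
qed

lemma continuous_map_P1_chart: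
  assumes "\<kappa> \<in> P1_charts"
  shows "continuous_map euclidean P1_top \<kappa>"
  using assms by (auto simp: continuous_map_def openin_P1_top_iff vimage_def)

lemma usc_on_P1_iff: "usc_on P1_top \<psi> \<longleftrightarrow> (\<forall>\<kappa>\<in>P1_charts. usc_on (top_of_set UNIV) (\<lambda>z. \<psi> (\<kappa> z)))"
proof safe
  fix \<kappa> assume "usc_on P1_top \<psi>" "\<kappa> \<in> P1_charts"
  then show "usc_on (top_of_set UNIV) (\<lambda>z. \<psi> (\<kappa> z))"
    by (simp add: usc_on_compose[OF continuous_map_P1_chart])
next
  assume *: "\<forall>\<kappa>\<in>P1_charts. usc_on (top_of_set UNIV) (\<lambda>z. \<psi> (\<kappa> z))"
  show "usc_on P1_top \<psi>" unfolding usc_on_def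
  proof safe
    fix c show "openin P1_top {x \<in> topspace P1_top. \<psi> x < c}"
      using * by (auto simp: openin_P1_top_iff usc_on_def vimage_def)
  next
    fix x assume "\<psi> x = \<infinity>"
    moreover obtain \<kappa> z where "\<kappa> \<in> P1_charts" "x = \<kappa> z" by (metis P1_covered_by_unit_discs)
    ultimately show False using * by (auto simp: usc_on_def)
  qed
qed

lemma continuous_on_FS_potential: "continuous_on S FS_potential"
proof -
  have "1 + (cmod z)\<^sup>2 \<noteq> 0" for z by (metis add_pos_nonneg less_irrefl zero_le_power2 zero_less_one)
  then show ?thesis unfolding FS_potential_def by (intro continuous_intros) auto
qed

lemma FS_potential_nonneg: "0 \<le> FS_potential z"
  by (simp add: FS_potential_def)

lemma usc_on_FS_add_iff: "usc_on (top_of_set S) (\<lambda>z. ereal (FS_potential z) + f z) \<longleftrightarrow> usc_on (top_of_set S) f"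
proof
  assume "usc_on (top_of_set S) (\<lambda>z. ereal (FS_potential z) + f z)"
  then have "usc_on (top_of_set S) (\<lambda>z. ereal (- FS_potential z) + (ereal (FS_potential z) + f z))"
    by (rule usc_on_add[rotated]) (intro usc_on_ereal continuous_intros continuous_on_FS_potential)
  then show "usc_on (top_of_set S) f"
    by (rule usc_on_cong) (simp add: add.assoc[symmetric] zero_ereal_def[symmetric])
next
  assume "usc_on (top_of_set S) f"
  then show "usc_on (top_of_set S) (\<lambda>z. ereal (FS_potential z) + f z)"
    by (intro usc_on_add usc_on_ereal continuous_on_FS_potential)
qed

lemma FS_sh_D: "FS_sh \<psi> \<Longrightarrow> \<kappa> \<in> P1_charts \<Longrightarrow> subharmonic_on UNIV (\<lambda>z. ereal (FS_potential z) + \<psi> (\<kappa> z))"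
  by (auto simp: FS_sh_def)

lemma kaehler_continuous:
  assumes "kaehler_potential \<phi>" "\<kappa> \<in> P1_charts"
  shows "continuous_on S (\<lambda>z. \<phi> (\<kappa> z))"
proof -
  have "Ck_on 0 UNIV (\<phi> \<circ> \<kappa>)" using assms unfolding kaehler_potential_def smooth_P1_def by blast
  then show ?thesis by (auto simp: o_def elim: continuous_on_subset)
qed

lemma kaehler_usc: "kaehler_potential \<phi> \<Longrightarrow> usc_on P1_top (\<lambda>x. ereal (\<phi> x))"
  unfolding usc_on_P1_iff by (intro ballI usc_on_ereal kaehler_continuous)

lemma kaehler_bounded:
  assumes "kaehler_potential \<phi>"
  obtains B where "0 \<le> B" "\<And>x. \<bar>\<phi> x\<bar> \<le> B"
proof -
  have "bounded ((\<lambda>z. \<phi> (\<kappa> z)) ` cball 0 1)" if "\<kappa> \<in> P1_charts" for \<kappa>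
    by (intro compact_imp_bounded compact_continuous_image kaehler_continuous assms that compact_cball)
  then have "bounded ((\<lambda>z. \<phi> (Some z)) ` cball 0 1 \<union> (\<lambda>z. \<phi> (chart_infinity z)) ` cball 0 1)"
    by (simp add: bounded_Un)
  then obtain B where B: "0 < B" "\<And>y. y \<in> (\<lambda>z. \<phi> (Some z)) ` cball 0 1 \<union> (\<lambda>z. \<phi> (chart_infinity z)) ` cball 0 1 \<Longrightarrow> norm y \<le> B"
    by (metis bounded_pos)
  show thesis
  proof (rule that[of B])
    fix x obtain \<kappa> z where "\<kappa> \<in> P1_charts" "z \<in> cball 0 1" "x = \<kappa> z" by (rule P1_covered_by_unit_discs)
    then show "\<bar>\<phi> x\<bar> \<le> B" using B(2)[of "\<phi> x"] by (auto elim!: P1_charts_cases)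
  qed (use B in auto)
qed

section \<open>Positive Laplacian implies subharmonicity\<close>

definition twice_diff :: "(complex \<Rightarrow> real) \<Rightarrow> bool" where
  "twice_diff f \<longleftrightarrow> (\<forall>w. f differentiable (at w)) \<and>
     (\<forall>b w. (\<lambda>w. frechet_derivative f (at w) b) differentiable (at w))"

lemma twice_diff_FS_potential: "twice_diff FS_potential"
proof -
  have pos: "0 < 1 + w \<bullet> w" for w :: complex by (simp add: add_pos_nonneg)
  have F: "FS_potential = (\<lambda>w. ln (1 + w \<bullet> w))"
    by (auto simp: FS_potential_def power2_norm_eq_inner)
  have der: "(FS_potential has_derivative (\<lambda>v. 2 * (w \<bullet> v) / (1 + w \<bullet> w))) (at w)" for w
    unfolding F by (rule derivative_eq_intros refl pos)+ (simp add: inner_commute field_simps)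
  then have fd: "frechet_derivative FS_potential (at w) = (\<lambda>v. 2 * (w \<bullet> v) / (1 + w \<bullet> w))" for w
    using frechet_derivative_at by metis
  have "(\<lambda>w. 2 * (w \<bullet> b) / (1 + w \<bullet> w)) differentiable (at w)" for b w :: complex
    unfolding differentiable_def
    by (rule exI, (rule derivative_eq_intros refl)+) (use pos[of w] in auto)
  then show ?thesis unfolding twice_diff_def fd using der differentiable_def by blast
qed

lemma twice_diff_second_derivative:
  assumes "twice_diff f"
  shows "((\<lambda>t. f (x + of_real t * b)) has_real_derivative frechet_derivative f (at (x + of_real t * b)) b) (at t)"
    and "((\<lambda>t. frechet_derivative f (at (x + of_real t * b)) b) has_real_derivative
        frechet_derivative (\<lambda>w. frechet_derivative f (at w) b) (at (x + of_real t * b)) b) (at t)"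
proof -
  have *: "((\<lambda>t. g (x + of_real t * b)) has_real_derivative frechet_derivative g (at (x + of_real t * b)) b) (at t)"
    if "g differentiable (at (x + of_real t * b))" for g :: "complex \<Rightarrow> real"
  proof -
    let ?D = "frechet_derivative g (at (x + of_real t * b))"
    have D: "(g has_derivative ?D) (at (x + of_real t * b))" using that frechet_derivative_works by blast
    have "((\<lambda>t. x + of_real t * b) has_derivative (\<lambda>h. of_real h * b)) (at t)"
      by (auto intro!: derivative_eq_intros)
    from has_derivative_compose[OF this D]
    have "((\<lambda>t. g (x + of_real t * b)) has_derivative (\<lambda>h. ?D (of_real h * b))) (at t)" .
    moreover have "(\<lambda>h. ?D (of_real h * b)) = (*) (?D b)"
      using linear_scale[OF has_derivative_linear[OF D], of _ b] by (auto simp: scaleR_conv_of_real mult.commute)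
    ultimately show ?thesis by (simp add: has_field_derivative_def)
  qed
  show "((\<lambda>t. f (x + of_real t * b)) has_real_derivative frechet_derivative f (at (x + of_real t * b)) b) (at t)"
    using assms by (intro *) (auto simp: twice_diff_def)
  show "((\<lambda>t. frechet_derivative f (at (x + of_real t * b)) b) has_real_derivative
        frechet_derivative (\<lambda>w. frechet_derivative f (at w) b) (at (x + of_real t * b)) b) (at t)"
    using assms by (intro *) (auto simp: twice_diff_def)
qed

text \<open>If c were positive, h' would be positive just to the right of its zero at 0, and the
  mean value theorem would give a value larger than h 0.\<close>

lemma second_derivative_local_max:
  fixes h h' :: "real \<Rightarrow> real"
  assumes h: "\<And>t. (h has_real_derivative h' t) (at t)" and h': "(h' has_real_derivative c) (at 0)"
    and d: "0 < d" and max: "\<And>t. \<bar>t\<bar> < d \<Longrightarrow> h t \<le> h 0"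
  shows "c \<le> 0"
proof (rule ccontr)
  assume "\<not> c \<le> 0"
  then have "0 < c" by simp
  have "h' 0 = 0" by (rule DERIV_local_max[OF h d]) (use max in auto)
  from DERIV_pos_inc_right[OF h' \<open>0 < c\<close>] obtain e where e: "0 < e" "\<And>t. 0 < t \<Longrightarrow> t < e \<Longrightarrow> 0 < h' t"
    using \<open>h' 0 = 0\<close> by auto
  define s where "s = min d e / 2"
  have s: "0 < s" "s < d" "s < e" using d e by (auto simp: s_def)
  have "\<exists>z>0. z < s \<and> h s - h 0 = (s - 0) * h' z" by (rule MVT2[OF s(1)]) (use h in auto)
  then obtain z where z: "0 < z" "z < s" "h s - h 0 = s * h' z" by auto
  have "0 < s * h' z" using e(2)[of z] z s by (intro mult_pos_pos) auto
  then show False using max[of s] s z by auto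
qed

text \<open>If a harmonic majorant fails at the centre, the difference has an interior maximum,
  where the second derivatives in the two coordinate directions are nonpositive. Their sum is the
  Laplacian, which was assumed positive.\<close>

lemma kaehler_FS_sh:
  assumes \<phi>: "kaehler_potential \<phi>"
  shows "FS_sh (\<lambda>x. ereal (\<phi> x))"
  unfolding FS_sh_def
proof
  fix \<kappa> assume \<kappa>: "\<kappa> \<in> P1_charts"
  define f where "f z = FS_potential z + \<phi> (\<kappa> z)" for z
  have contf: "continuous_on S f" for S
    unfolding f_def by (intro continuous_intros continuous_on_FS_potential kaehler_continuous \<phi> \<kappa>)
  have "Ck_on (Suc (Suc 0)) UNIV (\<phi> \<circ> \<kappa>)" using \<phi> \<kappa> unfolding kaehler_potential_def smooth_P1_def by blast
  then have td: "twice_diff (\<phi> \<circ> \<kappa>)" by (auto simp: twice_diff_def)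
  have "subharmonic_on UNIV (\<lambda>z. ereal (f z))"
  proof (rule subharmonic_onI)
    show "usc_on (top_of_set UNIV) (\<lambda>z. ereal (f z))" by (rule usc_on_ereal[OF contf])
    fix a r p assume r: "0 < r" and p: "p holomorphic_on UNIV"
      and less: "\<And>z. z \<in> sphere a r \<Longrightarrow> ereal (f z) < ereal (Re (p z))"
    show "ereal (f a) \<le> ereal (Re (p a))"
    proof (rule ccontr)
      assume "\<not> ereal (f a) \<le> ereal (Re (p a))"
      then have fa: "Re (p a) < f a" by simp
      define g where "g z = f z - Re (p z)" for z
      have "continuous_on (cball a r) g" unfolding g_def
        using holomorphic_on_imp_continuous_on[OF p]
        by (intro continuous_intros contf) (auto elim: continuous_on_subset)
      moreover have "cball a r \<noteq> {}" using r by simp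
      ultimately obtain x where x: "x \<in> cball a r" "\<And>z. z \<in> cball a r \<Longrightarrow> g z \<le> g x"
        using continuous_attains_sup[OF compact_cball] by metis
      have "0 < g x" using x(2)[of a] r fa by (simp add: g_def)
      then have "x \<notin> sphere a r" using less[of x] by (auto simp: g_def)
      then have "x \<in> ball a r" using x(1) by auto
      then obtain d where d: "0 < d" "ball x d \<subseteq> ball a r" using open_ball openE by blast
      define p' where "p' = deriv p"
      have p': "(p has_field_derivative p' w) (at w)" for w
        unfolding p'_def by (rule holomorphic_derivI[OF p]) auto
      have p'': "(p' has_field_derivative deriv p' w) (at w)" for w
        unfolding p'_def by (rule holomorphic_derivI[OF holomorphic_deriv[OF p]]) auto
      let ?D = "\<lambda>u b. frechet_derivative (\<lambda>w. frechet_derivative u (at w) b) (at x) b"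
      have key: "?D FS_potential b + ?D (\<phi> \<circ> \<kappa>) b - Re (deriv p' x * b * b) \<le> 0" if b: "cmod b = 1" for b
      proof -
        let ?z = "\<lambda>t. x + of_real t * b"
        let ?h = "\<lambda>t. g (?z t)"
        let ?h' = "\<lambda>t. frechet_derivative FS_potential (at (?z t)) b + frechet_derivative (\<phi> \<circ> \<kappa>) (at (?z t)) b - Re (p' (?z t) * b)"
        have line: "((\<lambda>t. Re (G (?z t))) has_real_derivative Re (G' * b)) (at t)"
          if "(G has_field_derivative G') (at (?z t))" for G G' t
        proof -
          have "((\<lambda>t. ?z t) has_vector_derivative b) (at t)"
            by (auto intro!: derivative_eq_intros simp: has_vector_derivative_def scaleR_conv_of_real)
          from field_vector_diff_chain_at[OF this that]
          have "((\<lambda>t. G (?z t)) has_vector_derivative (b * G')) (at t)" by (simp add: o_def)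
          then have "((\<lambda>t. Re (G (?z t))) has_vector_derivative Re (b * G')) (at t)"
            by (rule bounded_linear.has_vector_derivative[OF bounded_linear_Re])
          then show ?thesis by (simp add: has_real_derivative_iff_has_vector_derivative mult.commute)
        qed
        have pb: "((\<lambda>w. p' w * b) has_field_derivative deriv p' w * b) (at w)" for w
          by (rule DERIV_cmult_right[OF p''])
        have 1: "(?h has_real_derivative ?h' t) (at t)" for t
          unfolding g_def f_def
          using twice_diff_second_derivative(1)[OF twice_diff_FS_potential] twice_diff_second_derivative(1)[OF td] line[OF p']
          by (intro DERIV_diff DERIV_add) (auto simp: o_def)
        have 2: "(?h' has_real_derivative ?D FS_potential b + ?D (\<phi> \<circ> \<kappa>) b - Re (deriv p' x * b * b)) (at 0)"
          using twice_diff_second_derivative(2)[OF twice_diff_FS_potential, of x b 0]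
            twice_diff_second_derivative(2)[OF td, of x b 0] line[OF pb, of 0]
          by (intro DERIV_diff DERIV_add) auto
        show ?thesis
        proof (rule second_derivative_local_max[OF 1 2 d(1)])
          fix t :: real assume "\<bar>t\<bar> < d"
          then have "?z t \<in> ball x d" using b by (simp add: dist_norm norm_mult)
          then show "?h t \<le> ?h 0" using x(2) d(2) by auto
        qed
      qed
      have "0 < ddc FS_potential x + ddc (\<phi> \<circ> \<kappa>) x" using \<phi> \<kappa> by (auto simp: kaehler_potential_def)
      then have "0 < (\<Sum>b\<in>Basis. ?D FS_potential b) + (\<Sum>b\<in>Basis. ?D (\<phi> \<circ> \<kappa>) b)"
        unfolding ddc_def by (simp add: add_divide_distrib[symmetric] zero_less_divide_iff)
      \<comment> \<open>Harmonicity of Re p: the two contributions of p'' cancel because 1 * 1 +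
        \<i> * \<i> = 0.\<close>
      also have "\<dots> = (?D FS_potential 1 + ?D (\<phi> \<circ> \<kappa>) 1 - Re (deriv p' x * 1 * 1)) +
          (?D FS_potential \<i> + ?D (\<phi> \<circ> \<kappa>) \<i> - Re (deriv p' x * \<i> * \<i>))"
        by (simp add: Basis_complex_def)
      also have "\<dots> \<le> 0" using key[of 1] key[of \<i>] by simp
      finally show False by simp
    qed
  qed
  then show "subharmonic_on UNIV (\<lambda>z. ereal (FS_potential z) + ereal (\<phi> (\<kappa> z)))" by (simp add: f_def)
qed

section \<open>The envelopes on the projective line\<close>

definition psi_cand :: "(P1 \<Rightarrow> real) \<Rightarrow> real \<Rightarrow> (P1 \<Rightarrow> ereal) \<Rightarrow> bool" where
  "psi_cand \<phi> t \<psi> \<longleftrightarrow> usc_on P1_top \<psi> \<and> FS_sh \<psi> \<and> (\<forall>x. \<psi> x \<le> ereal (\<phi> x)) \<and> lelong_ge \<psi> t"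

lemma psi_env_eq: "psi_env \<phi> t z = (SUP \<psi>\<in>Collect (psi_cand \<phi> t). \<psi> z)"
proof -
  have "Collect (psi_cand \<phi> t) = {\<psi>. usc_on P1_top \<psi> \<and> FS_sh \<psi> \<and> (\<forall>x. \<psi> x \<le> ereal (\<phi> x)) \<and> lelong_ge \<psi> t}"
    unfolding psi_cand_def by (rule refl)
  then show ?thesis by (simp only: psi_env_def)
qed

lemma psi_cand_le_env: "psi_cand \<phi> t \<psi> \<Longrightarrow> \<psi> z \<le> psi_env \<phi> t z"
  unfolding psi_env_eq by (rule SUP_upper) simp

lemma psi_env_leI: "(\<And>\<psi>. psi_cand \<phi> t \<psi> \<Longrightarrow> \<psi> z \<le> c) \<Longrightarrow> psi_env \<phi> t z \<le> c"
  unfolding psi_env_eq by (rule SUP_least) simp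

lemma psi_env_le: "psi_env \<phi> t z \<le> ereal (\<phi> z)"
  by (rule psi_env_leI) (simp add: psi_cand_def)

lemma FS_sh_imp_usc: "FS_sh \<psi> \<Longrightarrow> usc_on P1_top \<psi>"
  unfolding usc_on_P1_iff using FS_sh_D subharmonic_on_usc usc_on_FS_add_iff by blast

lemma psi_candI:
  "FS_sh \<psi> \<Longrightarrow> (\<And>x. \<psi> x \<le> ereal (\<phi> x)) \<Longrightarrow> lelong_ge \<psi> t \<Longrightarrow> psi_cand \<phi> t \<psi>"
  by (simp add: psi_cand_def FS_sh_imp_usc)

lemma lelong_geI:
  assumes "\<And>z. cmod z < 1 \<Longrightarrow> \<psi> (Some z) \<le> ereal t * ln_ext ((cmod z)\<^sup>2) + ereal C"
  shows "lelong_ge \<psi> t"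
  unfolding lelong_ge_def
proof (rule exI[of _ C])
  have "\<forall>\<^sub>F z in nhds 0. z \<in> ball (0::complex) 1" by (rule eventually_nhds_in_open) auto
  then show "\<forall>\<^sub>F z in nhds 0. \<psi> (Some z) \<le> ereal t * ln_ext ((cmod z)\<^sup>2) + ereal C"
    by eventually_elim (auto intro: assms)
qed

text \<open>The radius is capped at 1 so that ln |z|^2 is nonpositive, which is what comparing
  different slopes requires.\<close>

lemma lelong_geE:
  assumes "lelong_ge \<psi> t"
  obtains C d where "0 < d" "d \<le> 1" "\<And>z. cmod z < d \<Longrightarrow> \<psi> (Some z) \<le> ereal t * ln_ext ((cmod z)\<^sup>2) + ereal C"
proof -
  obtain C where "\<forall>\<^sub>F z in nhds 0. \<psi> (Some z) \<le> ereal t * ln_ext ((cmod z)\<^sup>2) + ereal C"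
    using assms by (auto simp: lelong_ge_def)
  then obtain d where "0 < d" "\<And>z. dist z 0 < d \<Longrightarrow> \<psi> (Some z) \<le> ereal t * ln_ext ((cmod z)\<^sup>2) + ereal C"
    by (auto simp: eventually_nhds_metric)
  then show thesis by (intro that[of "min d 1" C]) auto
qed

lemma ln_cmod_square_neg: "cmod z < 1 \<Longrightarrow> ln ((cmod z)\<^sup>2) \<le> 0"
  by (cases "z = 0") (auto simp: abs_square_le_1 less_imp_le)

lemma ln_cmod_square: "z \<noteq> 0 \<Longrightarrow> ln ((cmod z)\<^sup>2) = 2 * ln (cmod z)"
  by (simp add: ln_realpow)

lemma FS_potential_le_ln_2: "cmod w \<le> 1 \<Longrightarrow> FS_potential w \<le> ln 2"
  unfolding FS_potential_def by (subst ln_le_cancel_iff) (auto intro: add_pos_nonneg simp: power_le_one)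

lemma lelong_ge_mono:
  assumes "lelong_ge \<psi> t" "s \<le> t"
  shows "lelong_ge \<psi> s"
proof -
  obtain C d where d: "0 < d" "d \<le> 1" "\<And>z. cmod z < d \<Longrightarrow> \<psi> (Some z) \<le> ereal t * ln_ext ((cmod z)\<^sup>2) + ereal C"
    by (rule lelong_geE[OF assms(1)], rule that)
  have "\<psi> (Some z) \<le> ereal s * ln_ext ((cmod z)\<^sup>2) + ereal C" if z: "cmod z < d" for z
  proof -
    have "ereal t * ln_ext ((cmod z)\<^sup>2) \<le> ereal s * ln_ext ((cmod z)\<^sup>2)"
    proof (cases "z = 0")
      case True
      then show ?thesis using assms(2) by (auto simp: ln_ext_def zero_ereal_def[symmetric])
    next
      case False
      then show ?thesis using assms(2) ln_cmod_square_neg[of z] z d(2)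
        by (auto simp: ln_ext_def intro: mult_right_mono_neg)
    qed
    then show ?thesis using d(3)[OF z] by (meson add_right_mono order_trans)
  qed
  then show ?thesis unfolding lelong_ge_def eventually_nhds_metric using d(1) by auto
qed

lemma psi_env_antimono: "s \<le> t \<Longrightarrow> psi_env \<phi> t z \<le> psi_env \<phi> s z"
  by (rule psi_env_leI, rule psi_cand_le_env) (auto simp: psi_cand_def intro: lelong_ge_mono)

lemma psi_env_nonpos:
  assumes \<phi>: "kaehler_potential \<phi>" and t: "t \<le> 0"
  shows "psi_env \<phi> t z = ereal (\<phi> z)"
proof (rule antisym[OF psi_env_le])
  obtain B where B: "\<And>x. \<bar>\<phi> x\<bar> \<le> B" using kaehler_bounded[OF \<phi>] by blast
  have "lelong_ge (\<lambda>x. ereal (\<phi> x)) 0"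
    by (rule lelong_geI[of _ _ B]) (use B in \<open>simp add: abs_le_iff zero_ereal_def[symmetric]\<close>)
  then have "psi_cand \<phi> t (\<lambda>x. ereal (\<phi> x))"
    using lelong_ge_mono t by (intro psi_candI kaehler_FS_sh \<phi>) auto
  then show "ereal (\<phi> z) \<le> psi_env \<phi> t z" by (rule psi_cand_le_env)
qed

lemma psi_cand_at_0:
  assumes "psi_cand \<phi> t \<psi>" "0 < t"
  shows "\<psi> (Some 0) = -\<infinity>"
proof -
  obtain C d where d: "0 < d" "\<And>z. cmod z < d \<Longrightarrow> \<psi> (Some z) \<le> ereal t * ln_ext ((cmod z)\<^sup>2) + ereal C"
    using assms(1) lelong_geE unfolding psi_cand_def by metis
  then show ?thesis using d(2)[of 0] assms(2) by (simp add: ln_ext_def)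
qed

lemma psi_env_at_0: "0 < t \<Longrightarrow> psi_env \<phi> t (Some 0) = -\<infinity>"
  using psi_env_leI[of \<phi> t "Some 0" "-\<infinity>"] psi_cand_at_0 by force

lemma psi_cand_subharmonic:
  "psi_cand \<phi> t \<psi> \<Longrightarrow> \<kappa> \<in> P1_charts \<Longrightarrow> subharmonic_on UNIV (\<lambda>z. ereal (FS_potential z) + \<psi> (\<kappa> z))"
  by (simp add: psi_cand_def FS_sh_D)

text \<open>The definition of the Lelong condition allows the constant to depend on \<psi>; here it
  depends only on a bound for \<phi>, as the passage to a supremum requires. With the slope lowered
  to t - \<epsilon>, the individual constant is absorbed on a small circle, and then \<epsilon>
  tends to 0.\<close>

lemma psi_cand_bound:
  assumes \<psi>: "psi_cand \<phi> t \<psi>" and B: "\<And>x. \<phi> x \<le> B" and z: "0 < cmod z" "cmod z \<le> 1"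
  shows "ereal (FS_potential z) + \<psi> (Some z) \<le> ereal (B + ln 2 + t * ln ((cmod z)\<^sup>2))"
proof -
  obtain C d where d: "0 < d" "d \<le> 1" "\<And>w. cmod w < d \<Longrightarrow> \<psi> (Some w) \<le> ereal t * ln_ext ((cmod w)\<^sup>2) + ereal C"
    using \<psi> lelong_geE unfolding psi_cand_def by metis
  define L where "L = ln ((cmod z)\<^sup>2)"
  have L0: "L \<le> 0" using z by (auto simp: L_def ln_realpow)
  have eps: "ereal (FS_potential z) + \<psi> (Some z) \<le> ereal (B + ln 2 + (t - \<epsilon>) * L)" if \<epsilon>: "0 < \<epsilon>" for \<epsilon>
  proof -
    \<comment> \<open>The last entry makes 2 \<epsilon> ln \<rho> at most -|C - B|, so that lowering
      the slope compensates for the constant C of this particular candidate.\<close>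
    define \<rho> where "\<rho> = Min {d / 2, cmod z, exp (- \<bar>C - B\<bar> / (2 * \<epsilon>))}"
    have \<rho>: "0 < \<rho>" "\<rho> < d" "\<rho> \<le> cmod z" "\<rho> \<le> exp (- \<bar>C - B\<bar> / (2 * \<epsilon>))"
      using d z by (auto simp: \<rho>_def min_def)
    have "ln \<rho> \<le> - \<bar>C - B\<bar> / (2 * \<epsilon>)" using \<rho> by (metis exp_gt_zero ln_exp ln_le_cancel_iff)
    then have lnr: "2 * \<epsilon> * ln \<rho> \<le> - \<bar>C - B\<bar>" using \<epsilon> pos_le_divide_eq[of "2 * \<epsilon>" "ln \<rho>" "- \<bar>C - B\<bar>"] by (simp only: mult_ac)
    show ?thesis unfolding L_def
    proof (rule annulus_bound[OF psi_cand_subharmonic[OF \<psi>, of Some] \<rho>(1) _ _ \<rho>(3) z(2)])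
      fix w :: complex assume "cmod w = \<rho> \<or> cmod w = 1"
      then show "ereal (FS_potential w) + \<psi> (Some w) \<le> ereal (B + ln 2 + (t - \<epsilon>) * ln ((cmod w)\<^sup>2))"
      proof
        assume w: "cmod w = \<rho>"
        have w0: "w \<noteq> 0" using w \<rho> by auto
        have "FS_potential w \<le> ln 2"
          by (rule FS_potential_le_ln_2) (use \<rho> d w in auto)
        moreover have "\<psi> (Some w) \<le> ereal (t * ln ((cmod w)\<^sup>2) + C)"
          using d(3)[of w] \<rho> w w0 by (simp add: ln_ext_def)
        ultimately have "ereal (FS_potential w) + \<psi> (Some w) \<le> ereal (ln 2) + ereal (t * ln ((cmod w)\<^sup>2) + C)"
          by (intro add_mono) auto
        also have "\<dots> \<le> ereal (B + ln 2 + (t - \<epsilon>) * ln ((cmod w)\<^sup>2))"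
        proof -
          have "2 * \<epsilon> * ln \<rho> \<le> B - C" using lnr by linarith
          then have "ln 2 + (t * (2 * ln \<rho>) + C) \<le> B + ln 2 + (t - \<epsilon>) * (2 * ln \<rho>)"
            by (simp add: algebra_simps)
          then show ?thesis unfolding ln_cmod_square[OF w0] by (simp add: w)
        qed
        finally show ?thesis .
      next
        assume w: "cmod w = 1"
        have "\<psi> (Some w) \<le> ereal B"
          using \<psi> B[of "Some w"] unfolding psi_cand_def by (metis ereal_less_eq(3) order_trans)
        then have "ereal (FS_potential w) + \<psi> (Some w) \<le> ereal (ln 2) + ereal B"
          by (intro add_mono) (auto simp: FS_potential_def w)
        then show ?thesis by (simp add: w add.commute)
      qed
    qed auto
  qed
  have "ereal (FS_potential z) + \<psi> (Some z) \<le> ereal (B + ln 2 + t * L)"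
  proof (rule ereal_le_epsilon2)
    fix e :: real assume e: "0 < e"
    \<comment> \<open>The denominator is 1 - L rather than -L because L may vanish.\<close>
    define \<epsilon> where "\<epsilon> = e / (1 - L)"
    have "0 < \<epsilon>" "\<epsilon> * (- L) \<le> e" using e L0 by (auto simp: \<epsilon>_def field_simps)
    then have "ereal (B + ln 2 + (t - \<epsilon>) * L) \<le> ereal (B + ln 2 + t * L) + ereal e" by (simp add: algebra_simps)
    with eps[OF \<open>0 < \<epsilon>\<close>] show "ereal (FS_potential z) + \<psi> (Some z) \<le> ereal (B + ln 2 + t * L) + ereal e"
      by (rule order_trans)
  qed
  then show ?thesis by (simp add: L_def)
qed

text \<open>Between the logarithmic growth of slope \<open>t\<close> at \<open>0\<close> and of slope \<open>1\<close> at infinity, a slope strictly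
  in between provides harmonic majorants with an arbitrarily small constant.\<close>

lemma psi_cand_gt_1:
  assumes \<phi>: "kaehler_potential \<phi>" and \<psi>: "psi_cand \<phi> t \<psi>" and t: "1 < t"
  shows "\<psi> x = -\<infinity>"
proof -
  obtain B where B: "0 \<le> B" "\<And>x. \<bar>\<phi> x\<bar> \<le> B" using kaehler_bounded[OF \<phi>] by blast
  have B': "\<phi> x \<le> B" for x using B(2)[of x] by linarith
  define h where "h = (t - 1) / 2"
  have h: "0 < h" "t = 1 + 2 * h" using t by (simp_all add: h_def field_simps)
  define C where "C = B + ln 2"
  have fin: "\<psi> (Some z) = -\<infinity>" if z: "z \<noteq> 0" for z
  proof -
    have A: "ereal (FS_potential z) + \<psi> (Some z) \<le> ereal (A + (1 + h) * ln ((cmod z)\<^sup>2))" for A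
    proof -
      \<comment> \<open>The slope 1 + h differs by h from both 1 and t. On the circles of radii exp
        (-M) and exp M this difference is worth 2 h M, enough to absorb A - C, and z lies in
        between.\<close>
      define M where "M = max (\<bar>A - C\<bar> / (2 * h)) \<bar>ln (cmod z)\<bar>"
      have M: "\<bar>A - C\<bar> \<le> 2 * h * M" "\<bar>ln (cmod z)\<bar> \<le> M" "0 \<le> M"
      proof -
        have "\<bar>A - C\<bar> / (2 * h) \<le> M" by (simp add: M_def)
        then show "\<bar>A - C\<bar> \<le> 2 * h * M" using h by (simp add: pos_divide_le_eq mult.commute mult.left_commute)
      qed (auto simp: M_def)
      have zz: "exp (- M) \<le> cmod z" "cmod z \<le> exp M"
      proof -
        have "exp (- M) \<le> exp (ln (cmod z))" "exp (ln (cmod z)) \<le> exp M"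
          using M(2) unfolding exp_le_cancel_iff abs_le_iff by linarith+
        then show "exp (- M) \<le> cmod z" "cmod z \<le> exp M" using z by simp_all
      qed
      show ?thesis
      proof (rule annulus_bound[OF psi_cand_subharmonic[OF \<psi>, of Some] _ _ _ zz])
        fix w :: complex assume "cmod w = exp (- M) \<or> cmod w = exp M"
        then show "ereal (FS_potential w) + \<psi> (Some w) \<le> ereal (A + (1 + h) * ln ((cmod w)\<^sup>2))"
        proof
          assume w: "cmod w = exp (- M)"
          have w0: "w \<noteq> 0" using w by auto
          have lw: "ln ((cmod w)\<^sup>2) = - 2 * M" unfolding ln_cmod_square[OF w0] by (simp add: w)
          have "ereal (FS_potential w) + \<psi> (Some w) \<le> ereal (B + ln 2 + t * ln ((cmod w)\<^sup>2))"
            by (rule psi_cand_bound[OF \<psi> B']) (use w M in auto)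
          also have "\<dots> \<le> ereal (A + (1 + h) * ln ((cmod w)\<^sup>2))"
            unfolding lw h(2) using M(1) by (auto simp: C_def algebra_simps abs_le_iff)
          finally show ?thesis .
        next
          assume w: "cmod w = exp M"
          have w0: "w \<noteq> 0" using w by auto
          have lw: "ln ((cmod w)\<^sup>2) = 2 * M" unfolding ln_cmod_square[OF w0] by (simp add: w)
          have "1 + (cmod w)\<^sup>2 \<le> 2 * (cmod w)\<^sup>2" using w M(3) by (simp add: one_le_power)
          then have "FS_potential w \<le> ln (2 * (cmod w)\<^sup>2)"
            unfolding FS_potential_def by (subst ln_le_cancel_iff) (auto intro: add_pos_nonneg simp: w0)
          also have "\<dots> = ln 2 + 2 * M" using w0 lw by (simp add: ln_mult)
          finally have "FS_potential w \<le> ln 2 + 2 * M" .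
          moreover have "\<psi> (Some w) \<le> ereal B"
            using \<psi> B'[of "Some w"] unfolding psi_cand_def by (metis ereal_less_eq(3) order_trans)
          ultimately have "ereal (FS_potential w) + \<psi> (Some w) \<le> ereal (ln 2 + 2 * M) + ereal B"
            by (intro add_mono) auto
          also have "\<dots> \<le> ereal (A + (1 + h) * ln ((cmod w)\<^sup>2))"
            unfolding lw using M(1) by (auto simp: C_def algebra_simps abs_le_iff)
          finally show ?thesis .
        qed
      qed auto
    qed
    show ?thesis
    proof (rule ereal_bot)
      fix M show "\<psi> (Some z) \<le> ereal M"
        using A[of "FS_potential z + M - (1 + h) * ln ((cmod z)\<^sup>2)"] by (cases "\<psi> (Some z)") auto
    qed
  qed
  show ?thesis
  proof (cases x)
    case (Some z)
    then show ?thesis using fin psi_cand_at_0[OF \<psi>] t by (cases "z = 0") auto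
  next
    case None
    \<comment> \<open>The point at infinity is the centre of a circle on which \<psi> is already
      known to be -\<infinity>, so every constant is a majorant.\<close>
    have le: "ereal (FS_potential 0) + \<psi> (chart_infinity 0) \<le> ereal (Re (of_real N))" for N
    proof (rule subharmonic_onD[OF psi_cand_subharmonic[OF \<psi>], of chart_infinity 1 _ "\<lambda>z. of_real N"])
      fix w :: complex assume "w \<in> sphere 0 1"
      then have "w \<noteq> 0" by auto
      then show "ereal (FS_potential w) + \<psi> (chart_infinity w) \<le> ereal (Re (of_real N))" using fin by simp
    qed auto
    have "\<psi> None \<le> ereal M" for M using le[of "FS_potential 0 + M"] by (cases "\<psi> None") auto
    then show ?thesis unfolding None by (rule ereal_bot)
  qed
qed

lemma psi_env_gt_1: "kaehler_potential \<phi> \<Longrightarrow> 1 < t \<Longrightarrow> psi_env \<phi> t z = -\<infinity>"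
  using psi_env_leI[of \<phi> t z "-\<infinity>"] psi_cand_gt_1 by force

text \<open>The competitor is ln (|z|^2 / (1 + |z|^2)) - B, for which the curvature form is the
  point mass at 0. Added to the local potential it becomes ln |z|^2 - B in one chart and the
  constant -B in the other.\<close>

lemma psi_env_1_finite:
  assumes \<phi>: "kaehler_potential \<phi>" and x: "x \<noteq> Some 0"
  shows "psi_env \<phi> 1 x \<noteq> -\<infinity>"
proof -
  obtain B where B: "0 \<le> B" "\<And>x. \<bar>\<phi> x\<bar> \<le> B" using kaehler_bounded[OF \<phi>] by blast
  define \<psi> where "\<psi> y = (case y of None \<Rightarrow> ereal (- B) | Some z \<Rightarrow> ln_ext ((cmod z)\<^sup>2) + ereal (- FS_potential z - B))" for y
  have S: "ereal (FS_potential z) + \<psi> (Some z) = ln_ext ((cmod z)\<^sup>2) + ereal (- B)" for z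
    by (auto simp: \<psi>_def ln_ext_def)
  have I: "ereal (FS_potential w) + \<psi> (chart_infinity w) = ereal (- B)" for w
  proof (cases "w = 0")
    case True
    then show ?thesis by (simp add: \<psi>_def FS_potential_def)
  next
    case False
    have "1 + 1 / (cmod w)\<^sup>2 = (1 + (cmod w)\<^sup>2) / (cmod w)\<^sup>2" using False by (simp add: field_simps)
    moreover have "1 + (cmod w)\<^sup>2 \<noteq> 0" "(cmod w)\<^sup>2 \<noteq> 0"
      using False by (auto simp: add_nonneg_eq_0_iff)
    ultimately have "ln (1 + 1 / (cmod w)\<^sup>2) = ln (1 + (cmod w)\<^sup>2) - ln ((cmod w)\<^sup>2)"
      by (simp only: ln_div simp_thms if_True)
    then have "FS_potential (1 / w) = FS_potential w - ln ((cmod w)\<^sup>2)"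
      by (simp only: FS_potential_def norm_divide norm_one power_divide one_power2)
    moreover have "ln_ext ((cmod (1 / w))\<^sup>2) = ereal (- ln ((cmod w)\<^sup>2))"
      using False by (simp add: ln_ext_def norm_divide power_divide ln_div)
    ultimately show ?thesis using False by (simp add: \<psi>_def)
  qed
  have "subharmonic_on UNIV (\<lambda>z. ereal (FS_potential z) + \<psi> (\<kappa> z))" if "\<kappa> \<in> P1_charts" for \<kappa>
    using that
  proof (cases rule: P1_charts_cases)
    case 1
    show ?thesis unfolding 1 S
      using subharmonic_on_add[OF subharmonic_on_ln_norm[of "\<lambda>z. z" UNIV] subharmonic_on_const[of UNIV "- B"]] by simp
  next
    case 2
    show ?thesis unfolding 2 I by (rule subharmonic_on_const)
  qed
  then have "FS_sh \<psi>" by (simp add: FS_sh_def)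
  moreover have "\<psi> y \<le> ereal (\<phi> y)" for y
  proof -
    have "\<psi> y \<le> ereal (- B)"
    proof (cases y)
      case (Some z)
      have "z \<noteq> 0 \<Longrightarrow> ln ((cmod z)\<^sup>2) \<le> FS_potential z" unfolding FS_potential_def by (subst ln_le_cancel_iff) (auto intro: add_pos_nonneg)
      then show ?thesis by (auto simp: \<psi>_def Some ln_ext_def)
    qed (simp add: \<psi>_def)
    also have "\<dots> \<le> ereal (\<phi> y)" using B(2)[of y] by simp
    finally show ?thesis .
  qed
  moreover have "- FS_potential z \<le> B" for z using B(1) FS_potential_nonneg[of z] by linarith
  then have "lelong_ge \<psi> 1"
    by (intro lelong_geI[of _ _ 0]) (use B in \<open>auto simp: \<psi>_def ln_ext_def one_ereal_def[symmetric]\<close>)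
  ultimately have "psi_cand \<phi> 1 \<psi>" by (rule psi_candI)
  moreover have "\<psi> x \<noteq> -\<infinity>" using x by (cases x) (auto simp: \<psi>_def ln_ext_def)
  ultimately show ?thesis using psi_cand_le_env[of \<phi> 1 \<psi> x] by auto
qed

section \<open>Concavity and left continuity in t\<close>

lemma psi_cand_convex:
  assumes \<psi>: "psi_cand \<phi> s \<psi>\<^sub>1" "psi_cand \<phi> t \<psi>\<^sub>2" and s: "0 \<le> s" and t: "0 \<le> t"
    and u: "0 < u" and v: "0 < v" and uv: "u + v = 1"
  shows "psi_cand \<phi> (u * s + v * t) (\<lambda>x. ereal u * \<psi>\<^sub>1 x + ereal v * \<psi>\<^sub>2 x)"
proof (rule psi_candI)
  show "FS_sh (\<lambda>x. ereal u * \<psi>\<^sub>1 x + ereal v * \<psi>\<^sub>2 x)"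
    unfolding FS_sh_def
  proof
    fix \<kappa> assume \<kappa>: "\<kappa> \<in> P1_charts"
    have "subharmonic_on UNIV (\<lambda>z. ereal u * (ereal (FS_potential z) + \<psi>\<^sub>1 (\<kappa> z)) + ereal v * (ereal (FS_potential z) + \<psi>\<^sub>2 (\<kappa> z)))"
      by (intro subharmonic_on_add subharmonic_on_cmult less_imp_le[OF u] less_imp_le[OF v] psi_cand_subharmonic[OF \<psi>(1) \<kappa>] psi_cand_subharmonic[OF \<psi>(2) \<kappa>])
    moreover have "ereal u * (ereal a + x) + ereal v * (ereal a + y) = ereal a + (ereal u * x + ereal v * y)"
      if "x \<noteq> \<infinity>" "y \<noteq> \<infinity>" for a x y
    proof -
      have "u * a + v * a = a" using uv by (metis distrib_right mult_1)
      then show ?thesis using that u v by (cases x; cases y) (auto simp: algebra_simps)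
    qed
    moreover have "\<psi>\<^sub>1 x \<noteq> \<infinity>" "\<psi>\<^sub>2 x \<noteq> \<infinity>" for x using \<psi> unfolding psi_cand_def usc_on_def by auto
    ultimately show "subharmonic_on UNIV (\<lambda>z. ereal (FS_potential z) + (ereal u * \<psi>\<^sub>1 (\<kappa> z) + ereal v * \<psi>\<^sub>2 (\<kappa> z)))"
      by simp
  qed
  fix x
  have "ereal u * \<psi>\<^sub>1 x + ereal v * \<psi>\<^sub>2 x \<le> ereal u * ereal (\<phi> x) + ereal v * ereal (\<phi> x)"
    using \<psi> u v unfolding psi_cand_def by (intro add_mono ereal_mult_left_mono) auto
  also have "\<dots> = ereal (\<phi> x)" using uv by (simp flip: distrib_right)
  finally show "ereal u * \<psi>\<^sub>1 x + ereal v * \<psi>\<^sub>2 x \<le> ereal (\<phi> x)" .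
next
  obtain C d where d: "0 < d" "\<And>z. cmod z < d \<Longrightarrow> \<psi>\<^sub>1 (Some z) \<le> ereal s * ln_ext ((cmod z)\<^sup>2) + ereal C"
    using \<psi>(1) lelong_geE unfolding psi_cand_def by metis
  obtain C' d' where d': "0 < d'" "\<And>z. cmod z < d' \<Longrightarrow> \<psi>\<^sub>2 (Some z) \<le> ereal t * ln_ext ((cmod z)\<^sup>2) + ereal C'"
    using \<psi>(2) lelong_geE unfolding psi_cand_def by metis
  have "ereal u * \<psi>\<^sub>1 (Some z) + ereal v * \<psi>\<^sub>2 (Some z)
      \<le> ereal (u * s + v * t) * ln_ext ((cmod z)\<^sup>2) + ereal (u * C + v * C')" if z: "cmod z < min d d'" for z
  proof -
    have "ereal u * \<psi>\<^sub>1 (Some z) + ereal v * \<psi>\<^sub>2 (Some z) \<le>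
        ereal u * (ereal s * ln_ext ((cmod z)\<^sup>2) + ereal C) + ereal v * (ereal t * ln_ext ((cmod z)\<^sup>2) + ereal C')"
      using d(2)[of z] d'(2)[of z] z u v by (intro add_mono ereal_mult_left_mono) auto
    also have "\<dots> = ereal (u * s + v * t) * ln_ext ((cmod z)\<^sup>2) + ereal (u * C + v * C')"
    \<comment> \<open>At the origin the products are 0 or -\<infinity>, since \<open>s\<close> and
      \<open>t\<close> are nonnegative; orders of opposite sign would mix both infinities.\<close>
    proof (cases "z = 0")
      case True
      show ?thesis
      proof (cases "s = 0 \<and> t = 0")
        case False
        then have "0 < u * s + v * t" using u v s t
          by (metis add_nonneg_pos add_pos_nonneg mult_pos_pos mult_nonneg_nonneg order_le_less)
        then have "(u * s + v * t) \<noteq> 0" "ereal (u * s + v * t) * ln_ext ((cmod z)\<^sup>2) = -\<infinity>"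
          using True by (simp_all add: ln_ext_def)
        moreover have "ereal u * (ereal s * ln_ext ((cmod z)\<^sup>2) + ereal C) = (if s = 0 then ereal (u * C) else -\<infinity>)"
          using True u s by (simp add: ln_ext_def zero_ereal_def[symmetric])
        moreover have "ereal v * (ereal t * ln_ext ((cmod z)\<^sup>2) + ereal C') = (if t = 0 then ereal (v * C') else -\<infinity>)"
          using True v t by (simp add: ln_ext_def zero_ereal_def[symmetric])
        ultimately show ?thesis using False by (simp split: if_splits)
      qed (use True in \<open>auto simp: zero_ereal_def[symmetric]\<close>)
    next
      case False
      then show ?thesis by (simp add: ln_ext_def algebra_simps)
    qed
    finally show ?thesis .
  qed
  then show "lelong_ge (\<lambda>x. ereal u * \<psi>\<^sub>1 x + ereal v * \<psi>\<^sub>2 x) (u * s + v * t)"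
    unfolding lelong_ge_def eventually_nhds_metric using d(1) d'(1)
    by (intro exI[of _ "u * C + v * C'"] exI[of _ "min d d'"]) auto
qed

text \<open>Convex combinations of nearly optimal candidates compete for the intermediate parameter.
  Finiteness on [0,1] follows from monotonicity in t and the explicit competitor at t = 1, so
  supporting lines of a real function become available.\<close>

lemma psi_env_concave:
  assumes \<phi>: "kaehler_potential \<phi>" and x: "x \<noteq> Some 0"
  obtains G where "\<And>t. 0 \<le> t \<Longrightarrow> t \<le> 1 \<Longrightarrow> psi_env \<phi> t x = ereal (G t)" "convex_on {0..1} (\<lambda>t. - G t)"
proof -
  have fin: "\<bar>psi_env \<phi> t x\<bar> \<noteq> \<infinity>" if "t \<le> 1" for t
    using psi_env_le[of \<phi> t x] psi_env_antimono[OF that, of \<phi> x] psi_env_1_finite[OF \<phi> x] by auto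
  define G where "G t = real_of_ereal (psi_env \<phi> t x)" for t
  have G: "psi_env \<phi> t x = ereal (G t)" if "t \<le> 1" for t
    using fin[OF that] by (simp add: G_def ereal_real)
  have "convex_on {0..1} (\<lambda>t. - G t)"
  proof (rule convex_onI)
    fix u s t :: real assume u: "0 < u" "u < 1" and s: "s \<in> {0..1}" and t: "t \<in> {0..1}"
    let ?r = "(1 - u) *\<^sub>R s + u *\<^sub>R t"
    have "?r \<le> (1 - u) * 1 + u * 1" using u s t by (intro add_mono) auto
    then have r: "?r \<le> 1" by simp
    have "(1 - u) * G s + u * G t \<le> G ?r + e" if e: "0 < e" for e
    proof -
      have "ereal (G s - e) < psi_env \<phi> s x" "ereal (G t - e) < psi_env \<phi> t x" using G s t e by auto
      then obtain \<psi>\<^sub>1 \<psi>\<^sub>2 where \<psi>: "psi_cand \<phi> s \<psi>\<^sub>1" "ereal (G s - e) < \<psi>\<^sub>1 x" "psi_cand \<phi> t \<psi>\<^sub>2" "ereal (G t - e) < \<psi>\<^sub>2 x"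
        unfolding psi_env_eq less_SUP_iff by auto
      have "ereal (1 - u) * ereal (G s - e) + ereal u * ereal (G t - e) \<le> ereal (1 - u) * \<psi>\<^sub>1 x + ereal u * \<psi>\<^sub>2 x"
        using \<psi> u by (intro add_mono ereal_mult_left_mono) auto
      also have "\<dots> \<le> psi_env \<phi> ((1 - u) * s + u * t) x"
        by (rule psi_cand_le_env[OF psi_cand_convex[OF \<psi>(1,3)]]) (use u s t in auto)
      also have "\<dots> = ereal (G ?r)" using G[OF r] by simp
      finally show ?thesis by (simp add: algebra_simps)
    qed
    then have "(1 - u) * G s + u * G t \<le> G ?r" by (rule field_le_epsilon)
    then show "- G ?r \<le> (1 - u) * - G s + u * - G t" by simp
  qed simp
  with G show thesis using that by auto
qed

lemma openin_P1_chart_image: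
  assumes "\<kappa> \<in> P1_charts" "open S"
  shows "openin P1_top (\<kappa> ` S)"
  unfolding openin_P1_top_iff
proof
  fix \<kappa>' assume "\<kappa>' \<in> P1_charts"
  have *: "Some -` (chart_infinity ` S) = {z. z \<noteq> 0 \<and> 1 / z \<in> S}"
    "chart_infinity -` (Some ` S) = {z. z \<noteq> 0 \<and> 1 / z \<in> S}" "chart_infinity -` (chart_infinity ` S) = S"
  proof -
    show "Some -` (chart_infinity ` S) = {z. z \<noteq> 0 \<and> 1 / z \<in> S}"
    proof (intro set_eqI iffI)
      fix z assume "z \<in> Some -` (chart_infinity ` S)"
      then obtain w where "Some z = chart_infinity w" "w \<in> S" by auto
      then show "z \<in> {z. z \<noteq> 0 \<and> 1 / z \<in> S}" by (auto simp: chart_infinity_def split: if_splits)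
    next
      fix z assume "z \<in> {z. z \<noteq> 0 \<and> 1 / z \<in> S}"
      then show "z \<in> Some -` (chart_infinity ` S)" by (auto intro!: image_eqI[of _ _ "1 / z"])
    qed
    show "chart_infinity -` (Some ` S) = {z. z \<noteq> 0 \<and> 1 / z \<in> S}"
      by (auto simp: chart_infinity_def split: if_splits)
    show "chart_infinity -` (chart_infinity ` S) = S"
      by (auto simp: chart_infinity_def split: if_splits)
  qed
  then show "open (\<kappa>' -` \<kappa> ` S)"
    using assms \<open>\<kappa>' \<in> P1_charts\<close> open_inverse_vimage[OF assms(2)]
    by (auto elim!: P1_charts_cases simp: inj_vimage_image_eq)
qed

text \<open>The candidate is the upper semicontinuous regularisation of the envelopes for \<open>t < 1\<close>, with the
  limit \<open>t \<rightarrow> 1\<close> taken at the same time; the constant in the logarithmic bound at \<open>0\<close> is uniform in \<open>t\<close>.\<close>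

lemma psi_env_left_limit:
  assumes \<phi>: "kaehler_potential \<phi>" and c: "psi_env \<phi> 1 x < c"
  obtains t where "0 < t" "t < 1" "psi_env \<phi> t x < c"
proof -
  obtain B where B: "0 \<le> B" "\<And>x. \<bar>\<phi> x\<bar> \<le> B" using kaehler_bounded[OF \<phi>] by blast
  have B': "\<phi> x \<le> B" for x using B(2)[of x] by linarith
  define I where "I x = {(V, t::real). openin P1_top V \<and> x \<in> V \<and> 0 < t \<and> t < 1}" for x
  define h where "h x = (INF (V, t)\<in>I x. SUP y\<in>V. psi_env \<phi> t y)" for x
  have hI: "h x \<le> c" if "openin P1_top V" "x \<in> V" "0 < t" "t < 1" "\<And>y. y \<in> V \<Longrightarrow> psi_env \<phi> t y \<le> c" for V x t c
    unfolding h_def by (rule INF_lower2[of "(V, t)"]) (use that in \<open>auto simp: I_def intro: SUP_least\<close>)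
  have hE: "\<exists>V t. openin P1_top V \<and> x \<in> V \<and> 0 < t \<and> t < 1 \<and> (SUP y\<in>V. psi_env \<phi> t y) < c" if "h x < c" for x c
    using that unfolding h_def INF_less_iff I_def by auto
  have h\<phi>: "h x \<le> ereal (\<phi> x)" for x
  proof (rule ereal_le_epsilon2)
    fix e :: real assume e: "0 < e"
    let ?V = "{y \<in> topspace P1_top. ereal (\<phi> y) < ereal (\<phi> x + e)}"
    have "openin P1_top ?V" using kaehler_usc[OF \<phi>] unfolding usc_on_def by blast
    then show "h x \<le> ereal (\<phi> x) + ereal e"
      by (rule hI[of ?V x "1/2"]) (use e in \<open>auto intro: order_trans[OF psi_env_le]\<close>)
  qed
  have husc: "usc_on P1_top h"
    unfolding usc_on_def
  proof (intro conjI allI ballI)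
    fix c show "openin P1_top {x \<in> topspace P1_top. h x < c}"
    proof (subst openin_subopen, safe)
      fix x assume "h x < c"
      then obtain V t where V: "openin P1_top V" "x \<in> V" "0 < t" "t < 1" "(SUP y\<in>V. psi_env \<phi> t y) < c"
        using hE by blast
      have "h y < c" if "y \<in> V" for y
        by (rule le_less_trans[OF hI[OF V(1) that V(3,4)] V(5)]) (rule SUP_upper)
      then show "\<exists>T. openin P1_top T \<and> x \<in> T \<and> T \<subseteq> {x \<in> topspace P1_top. h x < c}" using V by auto
    qed
  next
    fix x show "h x \<noteq> \<infinity>" using h\<phi>[of x] by auto
  qed
  have "FS_sh h" unfolding FS_sh_def
  proof
    fix \<kappa> assume \<kappa>: "\<kappa> \<in> P1_charts"
    show "subharmonic_on UNIV (\<lambda>z. ereal (FS_potential z) + h (\<kappa> z))"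
    proof (rule subharmonic_onI)
      show "usc_on (top_of_set UNIV) (\<lambda>z. ereal (FS_potential z) + h (\<kappa> z))"
        using husc \<kappa> unfolding usc_on_FS_add_iff usc_on_P1_iff by blast
      fix a r p assume r: "0 < r" and p: "p holomorphic_on UNIV"
        and less: "\<And>z. z \<in> sphere a r \<Longrightarrow> ereal (FS_potential z) + h (\<kappa> z) < ereal (Re (p z))"
      have contp: "continuous_on UNIV (\<lambda>z. Re (p z))"
        using holomorphic_on_imp_continuous_on[OF p] by (rule continuous_on_Re)
      \<comment> \<open>The points w and \<zeta> vary independently, so the local bound can later be
        applied on a translated circle while the majorant is still evaluated on the original
        one.\<close>
      have "\<exists>d t. 0 < d \<and> 0 < t \<and> t < 1 \<and> (\<forall>w\<in>ball z (2 * d). \<forall>\<zeta>\<in>ball z (2 * d).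
          ereal (FS_potential w) + psi_env \<phi> t (\<kappa> w) \<le> ereal (Re (p \<zeta>)))" if z: "z \<in> sphere a r" for z
      proof -
        have "h (\<kappa> z) < ereal (Re (p z) - FS_potential z)"
          using less[OF z] by (simp add: ereal_shift add.commute)
        then obtain m where m: "h (\<kappa> z) < ereal m" "m < Re (p z) - FS_potential z"
          using ereal_dense2 by force
        then obtain V t where V: "openin P1_top V" "\<kappa> z \<in> V" "0 < t" "t < 1" "(SUP y\<in>V. psi_env \<phi> t y) < ereal m"
          using hE by blast
        define e where "e = (Re (p z) - FS_potential z - m) / 2"
        have e: "0 < e" using m by (simp add: e_def)
        have "open (\<kappa> -` V)" using V(1) \<kappa> unfolding openin_P1_top_iff by blast
        then obtain d1 where d1: "0 < d1" "ball z d1 \<subseteq> \<kappa> -` V" using V(2) openE by (metis vimageI)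
        obtain d2 where d2: "0 < d2" "\<And>w. dist w z < d2 \<Longrightarrow> dist (FS_potential w) (FS_potential z) < e"
          using continuous_on_FS_potential[of UNIV] e unfolding continuous_on_iff by (metis UNIV_I)
        obtain d3 where d3: "0 < d3" "\<And>w. dist w z < d3 \<Longrightarrow> dist (Re (p w)) (Re (p z)) < e"
          using contp e unfolding continuous_on_iff by (metis UNIV_I)
        define d where "d = min d1 (min d2 d3) / 2"
        have "ereal (FS_potential w) + psi_env \<phi> t (\<kappa> w) \<le> ereal (Re (p \<zeta>))"
          if w: "w \<in> ball z (2 * d)" and \<zeta>: "\<zeta> \<in> ball z (2 * d)" for w \<zeta>
        proof -
          have "\<kappa> w \<in> V" using w d1 by (auto simp: d_def)
          then have "psi_env \<phi> t (\<kappa> w) \<le> ereal m" using V(5) by (meson SUP_upper less_imp_le order_trans)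
          moreover have "FS_potential w < FS_potential z + e" "Re (p z) - e < Re (p \<zeta>)"
            using d2(2)[of w] d3(2)[of \<zeta>] w \<zeta> by (auto simp: d_def dist_commute dist_real_def abs_less_iff)
          ultimately have "ereal (FS_potential w) + psi_env \<phi> t (\<kappa> w) \<le> ereal (FS_potential z + e) + ereal m"
            by (intro add_mono) auto
          also have "\<dots> \<le> ereal (Re (p \<zeta>))" using \<open>Re (p z) - e < Re (p \<zeta>)\<close> by (simp add: e_def field_simps)
          finally show ?thesis .
        qed
        then show ?thesis using d1(1) d2(1) d3(1) V(3,4) by (intro exI[of _ d] exI[of _ t]) (auto simp: d_def)
      qed
      then obtain d t where dt: "\<And>z. z \<in> sphere a r \<Longrightarrow> 0 < d z \<and> 0 < t z \<and> t z < 1 \<and>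
          (\<forall>w\<in>ball z (2 * d z). \<forall>\<zeta>\<in>ball z (2 * d z). ereal (FS_potential w) + psi_env \<phi> (t z) (\<kappa> w) \<le> ereal (Re (p \<zeta>)))"
        by metis
      have "sphere a r \<subseteq> (\<Union>z\<in>sphere a r. ball z (d z))"
      proof
        fix z assume "z \<in> sphere a r"
        moreover have "z \<in> ball z (d z)" using dt[OF \<open>z \<in> sphere a r\<close>] by simp
        ultimately show "z \<in> (\<Union>z\<in>sphere a r. ball z (d z))" by blast
      qed
      then obtain Z where Z: "Z \<subseteq> sphere a r" "finite Z" "sphere a r \<subseteq> (\<Union>z\<in>Z. ball z (d z))"
        using compactE_image[OF compact_sphere[of a r], of "sphere a r" "\<lambda>z. ball z (d z)"] by blast
      have "Z \<noteq> {}" using Z(3) r by auto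
      \<comment> \<open>Envelopes decrease in t, so the finitely many local bounds all hold at the
        largest parameter, which is still below 1.\<close>
      define T where "T = Max (t ` Z)"
      define \<delta> where "\<delta> = Min (d ` Z)"
      have dtZ: "0 < d z" "0 < t z" "t z < 1" if "z \<in> Z" for z using dt[of z] that Z(1) by blast+
      have T: "0 < T" "T < 1" "\<And>z. z \<in> Z \<Longrightarrow> t z \<le> T"
      proof -
        have "T \<in> t ` Z" unfolding T_def using Z(2) \<open>Z \<noteq> {}\<close> by (intro Max_in) auto
        then show "0 < T" "T < 1" using dtZ by blast+
        show "t z \<le> T" if "z \<in> Z" for z unfolding T_def using Z(2) that by (intro Max_ge) auto
      qed
      have \<delta>: "0 < \<delta>" "\<And>z. z \<in> Z \<Longrightarrow> \<delta> \<le> d z"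
      proof -
        have "\<delta> \<in> d ` Z" unfolding \<delta>_def using Z(2) \<open>Z \<noteq> {}\<close> by (intro Min_in) auto
        then show "0 < \<delta>" using dtZ by blast
        show "\<delta> \<le> d z" if "z \<in> Z" for z unfolding \<delta>_def using Z(2) that by (intro Min_le) auto
      qed
      \<comment> \<open>Bounding the regularised function at \<open>a\<close> needs a bound on
        envelopes in a whole neighbourhood of \<open>a\<close>. It comes from circles around a + v
        with the translated majorant p (z - v).\<close>
      have shift: "ereal (FS_potential (a + v)) + psi_env \<phi> T (\<kappa> (a + v)) \<le> ereal (Re (p a))" if v: "cmod v < \<delta>" for v
      proof -
        have "psi_env \<phi> T (\<kappa> (a + v)) \<le> ereal (Re (p a) - FS_potential (a + v))"
        proof (rule psi_env_leI)
          fix \<psi> assume \<psi>: "psi_cand \<phi> T \<psi>"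
          have "ereal (FS_potential (a + v)) + \<psi> (\<kappa> (a + v)) \<le> ereal (Re (p (a + v - v)))"
          proof (rule subharmonic_onD[OF psi_cand_subharmonic[OF \<psi> \<kappa>] r])
            have "(\<lambda>z. z - v) holomorphic_on UNIV" by (intro holomorphic_intros)
            from holomorphic_on_compose_gen[OF this p] show "(\<lambda>z. p (z - v)) holomorphic_on UNIV" by (simp add: o_def)
            fix w assume "w \<in> sphere (a + v) r"
            then have w: "w - v \<in> sphere a r" by (simp add: dist_norm algebra_simps)
            then obtain z where z: "z \<in> Z" "w - v \<in> ball z (d z)" using Z(3) by auto
            have zs: "z \<in> sphere a r" using Z(1) z(1) by blast
            have "dist z w \<le> dist z (w - v) + dist (w - v) w" by (rule dist_triangle)
            also have "dist (w - v) w = cmod v" by (simp add: dist_norm)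
            also have "dist z (w - v) + cmod v < 2 * d z" using z v \<delta>(2)[OF z(1)] by simp
            finally have "w \<in> ball z (2 * d z)" by simp
            moreover have "w - v \<in> ball z (2 * d z)" using z(2) dtZ(1)[OF z(1)] by simp
            ultimately have "ereal (FS_potential w) + psi_env \<phi> (t z) (\<kappa> w) \<le> ereal (Re (p (w - v)))"
              using dt[OF zs] by blast
            moreover have "\<psi> (\<kappa> w) \<le> psi_env \<phi> (t z) (\<kappa> w)"
              using psi_cand_le_env[OF \<psi>] psi_env_antimono[OF T(3)[OF z(1)]] by (rule order_trans)
            ultimately show "ereal (FS_potential w) + \<psi> (\<kappa> w) \<le> ereal (Re (p (w - v)))"
              by (meson add_left_mono order_trans)
          qed auto
          then show "\<psi> (\<kappa> (a + v)) \<le> ereal (Re (p a) - FS_potential (a + v))"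
            by (simp add: ereal_shift add.commute)
        qed
        then show ?thesis by (simp add: ereal_shift add.commute)
      qed
      have "h (\<kappa> a) \<le> ereal (Re (p a) - FS_potential a)"
      proof (rule ereal_le_epsilon2)
        fix e :: real assume e: "0 < e"
        obtain d2 where d2: "0 < d2" "\<And>w. dist w a < d2 \<Longrightarrow> dist (FS_potential w) (FS_potential a) < e"
          using continuous_on_FS_potential[of UNIV] e unfolding continuous_on_iff by (metis UNIV_I)
        let ?V = "\<kappa> ` ball a (min \<delta> d2)"
        have "h (\<kappa> a) \<le> ereal (Re (p a) - FS_potential a + e)"
        proof (rule hI[of ?V _ T])
          show "openin P1_top ?V" by (rule openin_P1_chart_image[OF \<kappa>]) simp
          show "\<kappa> a \<in> ?V" using \<delta> d2 by auto
          fix y assume "y \<in> ?V"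
          then obtain w where w: "y = \<kappa> w" "dist a w < \<delta>" "dist a w < d2" by auto
          have "ereal (FS_potential w) + psi_env \<phi> T (\<kappa> w) \<le> ereal (Re (p a))"
            using shift[of "w - a"] w(2) by (simp add: dist_norm norm_minus_commute)
          then have "psi_env \<phi> T y \<le> ereal (Re (p a) - FS_potential w)"
            by (simp add: w(1) ereal_shift add.commute)
          also have "\<dots> \<le> ereal (Re (p a) - FS_potential a + e)"
            using d2(2)[of w] w(3) by (simp add: dist_commute dist_real_def abs_less_iff)
          finally show "psi_env \<phi> T y \<le> ereal (Re (p a) - FS_potential a + e)" .
        qed (use T in auto)
        then show "h (\<kappa> a) \<le> ereal (Re (p a) - FS_potential a) + ereal e" by simp
      qed
      then show "ereal (FS_potential a) + h (\<kappa> a) \<le> ereal (Re (p a))"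
        by (simp add: ereal_shift add.commute)
    qed
  qed
  moreover have "lelong_ge h 1"
  proof (rule lelong_geI[of _ _ "B + ln 2"])
    fix z :: complex assume z: "cmod z < 1"
    have bound: "psi_env \<phi> t (Some w) \<le> ereal (B + ln 2 + t * ln ((cmod w)\<^sup>2))" if "w \<noteq> 0" "cmod w < 1" for w t
    proof (rule psi_env_leI)
      fix \<psi> assume \<psi>: "psi_cand \<phi> t \<psi>"
      have "\<psi> (Some w) \<le> ereal (FS_potential w) + \<psi> (Some w)"
        using FS_potential_nonneg[of w] by (cases "\<psi> (Some w)") auto
      also have "\<dots> \<le> ereal (B + ln 2 + t * ln ((cmod w)\<^sup>2))"
        by (rule psi_cand_bound[OF \<psi> B']) (use that in auto)
      finally show "\<psi> (Some w) \<le> ereal (B + ln 2 + t * ln ((cmod w)\<^sup>2))" .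
    qed
    show "h (Some z) \<le> ereal 1 * ln_ext ((cmod z)\<^sup>2) + ereal (B + ln 2)"
    proof (cases "z = 0")
      case False
      define L where "L = ln ((cmod z)\<^sup>2)"
      have L: "L \<le> 0" using ln_cmod_square_neg[OF z] by (simp add: L_def)
      have "h (Some z) \<le> ereal (L + (B + ln 2))"
      proof (rule ereal_le_epsilon2)
        fix e :: real assume e: "0 < e"
        \<comment> \<open>Close enough to 1 that (1 - t) (-L) is at most e/2; the maximum with 1/2
          keeps t positive.\<close>
        define t where "t = max (1/2) (1 - e / (2 * (1 - L)))"
        have "0 < e / (2 * (1 - L))" using e L by (intro divide_pos_pos) auto
        then have t: "0 < t" "t < 1" by (auto simp: t_def)
        have "1 - t \<le> e / (2 * (1 - L))" by (auto simp: t_def)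
        then have "(1 - t) * (- L) \<le> e / (2 * (1 - L)) * (- L)" using L by (intro mult_right_mono) auto
        also have "\<dots> \<le> e / 2" using e L by (simp add: field_simps)
        finally have tL: "t * L \<le> L + e / 2" by (simp add: algebra_simps)
        \<comment> \<open>The factor exp (e/4) raises ln |w|^2 by at most e/2, which is the other
          half of the error.\<close>
        let ?S = "{w. w \<noteq> 0 \<and> cmod w < 1 \<and> cmod w < cmod z * exp (e / 4)}"
        have "h (Some z) \<le> ereal (L + (B + ln 2) + e)"
        proof (rule hI[of "Some ` ?S" _ t])
          have "?S = ball 0 1 \<inter> ball 0 (cmod z * exp (e / 4)) - {0}" by auto
          then have "open ?S" by (metis open_Diff open_Int open_ball closed_singleton)
          then show "openin P1_top (Some ` ?S)" by (intro openin_P1_chart_image) auto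
          show "Some z \<in> Some ` ?S" using z False e by auto
          fix y assume "y \<in> Some ` ?S"
          then obtain w where w: "y = Some w" "w \<noteq> 0" "cmod w < 1" "cmod w < cmod z * exp (e / 4)" by auto
          have "ln (cmod w) < ln (cmod z * exp (e / 4))" using w False by (subst ln_less_cancel_iff) auto
          also have "\<dots> = ln (cmod z) + e / 4" using False by (simp add: ln_mult)
          finally have "ln ((cmod w)\<^sup>2) \<le> L + e / 2" unfolding L_def ln_cmod_square[OF w(2)] ln_cmod_square[OF False] by simp
          then have "t * ln ((cmod w)\<^sup>2) \<le> t * (L + e / 2)" using t by (intro mult_left_mono) auto
          also have "\<dots> \<le> t * L + e / 2" using t e by (simp add: distrib_left)
          also have "\<dots> \<le> L + e" using tL by simp
          finally have "ereal (B + ln 2 + t * ln ((cmod w)\<^sup>2)) \<le> ereal (L + (B + ln 2) + e)" by simp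
          then show "psi_env \<phi> t y \<le> ereal (L + (B + ln 2) + e)"
            unfolding w(1) using bound[OF w(2,3), of t] by (rule order_trans[rotated])
        qed (use t in auto)
        then show "h (Some z) \<le> ereal (L + (B + ln 2)) + ereal e" by simp
      qed
      then show ?thesis using False by (simp add: ln_ext_def L_def)
    next
      case True
      \<comment> \<open>The single parameter 1/2 suffices at the origin: on small discs its envelope
        is already below any prescribed number.\<close>
      have le: "h (Some 0) \<le> ereal (B + ln 2 - M)" if M: "0 < M" for M
      proof (rule hI[of "Some ` ball 0 (exp (- M))" _ "1/2"])
        show "openin P1_top (Some ` ball 0 (exp (- M)))" by (intro openin_P1_chart_image) auto
        fix y assume "y \<in> Some ` ball (0::complex) (exp (- M))"
        then obtain w where w: "y = Some w" "cmod w < exp (- M)" by auto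
        show "psi_env \<phi> (1/2) y \<le> ereal (B + ln 2 - M)"
        proof (cases "w = 0")
          case True
          then show ?thesis using psi_env_at_0[of "1/2" \<phi>] w by simp
        next
          case False
          have "cmod w < 1" using w(2) M by (meson exp_less_one_iff less_trans neg_less_0_iff_less)
          have "ln (cmod w) < - M" using w(2) False by (metis exp_gt_zero ln_exp ln_less_cancel_iff zero_less_norm_iff)
          then have "1/2 * ln ((cmod w)\<^sup>2) \<le> - M" unfolding ln_cmod_square[OF False] by simp
          then have "ereal (B + ln 2 + 1/2 * ln ((cmod w)\<^sup>2)) \<le> ereal (B + ln 2 - M)" by simp
          then show ?thesis unfolding w(1) using bound[OF False \<open>cmod w < 1\<close>, of "1/2"] by (rule order_trans[rotated])
        qed
      qed auto
      have "h (Some 0) = -\<infinity>"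
      proof (rule ereal_bot)
        fix y
        have "h (Some 0) \<le> ereal (B + ln 2 - (\<bar>B + ln 2 - y\<bar> + 1))" by (rule le) simp
        also have "\<dots> \<le> ereal y" unfolding ereal_less_eq by linarith
        finally show "h (Some 0) \<le> ereal y" .
      qed
      then show ?thesis using True by simp
    qed
  qed
  ultimately have "psi_cand \<phi> 1 h" using h\<phi> by (intro psi_candI)
  then have "h x < c" using c psi_cand_le_env le_less_trans by blast
  then obtain V t where V: "x \<in> V" "0 < t" "t < 1" "(SUP y\<in>V. psi_env \<phi> t y) < c" using hE by blast
  then have "psi_env \<phi> t x < c" by (meson SUP_upper le_less_trans)
  then show thesis using that V by blast
qed

section \<open>Candidates on the product with the disc\<close>

abbreviation P1_disc :: "(P1 \<times> complex) topology" where
  "P1_disc \<equiv> prod_topology P1_top (top_of_set (cball 0 1))"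

definition Phi_cand :: "(P1 \<Rightarrow> real) \<Rightarrow> (P1 \<times> complex \<Rightarrow> ereal) \<Rightarrow> bool" where
  "Phi_cand \<phi> \<psi> \<longleftrightarrow> usc_on P1_disc \<psi> \<and> FS_psh_disc \<psi> \<and>
     (\<forall>x. \<forall>\<tau>\<in>sphere 0 1. \<psi> (x, \<tau>) \<le> ereal (\<phi> x)) \<and> lelong_ge_one_disc \<psi>"

lemma Phi_env_eq: "Phi_env \<phi> p = (SUP \<psi>\<in>Collect (Phi_cand \<phi>). \<psi> p)"
proof -
  have "Collect (Phi_cand \<phi>) = {\<psi>. usc_on P1_disc \<psi> \<and> FS_psh_disc \<psi> \<and>
     (\<forall>x. \<forall>\<tau>\<in>sphere 0 1. \<psi> (x, \<tau>) \<le> ereal (\<phi> x)) \<and> lelong_ge_one_disc \<psi>}"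
    unfolding Phi_cand_def by (rule refl)
  then show ?thesis by (simp only: Phi_env_def)
qed

lemma Phi_cand_le_env: "Phi_cand \<phi> \<psi> \<Longrightarrow> \<psi> p \<le> Phi_env \<phi> p"
  unfolding Phi_env_eq by (rule SUP_upper) simp

lemma Phi_env_leI: "(\<And>\<psi>. Phi_cand \<phi> \<psi> \<Longrightarrow> \<psi> p \<le> c) \<Longrightarrow> Phi_env \<phi> p \<le> c"
  unfolding Phi_env_eq by (rule SUP_least) simp

lemma lelong_ge_one_discE:
  assumes "lelong_ge_one_disc \<psi>"
  obtains C d where "0 < d" "\<And>z \<tau>. cmod z < d \<Longrightarrow> cmod \<tau> < d \<Longrightarrow>
    \<psi> (Some z, \<tau>) \<le> ln_ext ((cmod z)\<^sup>2 + (cmod \<tau>)\<^sup>2) + ereal C"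
proof -
  obtain C where "eventually (\<lambda>(z, \<tau>). \<psi> (Some z, \<tau>) \<le> ln_ext ((cmod z)\<^sup>2 + (cmod \<tau>)\<^sup>2) + ereal C) (nhds (0, 0))"
    using assms by (auto simp: lelong_ge_one_disc_def)
  then obtain e where e: "0 < e" "\<And>p. dist p (0, 0) < e \<Longrightarrow>
      (\<lambda>(z, \<tau>). \<psi> (Some z, \<tau>) \<le> ln_ext ((cmod z)\<^sup>2 + (cmod \<tau>)\<^sup>2) + ereal C) p"
    unfolding eventually_nhds_metric by blast
  show thesis
  proof (rule that[of "e / 2" C])
    fix z \<tau> :: complex assume "cmod z < e / 2" "cmod \<tau> < e / 2"
    then have "norm (z, \<tau>) < e" using norm_Pair_le[of z \<tau>] by linarith
    then have "dist (z, \<tau>) (0, 0) < e" unfolding zero_prod_def[symmetric] dist_norm by simp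
    from e(2)[OF this] show "\<psi> (Some z, \<tau>) \<le> ln_ext ((cmod z)\<^sup>2 + (cmod \<tau>)\<^sup>2) + ereal C" by simp
  qed (use e in auto)
qed

lemma lelong_ge_one_discI:
  assumes "0 < d" "\<And>z \<tau>. cmod z < d \<Longrightarrow> cmod \<tau> < d \<Longrightarrow>
    \<psi> (Some z, \<tau>) \<le> ln_ext ((cmod z)\<^sup>2 + (cmod \<tau>)\<^sup>2) + ereal C"
  shows "lelong_ge_one_disc \<psi>"
proof -
  have "\<forall>p. dist p (0, 0) < d \<longrightarrow>
      (\<lambda>(z, \<tau>). \<psi> (Some z, \<tau>) \<le> ln_ext ((cmod z)\<^sup>2 + (cmod \<tau>)\<^sup>2) + ereal C) p"
  proof (intro allI impI)
    fix p :: "complex \<times> complex" assume "dist p (0, 0) < d"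
    then have "norm p < d" unfolding zero_prod_def[symmetric] by simp
    then have "cmod (fst p) < d" "cmod (snd p) < d"
      using norm_fst_le[of "fst p" "snd p"] norm_snd_le[of "snd p" "fst p"] by auto
    then show "(\<lambda>(z, \<tau>). \<psi> (Some z, \<tau>) \<le> ln_ext ((cmod z)\<^sup>2 + (cmod \<tau>)\<^sup>2) + ereal C) p"
      using assms(2)[of "fst p" "snd p"] by (auto simp: case_prod_beta)
  qed
  then show ?thesis unfolding lelong_ge_one_disc_def eventually_nhds_metric using assms(1) by blast
qed

lemma continuous_map_P1_disc:
  assumes "\<kappa> \<in> P1_charts" "continuous_on A g" "continuous_on A k" "\<And>p. p \<in> A \<Longrightarrow> cmod (k p) \<le> 1"
  shows "continuous_map (top_of_set A) P1_disc (\<lambda>p. (\<kappa> (g p), k p))"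
proof (intro continuous_map_pairedI)
  show "continuous_map (top_of_set A) P1_top (\<lambda>p. \<kappa> (g p))"
    using continuous_map_compose[of "top_of_set A" euclidean g P1_top \<kappa>] assms(1,2) continuous_map_P1_chart
    by (simp add: o_def)
  show "continuous_map (top_of_set A) (top_of_set (cball 0 1)) k" using assms(3,4) by auto
qed

lemma product_psh:
  assumes \<psi>: "FS_sh \<psi>" and c: "0 \<le> c" and \<kappa>: "\<kappa> \<in> P1_charts"
  shows "psh_on (UNIV \<times> ball 0 1) (\<lambda>(z, \<tau>). ereal (FS_potential z) + (\<psi> (\<kappa> z) + ereal c * ln_ext ((cmod \<tau>)\<^sup>2)))"
    (is "psh_on ?U ?u")
proof -
  let ?v = "\<lambda>z. ereal (FS_potential z) + \<psi> (\<kappa> z)"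
  have sh: "subharmonic_on UNIV ?v" by (rule FS_sh_D[OF \<psi> \<kappa>])
  have eq: "?u = (\<lambda>p. ?v (fst p) + ereal c * ln_ext ((cmod (snd p))\<^sup>2))" by (auto simp: add.assoc)
  show ?thesis unfolding eq psh_on_def
  proof (intro conjI allI)
    show "usc_on (top_of_set ?U) (\<lambda>p. ?v (fst p) + ereal c * ln_ext ((cmod (snd p))\<^sup>2))"
    proof (rule usc_on_add)
      show "usc_on (top_of_set ?U) (\<lambda>p. ?v (fst p))"
        by (rule usc_on_compose[OF _ subharmonic_on_usc[OF sh]]) (auto intro: continuous_intros)
      show "usc_on (top_of_set ?U) (\<lambda>p. ereal c * ln_ext ((cmod (snd p))\<^sup>2))"
        using c by (intro usc_on_cmult usc_on_ln_ext continuous_intros) auto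
    qed
    fix a1 a2 b1 b2 :: complex
    have "(\<lambda>l. a2 + l * b2) holomorphic_on UNIV" by (intro holomorphic_intros)
    then show "subharmonic_on {l. (a1 + l * b1, a2 + l * b2) \<in> ?U}
        (\<lambda>l. ?v (fst (a1 + l * b1, a2 + l * b2)) + ereal c * ln_ext ((cmod (snd (a1 + l * b1, a2 + l * b2)))\<^sup>2))"
      unfolding fst_conv snd_conv using c
      by (intro subharmonic_on_add subharmonic_on_affine[OF sh] subharmonic_on_cmult subharmonic_on_ln_norm) auto
  qed
qed

text \<open>Both logarithms are at most ln (|z|^2 + |\<tau>|^2), so their combination with weights t
  and 1 - t is too. This is why the parameter is confined to [0,1]: both weights have to be
  nonnegative.\<close>

lemma product_candidate:
  assumes \<psi>: "psi_cand \<phi> t \<psi>" and t: "0 \<le> t" "t \<le> 1"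
  shows "Phi_cand \<phi> (\<lambda>(x, \<tau>). \<psi> x + ereal (1 - t) * ln_ext ((cmod \<tau>)\<^sup>2))"
  unfolding Phi_cand_def
proof (intro conjI allI ballI)
  have eq: "(\<lambda>(x, \<tau>). \<psi> x + ereal (1 - t) * ln_ext ((cmod \<tau>)\<^sup>2)) =
      (\<lambda>p. \<psi> (fst p) + ereal (1 - t) * ln_ext ((cmod (snd p))\<^sup>2))" by auto
  show "usc_on P1_disc (\<lambda>(x, \<tau>). \<psi> x + ereal (1 - t) * ln_ext ((cmod \<tau>)\<^sup>2))"
    unfolding eq
  proof (rule usc_on_add)
    show "usc_on P1_disc (\<lambda>p. \<psi> (fst p))"
      by (rule usc_on_compose[OF continuous_map_fst]) (use \<psi> in \<open>simp add: psi_cand_def\<close>)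
    have "usc_on (top_of_set (cball 0 1)) (\<lambda>\<tau>::complex. ereal (1 - t) * ln_ext ((cmod \<tau>)\<^sup>2))"
      using t by (intro usc_on_cmult usc_on_ln_ext continuous_intros) auto
    then show "usc_on P1_disc (\<lambda>p. ereal (1 - t) * ln_ext ((cmod (snd p))\<^sup>2))"
      by (rule usc_on_compose[OF continuous_map_snd])
  qed
  show "FS_psh_disc (\<lambda>(x, \<tau>). \<psi> x + ereal (1 - t) * ln_ext ((cmod \<tau>)\<^sup>2))"
    unfolding FS_psh_disc_def using product_psh[of \<psi> "1 - t"] \<psi> t by (simp add: psi_cand_def)
  show "(case (x, \<tau>) of (x, \<tau>) \<Rightarrow> \<psi> x + ereal (1 - t) * ln_ext ((cmod \<tau>)\<^sup>2)) \<le> ereal (\<phi> x)"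
    if "\<tau> \<in> sphere 0 1" for x and \<tau> :: complex
  proof -
    have "cmod \<tau> = 1" "\<psi> x \<le> ereal (\<phi> x)" using that \<psi> by (auto simp: psi_cand_def)
    then show ?thesis by (auto simp: ln_ext_def zero_ereal_def[symmetric])
  qed
  obtain C d where d: "0 < d" "\<And>z. cmod z < d \<Longrightarrow> \<psi> (Some z) \<le> ereal t * ln_ext ((cmod z)\<^sup>2) + ereal C"
    using \<psi> lelong_geE unfolding psi_cand_def by metis
  show "lelong_ge_one_disc (\<lambda>(x, \<tau>). \<psi> x + ereal (1 - t) * ln_ext ((cmod \<tau>)\<^sup>2))"
  proof (rule lelong_ge_one_discI[OF d(1), of _ C])
    fix z \<tau> :: complex assume z: "cmod z < d"
    let ?L = "ln_ext ((cmod z)\<^sup>2 + (cmod \<tau>)\<^sup>2)"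
    have "\<psi> (Some z) + ereal (1 - t) * ln_ext ((cmod \<tau>)\<^sup>2) \<le>
       (ereal t * ln_ext ((cmod z)\<^sup>2) + ereal C) + ereal (1 - t) * ln_ext ((cmod \<tau>)\<^sup>2)"
      using d(2)[OF z] by (rule add_right_mono)
    also have "\<dots> \<le> (ereal t * ?L + ereal C) + ereal (1 - t) * ?L"
      using t by (intro add_mono ereal_mult_left_mono ln_ext_mono) auto
    also have "\<dots> = ?L + ereal C"
    proof (cases "?L")
      case (real y)
      then show ?thesis by (simp add: algebra_simps)
    next
      case MInf
      then show ?thesis using t by (cases "t = 0"; cases "t = 1") (auto simp: zero_ereal_def[symmetric] one_ereal_def[symmetric])
    next
      case PInf
      then show ?thesis by (simp add: ln_ext_def split: if_splits)
    qed
    finally show "(case (Some z, \<tau>) of (x, \<tau>) \<Rightarrow> \<psi> x + ereal (1 - t) * ln_ext ((cmod \<tau>)\<^sup>2)) \<le> ?L + ereal C" by simp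
  qed
qed

section \<open>Suprema over rotations of the disc\<close>

definition rot_sup :: "(P1 \<times> complex \<Rightarrow> ereal) \<Rightarrow> P1 \<times> complex \<Rightarrow> ereal" where
  "rot_sup \<psi> p = (SUP c\<in>sphere 0 1. \<psi> (fst p, c * snd p))"

lemma le_rot_sup: "cmod c = 1 \<Longrightarrow> \<psi> (x, c * \<tau>) \<le> rot_sup \<psi> (x, \<tau>)"
  unfolding rot_sup_def by (rule SUP_upper2[of c]) auto

lemma rot_sup_leI: "(\<And>c. cmod c = 1 \<Longrightarrow> \<psi> (x, c * \<tau>) \<le> b) \<Longrightarrow> rot_sup \<psi> (x, \<tau>) \<le> b"
  unfolding rot_sup_def by (rule SUP_least) auto

lemma rot_sup_cmod: "rot_sup \<psi> (x, \<tau>) = rot_sup \<psi> (x, of_real (cmod \<tau>))"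
proof (cases "\<tau> = 0")
  case False
  define c where "c = \<tau> / of_real (cmod \<tau>)"
  have c: "cmod c = 1" "\<tau> = c * of_real (cmod \<tau>)" using False by (auto simp: c_def norm_divide)
  show ?thesis
  proof (rule antisym)
    show "rot_sup \<psi> (x, \<tau>) \<le> rot_sup \<psi> (x, of_real (cmod \<tau>))"
    proof (rule rot_sup_leI)
      fix b assume "cmod b = 1"
      then have "\<psi> (x, (b * c) * of_real (cmod \<tau>)) \<le> rot_sup \<psi> (x, of_real (cmod \<tau>))"
        using c(1) by (intro le_rot_sup) (simp add: norm_mult)
      then show "\<psi> (x, b * \<tau>) \<le> rot_sup \<psi> (x, of_real (cmod \<tau>))" using c(2) by (metis mult.assoc)
    qed
    show "rot_sup \<psi> (x, of_real (cmod \<tau>)) \<le> rot_sup \<psi> (x, \<tau>)"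
    proof (rule rot_sup_leI)
      fix b assume "cmod b = 1"
      then have "\<psi> (x, (b / c) * \<tau>) \<le> rot_sup \<psi> (x, \<tau>)"
        using c(1) by (intro le_rot_sup) (simp add: norm_divide)
      moreover have "(b / c) * \<tau> = b * of_real (cmod \<tau>)" using c by (metis nonzero_mult_div_cancel_left norm_zero times_divide_eq_left times_divide_eq_right zero_neq_one)
      ultimately show "\<psi> (x, b * of_real (cmod \<tau>)) \<le> rot_sup \<psi> (x, \<tau>)" by simp
    qed
  qed
qed simp

text \<open>The rotation group is compact, so the supremum is upper semicontinuous without
  regularisation. Rotations map complex lines to complex lines, hence a majorant of the supremum on
  a line majorises each rotated function there; moduli, and with them the remaining two conditions,
  are preserved.\<close>

lemma Phi_cand_rot_sup:
  assumes \<psi>: "Phi_cand \<phi> \<psi>"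
  shows "Phi_cand \<phi> (rot_sup \<psi>)"
proof -
  let ?S = "top_of_set (sphere (0::complex) 1)"
  have "continuous_map (prod_topology P1_disc ?S) P1_disc (\<lambda>q. (fst (fst q), snd q * snd (fst q)))"
  proof (intro continuous_map_pairedI)
    show "continuous_map (prod_topology P1_disc ?S) P1_top (\<lambda>q. fst (fst q))"
      using continuous_map_compose[OF continuous_map_fst continuous_map_fst] by (simp add: o_def)
    have 1: "continuous_map (prod_topology P1_disc ?S) euclidean (\<lambda>q. snd q)"
      using continuous_map_snd[of P1_disc ?S] unfolding continuous_map_in_subtopology by (rule conjunct1)
    have "continuous_map (prod_topology P1_disc ?S) (top_of_set (cball 0 1)) (snd \<circ> fst)"
      by (rule continuous_map_compose[OF continuous_map_fst continuous_map_snd])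
    then have 2: "continuous_map (prod_topology P1_disc ?S) euclidean (\<lambda>q. snd (fst q))"
      unfolding continuous_map_in_subtopology o_def by (rule conjunct1)
    have "continuous_map (prod_topology P1_disc ?S) euclidean (\<lambda>q. snd q * snd (fst q))"
    proof -
      have "continuous_map (prod_topology euclidean euclidean) euclidean (\<lambda>p::complex \<times> complex. fst p * snd p)"
      proof -
        have "continuous_on UNIV (\<lambda>p::complex \<times> complex. fst p * snd p)" by (intro continuous_intros)
        then show ?thesis by simp
      qed
      from continuous_map_compose[OF continuous_map_pairedI[OF 1 2] this] show ?thesis by (simp add: o_def)
    qed
    then show "continuous_map (prod_topology P1_disc ?S) (top_of_set (cball 0 1)) (\<lambda>q. snd q * snd (fst q))"
      unfolding continuous_map_in_subtopology by (simp add: Pi_iff norm_mult mult_le_one)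
  qed
  then have "usc_on (prod_topology P1_disc ?S) (\<lambda>q. \<psi> (fst (fst q), snd q * snd (fst q)))"
    by (rule usc_on_compose) (use \<psi> in \<open>simp add: Phi_cand_def\<close>)
  then have "usc_on P1_disc (\<lambda>p. SUP c\<in>topspace ?S. \<psi> (fst (fst (p, c)), snd (p, c) * snd (fst (p, c))))"
    by (rule usc_on_SUP_compact) (auto simp: compact_space_subtopology)
  then have usc: "usc_on P1_disc (rot_sup \<psi>)" by (simp add: rot_sup_def[abs_def])
  have psh: "psh_on (UNIV \<times> ball 0 1) (\<lambda>(z, \<tau>). ereal (FS_potential z) + rot_sup \<psi> (\<kappa> z, \<tau>))" if \<kappa>: "\<kappa> \<in> P1_charts" for \<kappa>
    unfolding psh_on_def
  proof (intro conjI allI)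
    let ?U = "UNIV \<times> ball (0::complex) 1"
    have "usc_on (top_of_set ?U) (\<lambda>p. ereal (FS_potential (fst p)) + rot_sup \<psi> (\<kappa> (fst p), snd p))"
    proof (intro usc_on_add usc_on_ereal)
      show "continuous_on ?U (\<lambda>p. FS_potential (fst p))"
        by (rule continuous_on_compose2[OF continuous_on_FS_potential[of UNIV]]) (auto intro: continuous_intros)
      show "usc_on (top_of_set ?U) (\<lambda>p. rot_sup \<psi> (\<kappa> (fst p), snd p))"
        by (rule usc_on_compose[OF continuous_map_P1_disc[OF \<kappa>] usc]) (auto intro: continuous_intros)
    qed
    then show u: "usc_on (top_of_set ?U) (\<lambda>(z, \<tau>). ereal (FS_potential z) + rot_sup \<psi> (\<kappa> z, \<tau>))"
      by (simp add: case_prod_beta')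
    fix a1 a2 b1 b2 :: complex
    let ?V = "{l. (a1 + l * b1, a2 + l * b2) \<in> ?U}"
    show "subharmonic_on ?V (\<lambda>l. case (a1 + l * b1, a2 + l * b2) of (z, \<tau>) \<Rightarrow> ereal (FS_potential z) + rot_sup \<psi> (\<kappa> z, \<tau>))"
      unfolding prod.case
    proof (rule subharmonic_onI)
      show "usc_on (top_of_set ?V) (\<lambda>l. ereal (FS_potential (a1 + l * b1)) + rot_sup \<psi> (\<kappa> (a1 + l * b1), a2 + l * b2))"
      proof -
        have "continuous_on ?V (\<lambda>l. (a1 + l * b1, a2 + l * b2))" by (intro continuous_intros)
        then have "continuous_map (top_of_set ?V) (top_of_set ?U) (\<lambda>l. (a1 + l * b1, a2 + l * b2))" by auto
        from usc_on_compose[OF this u] show ?thesis by simp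
      qed
      fix a r p assume *: "0 < r" "cball a r \<subseteq> ?V" "p holomorphic_on UNIV"
        and less: "\<And>z. z \<in> sphere a r \<Longrightarrow> ereal (FS_potential (a1 + z * b1)) + rot_sup \<psi> (\<kappa> (a1 + z * b1), a2 + z * b2) < ereal (Re (p z))"
      have "rot_sup \<psi> (\<kappa> (a1 + a * b1), a2 + a * b2) \<le> ereal (Re (p a) - FS_potential (a1 + a * b1))"
      proof (rule rot_sup_leI)
        fix c :: complex assume c: "cmod c = 1"
        have "psh_on ?U (\<lambda>(z, \<tau>). ereal (FS_potential z) + \<psi> (\<kappa> z, \<tau>))"
          using \<psi> \<kappa> by (auto simp: Phi_cand_def FS_psh_disc_def)
        from psh_on_line[OF this, of a1 b1 "c * a2" "c * b2"]
        have "subharmonic_on {l. (a1 + l * b1, c * a2 + l * (c * b2)) \<in> ?U}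
            (\<lambda>l. ereal (FS_potential (a1 + l * b1)) + \<psi> (\<kappa> (a1 + l * b1), c * a2 + l * (c * b2)))" by simp
        moreover have e: "c * a2 + l * (c * b2) = c * (a2 + l * b2)" for l by (simp add: algebra_simps)
        ultimately have "subharmonic_on ?V (\<lambda>l. ereal (FS_potential (a1 + l * b1)) + \<psi> (\<kappa> (a1 + l * b1), c * (a2 + l * b2)))"
          using c by (simp add: norm_mult)
        then have "ereal (FS_potential (a1 + a * b1)) + \<psi> (\<kappa> (a1 + a * b1), c * (a2 + a * b2)) \<le> ereal (Re (p a))"
        proof (rule subharmonic_onD[OF _ *])
          fix z assume "z \<in> sphere a r"
          have "ereal (FS_potential (a1 + z * b1)) + \<psi> (\<kappa> (a1 + z * b1), c * (a2 + z * b2))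
             \<le> ereal (FS_potential (a1 + z * b1)) + rot_sup \<psi> (\<kappa> (a1 + z * b1), a2 + z * b2)"
            by (intro add_left_mono le_rot_sup c)
          also have "\<dots> \<le> ereal (Re (p z))" using less[OF \<open>z \<in> sphere a r\<close>] by simp
          finally show "ereal (FS_potential (a1 + z * b1)) + \<psi> (\<kappa> (a1 + z * b1), c * (a2 + z * b2)) \<le> ereal (Re (p z))" .
        qed
        then show "\<psi> (\<kappa> (a1 + a * b1), c * (a2 + a * b2)) \<le> ereal (Re (p a) - FS_potential (a1 + a * b1))"
          by (simp add: ereal_shift add.commute)
      qed
      then show "ereal (FS_potential (a1 + a * b1)) + rot_sup \<psi> (\<kappa> (a1 + a * b1), a2 + a * b2) \<le> ereal (Re (p a))"
        by (simp add: ereal_shift add.commute)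
    qed
  qed
  obtain C d where d: "0 < d" "\<And>z \<tau>. cmod z < d \<Longrightarrow> cmod \<tau> < d \<Longrightarrow>
    \<psi> (Some z, \<tau>) \<le> ln_ext ((cmod z)\<^sup>2 + (cmod \<tau>)\<^sup>2) + ereal C"
    using \<psi> lelong_ge_one_discE[of \<psi>] unfolding Phi_cand_def by metis
  have "lelong_ge_one_disc (rot_sup \<psi>)"
  proof (rule lelong_ge_one_discI[OF d(1), of _ C], rule rot_sup_leI)
    fix z \<tau> c :: complex assume "cmod z < d" "cmod \<tau> < d" "cmod c = 1"
    then show "\<psi> (Some z, c * \<tau>) \<le> ln_ext ((cmod z)\<^sup>2 + (cmod \<tau>)\<^sup>2) + ereal C"
      using d(2)[of z "c * \<tau>"] by (simp add: norm_mult)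
  qed
  moreover have "rot_sup \<psi> (x, \<tau>) \<le> ereal (\<phi> x)" if "\<tau> \<in> sphere 0 1" for x \<tau>
    by (rule rot_sup_leI) (use \<psi> that in \<open>auto simp: Phi_cand_def norm_mult\<close>)
  ultimately show ?thesis using usc psh unfolding Phi_cand_def FS_psh_disc_def by blast
qed

section \<open>Kiselman's minimum principle\<close>

text \<open>A value g y remains admissible for all z near y. Finitely many such neighbourhoods cover
  S, and a partition of unity built from distances to their complements averages the values;
  convexity of the fibres keeps the average admissible.\<close>

lemma compact_continuous_selection:
  fixes S :: "'a::metric_space set" and A :: "('a \<times> real) set"
  assumes S: "compact S" and A: "openin (top_of_set (S \<times> T)) A"
    and ne: "\<And>z. z \<in> S \<Longrightarrow> \<exists>s. (z, s) \<in> A" and conv: "\<And>z. z \<in> S \<Longrightarrow> convex {s. (z, s) \<in> A}"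
  obtains x where "continuous_on S x" "\<And>z. z \<in> S \<Longrightarrow> (z, x z) \<in> A"
proof -
  obtain G where G: "open G" "A = (S \<times> T) \<inter> G" using A by (auto simp: openin_open)
  obtain g where g: "\<And>z. z \<in> S \<Longrightarrow> (z, g z) \<in> A" using ne by metis
  define N where "N y = {z. (z, g y) \<in> G}" for y
  have N: "open (N y)" for y
    using continuous_open_preimage[of UNIV "\<lambda>z. (z, g y)" G] G(1)
    by (simp add: N_def vimage_def continuous_intros)
  have "S \<subseteq> (\<Union>y\<in>S. N y)" using g G(2) by (auto simp: N_def)
  then obtain Z where Z: "Z \<subseteq> S" "finite Z" "S \<subseteq> (\<Union>y\<in>Z. N y)"
    using compactE_image[OF S, of S N] N by blast
  \<comment> \<open>The distance to the empty set is 0 by convention, hence the separate weight 1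
    when the neighbourhood is everything.\<close>
  define w where "w y z = (if - N y = {} then 1 else infdist z (- N y))" for y z
  have wcont: "continuous_on S (w y)" for y
    unfolding w_def by (cases "- N y = {}") (auto intro!: continuous_intros)
  have w0: "0 \<le> w y z" for y z by (simp add: w_def infdist_nonneg)
  have wpos: "0 < w y z \<longleftrightarrow> z \<in> N y" for y z
  proof (cases "- N y = {}")
    case False
    have "closed (- N y)" using N by (simp add: closed_Compl)
    then have "z \<in> - N y \<longleftrightarrow> infdist z (- N y) = 0" by (rule in_closed_iff_infdist_zero[OF _ False])
    then show ?thesis using False infdist_nonneg[of z "- N y"] by (auto simp: w_def order_le_less)
  qed (auto simp: w_def)
  define W where "W z = (\<Sum>y\<in>Z. w y z)" for z
  have W: "0 < W z" if z: "z \<in> S" for z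
  proof -
    obtain y where y: "y \<in> Z" "z \<in> N y" using Z(3) z by auto
    then have "0 < w y z" using wpos by blast
    then show ?thesis unfolding W_def using Z(2) y(1) w0 by (intro sum_pos2) auto
  qed
  define x where "x z = (\<Sum>y\<in>Z. (w y z / W z) * g y)" for z
  show thesis
  proof (rule that)
    show "continuous_on S x"
      unfolding x_def W_def by (intro continuous_intros wcont) (use W in \<open>force simp: W_def\<close>)
    fix z assume z: "z \<in> S"
    define Y where "Y = {y \<in> Z. z \<in> N y}"
    have zero: "w y z = 0" if "y \<in> Z - Y" for y
      using that wpos[of y z] w0[of y z] by (auto simp: Y_def)
    have fin: "finite Y" and sub: "Y \<subseteq> Z" using Z(2) by (auto simp: Y_def)
    have "(\<Sum>y\<in>Y. w y z / W z) = (\<Sum>y\<in>Z. w y z / W z)"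
      using zero by (intro sum.mono_neutral_left Z(2) sub) auto
    also have "\<dots> = 1" using W[OF z] by (simp add: W_def flip: sum_divide_distrib)
    finally have one: "(\<Sum>y\<in>Y. w y z / W z) = 1" .
    have "(\<Sum>y\<in>Y. (w y z / W z) *\<^sub>R g y) \<in> {s. (z, s) \<in> A}"
    proof (rule convex_sum[OF fin conv[OF z] one])
      fix y assume y: "y \<in> Y"
      show "0 \<le> w y z / W z" using w0 W[OF z] by simp
      have "(y, g y) \<in> A" using y Z(1) g by (auto simp: Y_def)
      then show "g y \<in> {s. (z, s) \<in> A}" using y z by (auto simp: Y_def N_def G(2))
    qed
    also have "(\<Sum>y\<in>Y. (w y z / W z) *\<^sub>R g y) = x z"
      unfolding x_def real_scaleR_def using zero by (intro sum.mono_neutral_left Z(2) sub) auto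
    finally show "(z, x z) \<in> A" by simp
  qed
qed

text \<open>The graph of a continuous function over a compact set is compact, so an open set
  containing it contains a tube of uniform width. This leaves room to replace the selection by a
  harmonic function.\<close>

lemma compact_graph_neighbourhood:
  fixes S :: "'a::metric_space set" and A :: "('a \<times> real) set"
  assumes S: "compact S" and T: "open T" and A: "openin (top_of_set (S \<times> T)) A"
    and x: "continuous_on S x" "\<And>z. z \<in> S \<Longrightarrow> (z, x z) \<in> A"
  obtains d where "0 < d" "\<And>z s. z \<in> S \<Longrightarrow> \<bar>s - x z\<bar> < d \<Longrightarrow> (z, s) \<in> A"
proof -
  obtain G where G: "open G" "A = (S \<times> T) \<inter> G" using A by (auto simp: openin_open)
  have "compact ((\<lambda>z. (z, x z)) ` S)"
    by (intro compact_continuous_image S continuous_intros x)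
  moreover have "open (G \<inter> UNIV \<times> T)" by (intro open_Int open_Times G T open_UNIV)
  moreover have "(\<lambda>z. (z, x z)) ` S \<subseteq> G \<inter> UNIV \<times> T" using x(2) G(2) by auto
  ultimately obtain d where d: "0 < d" "(\<Union>p\<in>(\<lambda>z. (z, x z)) ` S. ball p d) \<subseteq> G \<inter> UNIV \<times> T"
    by (rule compact_subset_open_imp_ball_epsilon_subset)
  show thesis
  proof (rule that[OF d(1)])
    fix z s assume z: "z \<in> S" "\<bar>s - x z\<bar> < d"
    then have "(z, s) \<in> ball (z, x z) d" by (simp add: dist_Pair_Pair dist_real_def abs_minus_commute)
    then have "(z, s) \<in> G \<inter> UNIV \<times> T" using d(2) z(1) by blast
    then show "(z, s) \<in> A" using G(2) z(1) by auto
  qed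
qed

section \<open>The partial Legendre transform in ln |\<tau>|\<close>

definition radial :: "(P1 \<times> complex \<Rightarrow> ereal) \<Rightarrow> bool" where
  "radial S \<longleftrightarrow> (\<forall>x \<tau>. S (x, \<tau>) = S (x, of_real (cmod \<tau>)))"

lemma radialD: "radial S \<Longrightarrow> S (x, \<tau>) = S (x, of_real (cmod \<tau>))"
  unfolding radial_def by blast

lemma radial_exp: "radial S \<Longrightarrow> S (x, exp w) = S (x, of_real (exp (Re w)))"
  using radialD[of S x "exp w"] by simp

text \<open>The three circles theorem on the disc over a fixed point x. Convexity is phrased through
  affine majorants because values may be -\<infinity>; the slope is halved since
  \<open>annulus_bound\<close> uses ln |w|^2 = 2 s.\<close>

lemma Phi_cand_convex_ln:
  assumes S: "Phi_cand \<phi> S" "radial S" and s: "s1 \<le> s" "s \<le> s2" "s2 < 0"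
    and bd: "S (x, of_real (exp s1)) \<le> ereal (\<alpha> + \<beta> * s1)" "S (x, of_real (exp s2)) \<le> ereal (\<alpha> + \<beta> * s2)"
  shows "S (x, of_real (exp s)) \<le> ereal (\<alpha> + \<beta> * s)"
proof -
  obtain \<kappa> z where \<kappa>: "\<kappa> \<in> P1_charts" "x = \<kappa> z" by (rule P1_covered_by_unit_discs)
  have "psh_on (UNIV \<times> ball 0 1) (\<lambda>(z, \<tau>). ereal (FS_potential z) + S (\<kappa> z, \<tau>))"
    using S(1) \<kappa> by (auto simp: Phi_cand_def FS_psh_disc_def)
  from psh_on_line[OF this, of z 0 0 1]
  have sh: "subharmonic_on (ball 0 1) (\<lambda>\<tau>. ereal (FS_potential z) + S (x, \<tau>))"
    by (simp add: \<kappa>(2) ball_def dist_norm)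
  have "ereal (FS_potential z) + S (x, of_real (exp s)) \<le> ereal (FS_potential z + \<alpha> + (\<beta> / 2) * ln ((cmod (of_real (exp s)))\<^sup>2))"
  proof (rule annulus_bound[OF sh, of "exp s1" "exp s2"])
    fix w :: complex assume "cmod w = exp s1 \<or> cmod w = exp s2"
    then show "ereal (FS_potential z) + S (x, w) \<le> ereal (FS_potential z + \<alpha> + \<beta> / 2 * ln ((cmod w)\<^sup>2))"
    proof
      assume w: "cmod w = exp s1"
      have "S (x, w) \<le> ereal (\<alpha> + \<beta> * s1)" using radialD[OF S(2), of x w] bd(1) w by simp
      then have "ereal (FS_potential z) + S (x, w) \<le> ereal (FS_potential z) + ereal (\<alpha> + \<beta> * s1)" by (rule add_left_mono)
      then show ?thesis using w by (simp add: ln_realpow add.assoc)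
    next
      assume w: "cmod w = exp s2"
      have "S (x, w) \<le> ereal (\<alpha> + \<beta> * s2)" using radialD[OF S(2), of x w] bd(2) w by simp
      then have "ereal (FS_potential z) + S (x, w) \<le> ereal (FS_potential z) + ereal (\<alpha> + \<beta> * s2)" by (rule add_left_mono)
      then show ?thesis using w by (simp add: ln_realpow add.assoc)
    qed
  next
    fix w :: complex assume "cmod w \<le> exp s2"
    moreover have "exp s2 < 1" using s by simp
    ultimately show "w \<in> ball 0 1" unfolding mem_ball_0 by (rule le_less_trans)
  qed (use s in auto)
  then have "ereal (FS_potential z) + S (x, of_real (exp s)) \<le> ereal (FS_potential z + (\<alpha> + \<beta> * s))"
    by (simp add: ln_realpow add.assoc)
  then show ?thesis by (cases "S (x, of_real (exp s))") auto
qed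

text \<open>Up to sign the Legendre transform in s = ln |\<tau>|. Only s < 0 enters, since
  plurisubharmonicity is available over the open disc; the boundary s = 0 is reached by
  semicontinuity.\<close>

definition min_slice :: "(P1 \<times> complex \<Rightarrow> ereal) \<Rightarrow> real \<Rightarrow> P1 \<Rightarrow> ereal" where
  "min_slice S m x = (INF s\<in>{..<0}. S (x, of_real (exp s)) + ereal (- m * s))"

lemma min_slice_le: "s < 0 \<Longrightarrow> min_slice S m x \<le> S (x, of_real (exp s)) + ereal (- m * s)"
  unfolding min_slice_def by (rule INF_lower) simp

lemma Phi_cand_slice_usc:
  assumes S: "Phi_cand \<phi> S" and s: "s \<le> 0"
  shows "usc_on P1_top (\<lambda>x. S (x, of_real (exp s)))"
proof -
  have "complex_of_real (exp s) \<in> cball 0 1" using s by simp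
  then have "continuous_map P1_top P1_disc (\<lambda>x. (x, of_real (exp s)))"
    by (intro continuous_map_pairedI) auto
  then show ?thesis by (rule usc_on_compose) (use S in \<open>simp add: Phi_cand_def\<close>)
qed

text \<open>A harmonic majorant of the infimum on a circle is above the values \<open>S (\<kappa> z, exp (x z)) - m (x z)\<close>
  for some continuous \<open>x\<close>, because the admissible values form an interval for each \<open>z\<close>. Approximating \<open>x\<close>
  by the real part of an entire function \<open>f\<close> leads to the holomorphic curve \<open>\<tau> = exp (f z)\<close>.\<close>

lemma min_slice_FS_sh:
  assumes S: "Phi_cand \<phi> S" "radial S"
  shows "FS_sh (min_slice S m)"
  unfolding FS_sh_def
proof
  fix \<kappa> assume \<kappa>: "\<kappa> \<in> P1_charts"
  have uscS: "usc_on P1_disc S" using S by (simp add: Phi_cand_def)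
  have "usc_on P1_top (min_slice S m)"
    unfolding min_slice_def
  proof (rule usc_on_INF)
    fix s :: real assume "s \<in> {..<0}"
    then show "usc_on P1_top (\<lambda>x. S (x, of_real (exp s)) + ereal (- m * s))"
      by (intro usc_on_add usc_on_const Phi_cand_slice_usc[OF S(1)]) auto
  qed (auto intro: exI[of _ "-1"])
  then have usc: "usc_on (top_of_set UNIV) (\<lambda>z. min_slice S m (\<kappa> z))" using \<kappa> unfolding usc_on_P1_iff by blast
  show "subharmonic_on UNIV (\<lambda>z. ereal (FS_potential z) + min_slice S m (\<kappa> z))"
  proof (rule subharmonic_onI)
    show "usc_on (top_of_set UNIV) (\<lambda>z. ereal (FS_potential z) + min_slice S m (\<kappa> z))"
      using usc by (simp only: usc_on_FS_add_iff)
    fix a r p assume r: "0 < r" and p: "p holomorphic_on UNIV"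
      and less: "\<And>z. z \<in> sphere a r \<Longrightarrow> ereal (FS_potential z) + min_slice S m (\<kappa> z) < ereal (Re (p z))"
    let ?T = "sphere a r \<times> {..<0::real}"
    define A where "A = {q \<in> ?T. ereal (FS_potential (fst q) - m * snd q - Re (p (fst q))) + S (\<kappa> (fst q), of_real (exp (snd q))) < 0}"
    have memA: "(z, s) \<in> A \<longleftrightarrow> z \<in> sphere a r \<and> s < 0 \<and> S (\<kappa> z, of_real (exp s)) < ereal (Re (p z) - FS_potential z + m * s)" for z s
      unfolding A_def by (cases "S (\<kappa> z, of_real (exp s))") (auto simp: zero_ereal_def algebra_simps)
    have contp: "continuous_on UNIV (\<lambda>z. Re (p z))"
      using holomorphic_on_imp_continuous_on[OF p] by (rule continuous_on_Re)
    have "openin (top_of_set ?T) A"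
    proof -
      have c1: "continuous_on ?T (\<lambda>q. FS_potential (fst q))"
        by (rule continuous_on_compose2[OF continuous_on_FS_potential[of UNIV]]) (auto intro: continuous_intros)
      have c2: "continuous_on ?T (\<lambda>q. Re (p (fst q)))"
        by (rule continuous_on_compose2[OF contp]) (auto intro: continuous_intros)
      have c3: "continuous_map (top_of_set ?T) P1_disc (\<lambda>q. (\<kappa> (fst q), of_real (exp (snd q))))"
        by (rule continuous_map_P1_disc[OF \<kappa>]) (auto intro!: continuous_intros)
      have "usc_on (top_of_set ?T) (\<lambda>q. ereal (FS_potential (fst q) - m * snd q - Re (p (fst q))) + S (\<kappa> (fst q), of_real (exp (snd q))))"
        by (intro usc_on_add usc_on_ereal continuous_intros c1 c2 usc_on_compose[OF c3 uscS])
      then show ?thesis unfolding usc_on_def A_def by simp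
    qed
    moreover have "\<exists>s. (z, s) \<in> A" if z: "z \<in> sphere a r" for z
    proof -
      have "min_slice S m (\<kappa> z) < ereal (Re (p z) - FS_potential z)"
        using less[OF z] by (simp add: ereal_shift add.commute)
      then obtain s where s: "s < 0" "S (\<kappa> z, of_real (exp s)) + ereal (- m * s) < ereal (Re (p z) - FS_potential z)"
        unfolding min_slice_def INF_less_iff by auto
      then show ?thesis
        unfolding memA using z by (intro exI[of _ s]) (cases "S (\<kappa> z, of_real (exp s))", auto)
    qed
    moreover have "convex {s. (z, s) \<in> A}" if z: "z \<in> sphere a r" for z
    proof -
      have "is_interval {s. (z, s) \<in> A}"
        unfolding is_interval_1
      proof safe
        fix s1 s2 s assume s: "(z, s1) \<in> A" "(z, s2) \<in> A" "s1 \<le> s" "s \<le> s2"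
        let ?q = "Re (p z) - FS_potential z"
        \<comment> \<open>Strictness is stored in an intercept below \<open>?q\<close>, which gives
          real affine bounds at both endpoints even where \<open>S\<close> is -\<infinity>.\<close>
        have "\<exists>\<alpha><?q. S (\<kappa> z, of_real (exp s')) \<le> ereal (\<alpha> + m * s')" if s': "(z, s') \<in> A" for s'
        proof -
          have "S (\<kappa> z, of_real (exp s')) < ereal (?q + m * s')" using s' by (simp add: memA)
          then obtain y where "S (\<kappa> z, of_real (exp s')) < ereal y" "y < ?q + m * s'" using ereal_dense2 by force
          then show ?thesis by (intro exI[of _ "y - m * s'"]) auto
        qed
        then obtain \<alpha>1 \<alpha>2 where \<alpha>: "\<alpha>1 < ?q" "S (\<kappa> z, of_real (exp s1)) \<le> ereal (\<alpha>1 + m * s1)"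
          "\<alpha>2 < ?q" "S (\<kappa> z, of_real (exp s2)) \<le> ereal (\<alpha>2 + m * s2)" using s(1,2) by meson
        define \<alpha> where "\<alpha> = max \<alpha>1 \<alpha>2"
        have s20: "s2 < 0" using s(2) by (simp add: memA)
        have "S (\<kappa> z, of_real (exp s)) \<le> ereal (\<alpha> + m * s)"
          by (rule Phi_cand_convex_ln[OF S s(3,4) s20]; rule order_trans, rule \<alpha>) (auto simp: \<alpha>_def)
        also have "\<dots> < ereal (?q + m * s)" using \<alpha> by (simp add: \<alpha>_def)
        finally show "(z, s) \<in> A" using z s(4) s20 by (simp add: memA)
      qed
      then show ?thesis by (simp add: is_interval_convex_1)
    qed
    ultimately obtain x where x: "continuous_on (sphere a r) x" "\<And>z. z \<in> sphere a r \<Longrightarrow> (z, x z) \<in> A"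
      using compact_continuous_selection[OF compact_sphere] by metis
    obtain d where d: "0 < d" "\<And>z s. z \<in> sphere a r \<Longrightarrow> \<bar>s - x z\<bar> < d \<Longrightarrow> (z, s) \<in> A"
      using compact_graph_neighbourhood[OF compact_sphere open_lessThan \<open>openin (top_of_set ?T) A\<close> x] by metis
    obtain f where f: "f holomorphic_on UNIV" "\<And>z. z \<in> sphere a r \<Longrightarrow> \<bar>x z - Re (f z)\<bar> < d"
      using circle_harmonic_approx[OF x(1) r d(1)] by metis
    have fA: "(z, Re (f z)) \<in> A" if "z \<in> sphere a r" for z
      using d(2)[OF that, of "Re (f z)"] f(2)[OF that] by (simp add: abs_minus_commute)
    define F where "F = (\<lambda>z. exp (f z))"
    have F: "F holomorphic_on UNIV" unfolding F_def using f(1) by (intro holomorphic_intros)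
    \<comment> \<open>On the circle |F| = exp (Re f) < 1 because the approximation stays among the
      admissible s < 0; the maximum principle carries this inside, so the curve remains over the
      open disc.\<close>
    have Flt: "cmod (F z) < 1" if z: "z \<in> cball a r" for z
    proof -
      have cont: "continuous_on (sphere a r) (\<lambda>z. cmod (F z))"
        using holomorphic_on_imp_continuous_on[OF F] by (intro continuous_intros) (auto elim: continuous_on_subset)
      have "sphere a r \<noteq> {}" using r by simp
      then obtain y where y: "y \<in> sphere a r" "\<And>w. w \<in> sphere a r \<Longrightarrow> cmod (F w) \<le> cmod (F y)"
        using continuous_attains_sup[OF compact_sphere _ cont] by blast
      have "cmod (F z) \<le> cmod (F y)"
      proof (rule maximum_modulus_frontier[of F "cball a r"])
        show "F holomorphic_on interior (cball a r)" using F by (rule holomorphic_on_subset) auto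
        show "continuous_on (closure (cball a r)) F"
          using holomorphic_on_imp_continuous_on[OF F] by (rule continuous_on_subset) auto
      qed (use y z r in auto)
      also have "\<dots> < 1" using fA[OF y(1)] by (simp add: F_def memA)
      finally show ?thesis .
    qed
    have psh: "psh_on (UNIV \<times> ball 0 1) (\<lambda>(z, \<tau>). ereal (FS_potential z) + S (\<kappa> z, \<tau>))"
      using S(1) \<kappa> by (auto simp: Phi_cand_def FS_psh_disc_def)
    have "(\<lambda>(z, \<tau>). ereal (FS_potential z) + S (\<kappa> z, \<tau>)) (a, F a) \<le> ereal (Re ((\<lambda>z. p z + of_real m * f z) a))"
    proof (rule psh_on_graph[OF psh r F Flt])
      \<comment> \<open>The linear term m s becomes m Re f along the curve, hence harmonic, and can
        be moved into the majorant.\<close>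
      show "(\<lambda>z. p z + of_real m * f z) holomorphic_on UNIV" using p f(1) by (intro holomorphic_intros)
      fix z assume z: "z \<in> sphere a r"
      have "S (\<kappa> z, F z) < ereal (Re (p z) - FS_potential z + m * Re (f z))"
        using fA[OF z] radial_exp[OF S(2), of "\<kappa> z" "f z"] by (simp add: memA F_def)
      then have "ereal (FS_potential z) + S (\<kappa> z, F z) < ereal (Re (p z) + m * Re (f z))"
        by (cases "S (\<kappa> z, F z)") auto
      then show "(\<lambda>(z, \<tau>). ereal (FS_potential z) + S (\<kappa> z, \<tau>)) (z, F z) < ereal (Re (p z + of_real m * f z))"
        by simp
    qed auto
    then have le: "ereal (FS_potential a) + S (\<kappa> a, of_real (exp (Re (f a)))) \<le> ereal (Re (p a) + m * Re (f a))"
      using radial_exp[OF S(2), of "\<kappa> a" "f a"] by (simp add: F_def)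
    have "Re (f a) < 0" using Flt[of a] r by (simp add: F_def)
    then have "min_slice S m (\<kappa> a) \<le> S (\<kappa> a, of_real (exp (Re (f a)))) + ereal (- m * Re (f a))"
      by (rule min_slice_le)
    then have "ereal (FS_potential a) + min_slice S m (\<kappa> a) \<le>
        ereal (FS_potential a) + (S (\<kappa> a, of_real (exp (Re (f a)))) + ereal (- m * Re (f a)))"
      by (rule add_left_mono)
    also have "\<dots> \<le> ereal (Re (p a))"
      using le by (cases "S (\<kappa> a, of_real (exp (Re (f a))))") auto
    finally show "ereal (FS_potential a) + min_slice S m (\<kappa> a) \<le> ereal (Re (p a))" .
  qed
qed

text \<open>The bound by \<phi> comes from s tending to 0 and semicontinuity at \<tau> = 1. The
  Lelong condition comes from evaluating the infimum at |\<tau>| = |z|, where the two-variable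
  singularity turns into a logarithm of |z| alone.\<close>

lemma min_slice_candidate:
  assumes S: "Phi_cand \<phi> S" "radial S"
  shows "psi_cand \<phi> t (min_slice S (2 * (1 - t)))"
proof (rule psi_candI[OF min_slice_FS_sh[OF S]])
  define m where "m = 2 * (1 - t)"
  fix x
  show "min_slice S (2 * (1 - t)) x \<le> ereal (\<phi> x)"
    unfolding m_def[symmetric]
  proof (rule ereal_le_epsilon2)
    fix e :: real assume e: "0 < e"
    have uscS: "usc_on P1_disc S" using S by (simp add: Phi_cand_def)
    have "continuous_map (top_of_set (cball 0 1)) P1_disc (\<lambda>\<tau>. (x, \<tau>))"
      by (intro continuous_map_pairedI) auto
    then have "usc_on (top_of_set (cball 0 1)) (\<lambda>\<tau>. S (x, \<tau>))" by (rule usc_on_compose[OF _ uscS])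
    then have "openin (top_of_set (cball 0 1)) {\<tau> \<in> cball 0 1. S (x, \<tau>) < ereal (\<phi> x + e / 2)}"
      unfolding usc_on_def by simp
    moreover have "S (x, 1) \<le> ereal (\<phi> x)" using S by (auto simp: Phi_cand_def)
    then have "S (x, 1) < ereal (\<phi> x + e / 2)" using e by (cases "S (x, 1)") auto
    then have "1 \<in> {\<tau> \<in> cball 0 1. S (x, \<tau>) < ereal (\<phi> x + e / 2)}" by simp
    ultimately obtain d where d: "0 < d" "\<And>\<tau>. \<tau> \<in> cball 0 1 \<Longrightarrow> dist \<tau> 1 < d \<Longrightarrow> S (x, \<tau>) < ereal (\<phi> x + e / 2)"
      unfolding openin_euclidean_subtopology_iff by blast
    have "((\<lambda>s. complex_of_real (exp s)) \<longlongrightarrow> of_real (exp 0)) (at_left 0)"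
      by (intro tendsto_intros)
    then have "\<forall>\<^sub>F s in at_left 0. dist (complex_of_real (exp s)) 1 < d" using d(1) by (auto dest: tendstoD)
    moreover have "((\<lambda>s. - m * s) \<longlongrightarrow> - m * 0) (at_left 0)" by (intro tendsto_intros)
    then have "\<forall>\<^sub>F s in at_left 0. - m * s < e / 2" using e by (intro order_tendstoD(2)) auto
    moreover have "\<forall>\<^sub>F s in at_left 0. s < (0::real)" by (simp add: eventually_at_filter)
    ultimately have "\<forall>\<^sub>F s in at_left 0. dist (complex_of_real (exp s)) 1 < d \<and> - m * s < e / 2 \<and> s < 0"
      by eventually_elim auto
    then obtain s where s: "dist (complex_of_real (exp s)) 1 < d" "- m * s < e / 2" "s < 0"
      using eventually_happens'[OF trivial_limit_at_left_real] by blast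
    have "min_slice S m x \<le> S (x, of_real (exp s)) + ereal (- m * s)" by (rule min_slice_le[OF s(3)])
    also have "\<dots> \<le> ereal (\<phi> x + e / 2) + ereal (e / 2)"
      using d(2)[of "of_real (exp s)"] s by (intro add_mono) auto
    finally show "min_slice S m x \<le> ereal (\<phi> x) + ereal e" by (simp add: add.commute)
  qed
next
  define m where "m = 2 * (1 - t)"
  obtain C d where d: "0 < d" "\<And>z \<tau>. cmod z < d \<Longrightarrow> cmod \<tau> < d \<Longrightarrow>
    S (Some z, \<tau>) \<le> ln_ext ((cmod z)\<^sup>2 + (cmod \<tau>)\<^sup>2) + ereal C"
    using S(1) lelong_ge_one_discE[of S] unfolding Phi_cand_def by metis
  have zero: "min_slice S m (Some 0) \<le> ereal (2 * t * s + C)" if s: "s < 0" "s < ln d" for s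
  proof -
    have "exp s < d" using s(2) d(1) by (metis exp_less_cancel_iff exp_ln)
    then have "S (Some 0, of_real (exp s)) \<le> ereal (2 * s + C)"
      using d(2)[of 0 "of_real (exp s)"] d(1) by (simp add: ln_ext_def ln_realpow)
    then have "S (Some 0, of_real (exp s)) + ereal (- m * s) \<le> ereal (2 * s + C) + ereal (- m * s)" by (rule add_right_mono)
    also have "\<dots> = ereal (2 * t * s + C)" by (simp add: m_def algebra_simps)
    finally show ?thesis using min_slice_le[OF s(1), of S m "Some 0"] by (rule order_trans[rotated])
  qed
  have "min_slice S m (Some z) \<le> ereal t * ln_ext ((cmod z)\<^sup>2) + ereal (ln 2 + C)" if z: "cmod z < min d 1" for z
  proof (cases "z = 0")
    case False
    \<comment> \<open>With |\<tau>| = |z| the singular bound is ln 2 + 2 s + C, and subtracting 2 (1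
      - t) s leaves the slope t against ln |z|^2.\<close>
    define s where "s = ln (cmod z)"
    have s: "s < 0" "exp s = cmod z" using z False by (auto simp: s_def)
    have "(cmod z)\<^sup>2 + (cmod z)\<^sup>2 = 2 * (cmod z)\<^sup>2" by simp
    then have "ln ((cmod z)\<^sup>2 + (cmod z)\<^sup>2) = ln 2 + 2 * s" using False by (simp add: ln_mult s_def ln_realpow)
    then have "S (Some z, of_real (exp s)) \<le> ereal (ln 2 + 2 * s + C)"
      using d(2)[of z "of_real (exp s)"] z False s(2) by (simp add: ln_ext_def)
    then have "S (Some z, of_real (exp s)) + ereal (- m * s) \<le> ereal (ln 2 + 2 * s + C) + ereal (- m * s)" by (rule add_right_mono)
    also have "\<dots> = ereal (t * (2 * s) + (ln 2 + C))" by (simp add: m_def algebra_simps)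
    also have "2 * s = ln ((cmod z)\<^sup>2)" using False by (simp add: s_def ln_realpow)
    finally show ?thesis using min_slice_le[OF s(1), of S m "Some z"] False by (simp add: ln_ext_def)
  next
    case True
    \<comment> \<open>At the origin the bound 2 t s + C drives the infimum to -\<infinity> for t >
      0, gives C for t = 0, and for t < 0 the right-hand side is \<infinity>.\<close>
    consider "0 < t" | "t = 0" | "t < 0" by linarith
    then show ?thesis
    proof cases
      case 1
      have "min_slice S m (Some 0) \<le> ereal M" for M
      proof -
        define s where "s = min (min (- 1) (ln d - 1)) ((M - C) / (2 * t))"
        have "s < 0" "s < ln d" "s \<le> (M - C) / (2 * t)" by (auto simp: s_def min_def)
        then have "2 * t * s + C \<le> M" using 1 by (simp add: pos_le_divide_eq mult_ac)
        then show ?thesis using zero[OF \<open>s < 0\<close> \<open>s < ln d\<close>] by (meson ereal_less_eq(3) order_trans)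
      qed
      then have "min_slice S m (Some 0) = -\<infinity>" by (rule ereal_bot)
      then show ?thesis using True by simp
    next
      case 2
      have "min_slice S m (Some 0) \<le> ereal C"
        using zero[of "min (- 1) (ln d - 1)"] 2 by (simp add: min_def split: if_splits)
      then show ?thesis using 2 True by (auto simp: zero_ereal_def[symmetric] intro: order_trans)
    qed (use True in \<open>auto simp: ln_ext_def\<close>)
  qed
  then show "lelong_ge (min_slice S (2 * (1 - t))) t"
    unfolding lelong_ge_def eventually_nhds_metric m_def using d(1)
    by (intro exI[of _ "ln 2 + C"] exI[of _ "min d 1"]) auto
qed

section \<open>Legendre duality\<close>

text \<open>A supporting line at s0 of the convex function s \<mapsto> S (x, exp s) bounds the
  infimum defining \<open>min_slice\<close> from below. As that slice is a candidate, the envelope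
  at the matching t inherits the bound.\<close>

lemma Phi_cand_le_SUP:
  assumes \<psi>: "Phi_cand \<phi> \<psi>" and \<tau>: "0 < cmod \<tau>" "cmod \<tau> < 1"
  shows "\<psi> (x, \<tau>) \<le> (SUP t. psi_env \<phi> t x + ereal ((1 - t) * ln ((cmod \<tau>)\<^sup>2)))" (is "_ \<le> ?R")
proof -
  define S where "S = rot_sup \<psi>"
  have S: "Phi_cand \<phi> S" "radial S"
    unfolding S_def by (rule Phi_cand_rot_sup[OF \<psi>]) (simp add: radial_def rot_sup_cmod[symmetric])
  define f where "f s = S (x, of_real (exp s))" for s :: real
  define s0 where "s0 = ln (cmod \<tau>)"
  have s0: "s0 < 0" "exp s0 = cmod \<tau>" using \<tau> by (auto simp: s0_def)
  have lin: "f s \<le> ereal (\<alpha> + \<beta> * s)"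
    if "s1 \<le> s" "s \<le> s2" "s2 < 0" "f s1 \<le> ereal (\<alpha> + \<beta> * s1)" "f s2 \<le> ereal (\<alpha> + \<beta> * s2)" for s1 s s2 \<alpha> \<beta>
    using Phi_cand_convex_ln[OF S that(1-3)] that(4,5) unfolding f_def by blast
  have "\<psi> (x, \<tau>) \<le> S (x, \<tau>)" unfolding S_def using le_rot_sup[of 1 \<psi> x \<tau>] by simp
  also have "S (x, \<tau>) = f s0" unfolding f_def s0(2) by (rule radialD[OF S(2)])
  also have "f s0 \<le> ?R"
  proof (cases "f s0 = -\<infinity>")
    case False
    have top: "f s \<noteq> \<infinity>" if "s < 0" for s
    proof -
      have "complex_of_real (exp s) \<in> cball 0 1" using that by simp
      then show ?thesis using S(1) unfolding Phi_cand_def usc_on_def f_def by auto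
    qed
    have bot: "f s \<noteq> -\<infinity>" if s: "s < 0" for s
    proof
      assume mi: "f s = -\<infinity>"
      have "s \<noteq> s0" using mi False by auto
      define s' where "s' = (if s < s0 then s0 / 2 else s0 - 1)"
      have s': "s' < 0" "(s < s0 \<and> s0 < s') \<or> (s' < s0 \<and> s0 < s)"
        using s0(1) \<open>s \<noteq> s0\<close> by (auto simp: s'_def)
      obtain b where b: "f s' \<le> ereal b" using top[OF s'(1)] by (cases "f s'") auto
      have "f s0 \<le> ereal M" for M
      proof -
        \<comment> \<open>The affine function through (s', b) and (s0, M) majorises at both ends,
          whatever M is, because \<open>f\<close> is -\<infinity> at s. So -\<infinity> at one point
          would force -\<infinity> at s0.\<close>
        define \<beta> where "\<beta> = (M - b) / (s0 - s')"
        have "\<beta> * (s0 - s') = M - b" using s'(2) by (auto simp: \<beta>_def)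
        then have 1: "b - \<beta> * s' + \<beta> * s0 = M" by (simp add: algebra_simps)
        have 2: "f s' \<le> ereal (b - \<beta> * s' + \<beta> * s')" "f s \<le> ereal (b - \<beta> * s' + \<beta> * s)" using b mi by auto
        show ?thesis
          using s'(2) lin[of s s0 s' "b - \<beta> * s'" \<beta>] lin[of s' s0 s "b - \<beta> * s'" \<beta>] 1 2 s s'(1) by auto
      qed
      then show False using False ereal_bot by blast
    qed
    define F where "F s = real_of_ereal (f s)" for s
    have F: "f s = ereal (F s)" if "s < 0" for s
      unfolding F_def using top[OF that] bot[OF that] by (cases "f s") auto
    have "convex_on {..<0} F"
    proof (rule convex_on_linorderI)
      fix u x y :: real assume u: "0 < u" "u < 1" and xy: "x \<in> {..<0}" "y \<in> {..<0}" "x < y"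
      let ?s = "(1 - u) *\<^sub>R x + u *\<^sub>R y"
      define \<beta> where "\<beta> = (F y - F x) / (y - x)"
      have \<beta>: "\<beta> * (y - x) = F y - F x" using xy(3) by (simp add: \<beta>_def)
      have s: "?s = x + u * (y - x)" by (simp add: algebra_simps)
      have "u * (y - x) \<le> 1 * (y - x)" using u xy by (intro mult_right_mono) auto
      moreover have "0 \<le> u * (y - x)" using u xy by simp
      ultimately have sl: "x \<le> ?s" "?s \<le> y" unfolding s by auto
      have "f ?s \<le> ereal (F x - \<beta> * x + \<beta> * ?s)"
        by (rule lin[OF sl]) (use xy F \<beta> in \<open>auto simp: algebra_simps\<close>)
      also have "F x - \<beta> * x + \<beta> * ?s = F x + u * (\<beta> * (y - x))" unfolding s by (simp add: algebra_simps)
      also have "\<dots> = (1 - u) * F x + u * F y" unfolding \<beta> by (simp add: algebra_simps)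
      finally show "F ?s \<le> (1 - u) * F x + u * F y" using F[of ?s] sl xy by simp
    qed simp
    moreover have "s0 \<in> interior {..<0}" using s0 by (simp add: interior_open)
    ultimately obtain m where m: "\<And>s. s < 0 \<Longrightarrow> F s0 + m * (s - s0) \<le> F s"
      using convex_le_Inf_differential[of "{..<0}" F s0] by (metis lessThan_iff)
    define t where "t = 1 - m / 2"
    have mt: "2 * (1 - t) = m" by (simp add: t_def)
    have "ereal (F s0 - m * s0) \<le> min_slice S m x"
      unfolding min_slice_def
    proof (rule INF_greatest)
      fix s :: real assume "s \<in> {..<0}"
      then show "ereal (F s0 - m * s0) \<le> S (x, of_real (exp s)) + ereal (- m * s)"
        using F[of s] m[of s] by (simp add: f_def algebra_simps)
    qed
    also have "\<dots> \<le> psi_env \<phi> t x"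
      using psi_cand_le_env[OF min_slice_candidate[OF S, of t]] by (simp only: mt)
    finally have "ereal (F s0 - m * s0) + ereal (m * s0) \<le> psi_env \<phi> t x + ereal (m * s0)" by (rule add_right_mono)
    also have "m * s0 = (1 - t) * ln ((cmod \<tau>)\<^sup>2)"
      using \<tau> by (simp add: s0_def ln_realpow mt[symmetric] algebra_simps)
    finally have "f s0 \<le> psi_env \<phi> t x + ereal ((1 - t) * ln ((cmod \<tau>)\<^sup>2))"
      using F[OF s0(1)] by (simp add: \<open>m * s0 = (1 - t) * ln ((cmod \<tau>)\<^sup>2)\<close>[symmetric])
    also have "\<dots> \<le> ?R" by (rule SUP_upper) simp
    finally show ?thesis .
  qed simp
  finally show ?thesis .
qed

text \<open>Product candidates settle t in [0,1]. For t < 0 the envelope is still \<phi> while (1 -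
  t) ln |\<tau>|^2 is at most its value at t = 0, and for t > 1 the left-hand side is
  -\<infinity>.\<close>

lemma psi_env_le_Phi_env:
  assumes \<phi>: "kaehler_potential \<phi>" and \<tau>: "0 < cmod \<tau>" "cmod \<tau> \<le> 1"
  shows "psi_env \<phi> t x + ereal ((1 - t) * ln ((cmod \<tau>)\<^sup>2)) \<le> Phi_env \<phi> (x, \<tau>)"
proof -
  let ?L = "ln ((cmod \<tau>)\<^sup>2)"
  have L: "?L \<le> 0" using \<tau> by (simp add: ln_realpow)
  have mid: "psi_env \<phi> t x + ereal ((1 - t) * ?L) \<le> Phi_env \<phi> (x, \<tau>)" if t: "0 \<le> t" "t \<le> 1" for t
  proof -
    have "psi_env \<phi> t x \<le> Phi_env \<phi> (x, \<tau>) - ereal ((1 - t) * ?L)"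
    proof (rule psi_env_leI)
      fix \<psi> assume "psi_cand \<phi> t \<psi>"
      from Phi_cand_le_env[OF product_candidate[OF this t], of "(x, \<tau>)"]
      show "\<psi> x \<le> Phi_env \<phi> (x, \<tau>) - ereal ((1 - t) * ?L)"
        using \<tau> by (simp add: ln_ext_def ereal_le_minus)
    qed
    then show ?thesis by (simp add: ereal_le_minus)
  qed
  consider "t < 0" | "0 \<le> t" "t \<le> 1" | "1 < t" by linarith
  then show ?thesis
  proof cases
    case 1
    have "(1 - t) * ?L \<le> 1 * ?L" using 1 L by (intro mult_right_mono_neg) auto
    then have "psi_env \<phi> t x + ereal ((1 - t) * ?L) \<le> psi_env \<phi> 0 x + ereal ((1 - 0) * ?L)"
      using psi_env_nonpos[OF \<phi>, of t] psi_env_nonpos[OF \<phi>, of 0] 1 by simp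
    also have "\<dots> \<le> Phi_env \<phi> (x, \<tau>)" by (rule mid) auto
    finally show ?thesis .
  next
    case 3
    then show ?thesis using psi_env_gt_1[OF \<phi>] by simp
  qed (rule mid)
qed

text \<open>Supporting lines from above for the concave function of t, up to the slack between its
  value and c. The slope s will serve as ln |\<tau>|^2, so it must be nonpositive; monotonicity in t
  makes this possible.\<close>

lemma psi_env_affine_majorant:
  assumes \<phi>: "kaehler_potential \<phi>" and c: "psi_env \<phi> t x < ereal c"
  obtains s where "s \<le> 0" "\<And>t'. psi_env \<phi> t' x \<le> ereal (c + (t' - t) * s)"
proof -
  note result = that
  \<comment> \<open>Covers every t at or beyond which the envelope is -\<infinity>: the line through
    (t, c) is so steep that it exceeds \<phi> x to the left of t1, while between t1 and t it stays
    above c.\<close>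
  have steep: thesis
    if t1: "t1 < t" and right: "\<And>t'. t1 < t' \<Longrightarrow> psi_env \<phi> t' x = -\<infinity> \<or> t' \<le> t \<and> psi_env \<phi> t' x \<le> ereal c" for t1
  proof -
    define s where "s = - \<bar>\<phi> x - c\<bar> / (t - t1)"
    have s: "s \<le> 0" "(t - t1) * s = - \<bar>\<phi> x - c\<bar>" using t1 by (auto simp: s_def divide_nonpos_pos)
    show thesis
    proof (rule result[OF s(1)])
      fix t'
      show "psi_env \<phi> t' x \<le> ereal (c + (t' - t) * s)"
      proof (cases "t1 < t'")
        case True
        then consider "psi_env \<phi> t' x = -\<infinity>" | "t' \<le> t" "psi_env \<phi> t' x \<le> ereal c" using right by blast
        then show ?thesis
        proof cases
          case 2
          then have "0 \<le> (t' - t) * s" using s(1) by (intro mult_nonpos_nonpos) auto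
          then have "ereal c \<le> ereal (c + (t' - t) * s)" by simp
          with 2(2) show ?thesis by (rule order_trans)
        qed simp
      next
        case False
        then have "(t1 - t) * s \<le> (t' - t) * s" using s(1) by (intro mult_right_mono_neg) auto
        moreover have "(t1 - t) * s = \<bar>\<phi> x - c\<bar>" using s(2) by (simp add: algebra_simps)
        ultimately have "\<phi> x \<le> c + (t' - t) * s" by linarith
        then show ?thesis using psi_env_le[of \<phi> t' x] by (meson ereal_less_eq(3) order_trans)
      qed
    qed
  qed
  consider "t \<le> 0" | "1 < t" | "0 < t" "x = Some 0" | "t = 1" "x \<noteq> Some 0" | "0 < t" "t < 1" "x \<noteq> Some 0" by linarith
  then show thesis
  proof cases
    case 1
    show thesis
    proof (rule that[of 0])
      fix t'
      have "psi_env \<phi> t' x \<le> psi_env \<phi> t x" using psi_env_le psi_env_nonpos[OF \<phi> 1] by metis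
      then show "psi_env \<phi> t' x \<le> ereal (c + (t' - t) * 0)" using c by simp
    qed simp
  next
    case 2
    then show thesis using psi_env_gt_1[OF \<phi>] by (intro steep[of 1]) auto
  next
    case 3
    then show thesis using psi_env_at_0 by (intro steep[of 0]) auto
  next
    case 4
    obtain t1 where t1: "0 < t1" "t1 < 1" "psi_env \<phi> t1 x < ereal c"
      using psi_env_left_limit[OF \<phi>] c 4(1) by blast
    show thesis
    proof (rule steep[of t1])
      fix t' assume "t1 < t'"
      then have "psi_env \<phi> t' x \<le> psi_env \<phi> t1 x" by (intro psi_env_antimono) simp
      then show "psi_env \<phi> t' x = -\<infinity> \<or> t' \<le> t \<and> psi_env \<phi> t' x \<le> ereal c"
        using t1(3) psi_env_gt_1[OF \<phi>, of t' x] 4(1) by (cases "t' \<le> 1") auto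
    qed (use t1 4 in auto)
  next
    case 5
    obtain G where G: "\<And>t. 0 \<le> t \<Longrightarrow> t \<le> 1 \<Longrightarrow> psi_env \<phi> t x = ereal (G t)" "convex_on {0..1} (\<lambda>t. - G t)"
      using psi_env_concave[OF \<phi> 5(3)] by metis
    have "t \<in> interior {0..1}" using 5 by simp
    then obtain m where m: "\<And>t'. t' \<in> {0..1} \<Longrightarrow> - G t + m * (t' - t) \<le> - G t'"
      using convex_le_Inf_differential[OF G(2)] by metis
    \<comment> \<open>Comparing with the supporting line at 0 turns monotonicity into the sign of
      the slope.\<close>
    have "ereal (G t) \<le> ereal (G 0)" using psi_env_antimono[of 0 t \<phi> x] G(1) 5 by simp
    then have "0 \<le> m * t" using m[of 0] by simp
    then have m0: "0 \<le> m" using 5(1) by (simp add: zero_le_mult_iff)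
    have Gc: "G t < c" using c G(1)[of t] 5 by simp
    show thesis
    proof (rule that[of "- m"])
      fix t' :: real
      consider "t' < 0" | "t' \<in> {0..1}" | "1 < t'" by (meson atLeastAtMost_iff not_le)
      then show "psi_env \<phi> t' x \<le> ereal (c + (t' - t) * - m)"
      proof cases
        case 1
        have "psi_env \<phi> t' x = ereal (G 0)"
          using psi_env_nonpos[OF \<phi>, of t' x] psi_env_nonpos[OF \<phi>, of 0 x] G(1)[of 0] 1 by simp
        moreover have "G 0 \<le> G t + m * t" using m[of 0] by simp
        moreover have "m * t' \<le> 0" using m0 1 by (simp add: mult_nonneg_nonpos)
        ultimately show ?thesis using Gc by (simp add: algebra_simps)
      next
        case 2
        then show ?thesis using G(1)[of t'] m[of t'] Gc by (simp add: algebra_simps)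
      next
        case 3
        then show ?thesis using psi_env_gt_1[OF \<phi>] by simp
      qed
    qed (use m0 in simp)
  qed
qed

lemma Phi_env_eq_SUP:
  assumes \<phi>: "kaehler_potential \<phi>" and \<tau>: "0 < cmod \<tau>" "cmod \<tau> \<le> 1"
  shows "Phi_env \<phi> (x, \<tau>) = (SUP t. psi_env \<phi> t x + ereal ((1 - t) * ln ((cmod \<tau>)\<^sup>2)))" (is "_ = ?R")
proof (rule antisym)
  show "Phi_env \<phi> (x, \<tau>) \<le> ?R"
  proof (rule Phi_env_leI)
    fix \<psi> assume \<psi>: "Phi_cand \<phi> \<psi>"
    show "\<psi> (x, \<tau>) \<le> ?R"
    proof (cases "cmod \<tau> = 1")
      case True
      \<comment> \<open>On the boundary circle the logarithm vanishes and the term t = 0 is \<phi>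
        itself, so no convexity is involved.\<close>
      then have "\<psi> (x, \<tau>) \<le> psi_env \<phi> 0 x + ereal ((1 - 0) * ln ((cmod \<tau>)\<^sup>2))"
        using \<psi> psi_env_nonpos[OF \<phi>, of 0 x] by (simp add: Phi_cand_def)
      also have "\<dots> \<le> ?R" by (rule SUP_upper) simp
      finally show ?thesis .
    next
      case False
      then show ?thesis using \<tau> by (intro Phi_cand_le_SUP[OF \<psi>]) auto
    qed
  qed
  show "?R \<le> Phi_env \<phi> (x, \<tau>)"
    by (rule SUP_least) (rule psi_env_le_Phi_env[OF \<phi> \<tau>])
qed

lemma psi_env_eq_INF:
  assumes \<phi>: "kaehler_potential \<phi>"
  shows "psi_env \<phi> t x = (INF \<tau> \<in> {\<tau>::complex. 0 < cmod \<tau> \<and> cmod \<tau> \<le> 1}.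
           Phi_env \<phi> (x, \<tau>) - ereal ((1 - t) * ln ((cmod \<tau>)\<^sup>2)))" (is "_ = ?I")
proof (rule antisym)
  show "psi_env \<phi> t x \<le> ?I"
  proof (rule INF_greatest)
    fix \<tau> :: complex assume "\<tau> \<in> {\<tau>. 0 < cmod \<tau> \<and> cmod \<tau> \<le> 1}"
    then show "psi_env \<phi> t x \<le> Phi_env \<phi> (x, \<tau>) - ereal ((1 - t) * ln ((cmod \<tau>)\<^sup>2))"
      using psi_env_le_Phi_env[OF \<phi>, of \<tau> t x] by (simp add: ereal_le_minus)
  qed
  have le: "?I \<le> ereal c" if c: "psi_env \<phi> t x < ereal c" for c
  proof -
    obtain s where s: "s \<le> 0" "\<And>t'. psi_env \<phi> t' x \<le> ereal (c + (t' - t) * s)"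
      using psi_env_affine_majorant[OF \<phi> c] by metis
    \<comment> \<open>The slope of the affine majorant becomes ln |\<tau>|^2. All terms of the
      supremum for this \<tau> then have the same upper bound c + (1 - t) s.\<close>
    define \<tau> where "\<tau> = complex_of_real (exp (s / 2))"
    have \<tau>: "0 < cmod \<tau>" "cmod \<tau> \<le> 1" "ln ((cmod \<tau>)\<^sup>2) = s" using s(1) by (auto simp: \<tau>_def ln_realpow)
    have "Phi_env \<phi> (x, \<tau>) \<le> ereal (c + (1 - t) * s)"
      unfolding Phi_env_eq_SUP[OF \<phi> \<tau>(1,2)] \<tau>(3)
    proof (rule SUP_least)
      fix t'
      have "psi_env \<phi> t' x + ereal ((1 - t') * s) \<le> ereal (c + (t' - t) * s) + ereal ((1 - t') * s)"
        using s(2) by (rule add_right_mono)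
      also have "\<dots> = ereal (c + (1 - t) * s)" by (simp add: algebra_simps)
      finally show "psi_env \<phi> t' x + ereal ((1 - t') * s) \<le> ereal (c + (1 - t) * s)" .
    qed
    then have "Phi_env \<phi> (x, \<tau>) - ereal ((1 - t) * ln ((cmod \<tau>)\<^sup>2)) \<le> ereal c"
      unfolding \<tau>(3) by (cases "Phi_env \<phi> (x, \<tau>)") auto
    moreover have "\<tau> \<in> {\<tau>. 0 < cmod \<tau> \<and> cmod \<tau> \<le> 1}" using \<tau>(1,2) by blast
    ultimately show ?thesis by (rule INF_lower2[rotated])
  qed
  show "?I \<le> psi_env \<phi> t x"
  proof (rule ccontr)
    assume "\<not> ?I \<le> psi_env \<phi> t x"
    then have "psi_env \<phi> t x < ?I" by (simp only: not_le)
    then obtain c where c: "psi_env \<phi> t x < ereal c" "ereal c < ?I" using ereal_dense2 by blast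
    show False using le[OF c(1)] c(2) by (simp only: not_le[symmetric] simp_thms)
  qed
qed

theorem theorem2p7:
  fixes \<phi> :: "P1 \<Rightarrow> real"
  assumes "kaehler_potential \<phi>"
  shows "(\<forall>(z::P1) (t::real). psi_env \<phi> t z =
            (INF \<tau> \<in> {\<tau>::complex. 0 < cmod \<tau> \<and> cmod \<tau> \<le> 1}.
               Phi_env \<phi> (z, \<tau>) - ereal ((1 - t) * ln ((cmod \<tau>)\<^sup>2))))
       \<and> (\<forall>(z::P1) (\<tau>::complex). 0 < cmod \<tau> \<and> cmod \<tau> \<le> 1 \<longrightarrow>
            Phi_env \<phi> (z, \<tau>) =
              (SUP t::real. psi_env \<phi> t z + ereal ((1 - t) * ln ((cmod \<tau>)\<^sup>2))))"
  using psi_env_eq_INF[OF assms] Phi_env_eq_SUP[OF assms] by blast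

end
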